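(* Let $M$ and $M'$ be real-analytic generic submanifolds through $0$ in $\mathbb{C}^N$ and $\mathbb{C}^{N'}$, respectively, with $M$ of finite type at $0$. Let $\mathcal F$ be a class of germs at $0$ of holomorphic mappings $(\mathbb{C}^N,0)\to(\mathbb{C}^{N'},0)$ sending $M$ into $M'$ such that $\mathcal F$ satisfies the finite jet determination property at $0$. Then there exists an integer $k>0$ with the following property. Let $\tilde z\colon(\mathbb{C}^{N'},0)\to(\Sigma'_0,0)$ be a germ at $0$ of a holomorphic submersion, where $\Sigma'_0$ is the Segre variety of $M'$ at $0$, such that $\tilde z^{-1}(0)$ is transversal to $\Sigma'_0$ at $0$. If $H^1,H^2\in\mathcal F$ and $j^k_0(\tilde z\circ H^1)=j^k_0(\tilde z\circ H^2)$, then $H^1\equiv H^2$.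
   Context: A real-analytic generic submanifold $M\subset\mathbb{C}^N$ of (real) codimension $d$ through $0$ is given near $0$ by $\rho_1(Z,\bar Z)=\dots=\rho_d(Z,\bar Z)=0$, where $\rho(Z,\zeta)=(\rho_1,\ldots,\rho_d)(Z,\zeta)$ is a $\mathbb{C}^d$-valued holomorphic function near $0\in\mathbb{C}^N\times\mathbb{C}^N$ with $\rho(Z,\zeta)=\overline{\rho(\bar\zeta,\bar Z)}$ and $\partial_Z\rho_1\wedge\cdots\wedge\partial_Z\rho_d\neq0$ near $0$. $M$ is of finite type at $p\in M$ (in the sense of Kohn and Bloom–Graham) if the complex Lie algebra $\mathfrak g_M$ generated by all smooth $(1,0)$ and $(0,1)$ vector fields tangent to $M$ satisfies $\mathfrak g_M(p)=\mathbb{C}T_pM$, the complexified tangent space of $M$ at $p$. For a sufficiently small neighborhood $U$ of $0$ and $p$ close to $0$, the Segre variety of $M$ at $p$ is $\Sigma_p:=\{Z\in U:\rho(Z,\bar p)=0\}$, a complex submanifold of dimension $N-d$. $\Sigma'_p$ denotes the Segre variety of $M'$. A class $\mathcal F$ of germs of holomorphic mappings $(X,x)\to(Y,y)$ between complex manifolds satisfies the finite jet determination property at $x$ if there exists an integer $k\ge0$ such that for any pair $H^1,H^2\in\mathcal F$, $j^k_xH^1=j^k_xH^2$ implies $H^1\equiv H^2$. Here $j^k_xH$ denotes the $k$-jet of $H$ at $x$. "Sending $M$ into $M'$" is understood in the sense of germs at $0$. *)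

theory Defs
  imports "HOL-Analysis.Analysis"
begin

section \<open>Germs of holomorphic maps and their jets\<close>

text \<open>Germs are represented by total functions, of which only the behaviour near the base
  point matters.\<close>

definition holomorphic_near :: "(complex^'n \<Rightarrow> complex^'m) \<Rightarrow> complex^'n \<Rightarrow> bool" where
  "holomorphic_near f a \<longleftrightarrow>
     (\<forall>\<^sub>F x in nhds a. \<exists>D. Vector_Spaces.linear (*s) (*s) D \<and> (f has_derivative D) (at x))"

text \<open>Joint holomorphy of a scalar function of \<open>(Z, \<zeta>)\<close>: the real differential is the sum of a
  complex linear form in \<open>dZ\<close> and a complex linear form in \<open>d\<zeta>\<close>.\<close>

definition holomorphic2_near ::
    "(complex^'n \<Rightarrow> complex^'n \<Rightarrow> complex) \<Rightarrow> (complex^'n) \<times> (complex^'n) \<Rightarrow> bool" where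
  "holomorphic2_near r a \<longleftrightarrow>
     (\<forall>\<^sub>F w in nhds a. \<exists>A B. Vector_Spaces.linear (*s) (*) A \<and> Vector_Spaces.linear (*s) (*) B \<and>
        ((\<lambda>(Z, \<zeta>). r Z \<zeta>) has_derivative (\<lambda>(u, v). A u + B v)) (at w))"

text \<open>For holomorphic \<open>f\<close>, the value of the real differential on the \<open>j\<close>-th unit vector is
  \<open>\<partial>f/\<partial>Z\<^sub>j\<close>.\<close>

primrec partial_derivs :: "'n list \<Rightarrow> (complex^'n \<Rightarrow> complex^'m) \<Rightarrow> complex^'n \<Rightarrow> complex^'m" where
  "partial_derivs [] f = f"
| "partial_derivs (j # js) f =
     (\<lambda>x. frechet_derivative (partial_derivs js f) (at x) (axis j 1))"

text \<open>The \<open>k\<close>-jet is the family of all partial derivatives of order at most \<open>k\<close>. A derivative of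
  order \<open>l\<close> is indexed by a list of \<open>l\<close> coordinates, so that each multi-index occurs repeatedly.\<close>

definition jet ::
    "nat \<Rightarrow> (complex^'n \<Rightarrow> complex^'m) \<Rightarrow> complex^'n \<Rightarrow> 'n list \<Rightarrow> complex^'m" where
  "jet k f x = (\<lambda>js. if length js \<le> k then partial_derivs js f x else 0)"

definition germ_eq :: "(complex^'n \<Rightarrow> complex^'m) \<Rightarrow> (complex^'n \<Rightarrow> complex^'m) \<Rightarrow> complex^'n \<Rightarrow> bool"
  where "germ_eq f g x \<longleftrightarrow> (\<forall>\<^sub>F Z in nhds x. f Z = g Z)"

definition finite_jet_determination ::
    "(complex^'n \<Rightarrow> complex^'m) set \<Rightarrow> complex^'n \<Rightarrow> bool" where
  "finite_jet_determination F x \<longleftrightarrow>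
     (\<exists>k. \<forall>H1\<in>F. \<forall>H2\<in>F. jet k H1 x = jet k H2 x \<longrightarrow> germ_eq H1 H2 x)"


section \<open>Real-analytic generic submanifolds\<close>

definition vcnj :: "complex^'n \<Rightarrow> complex^'n" where
  "vcnj Z = (\<chi> j. cnj (Z $ j))"

text \<open>\<open>dZ r Z \<zeta>\<close> is the complex linear form \<open>\<partial>\<^sub>Z r\<close> at \<open>(Z, \<zeta>)\<close>, for holomorphic \<open>r\<close>.\<close>

definition dZ ::
    "(complex^'n \<Rightarrow> complex^'n \<Rightarrow> complex) \<Rightarrow> complex^'n \<Rightarrow> complex^'n \<Rightarrow> complex^'n \<Rightarrow> complex" where
  "dZ r Z \<zeta> = frechet_derivative (\<lambda>Z. r Z \<zeta>) (at Z)"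

text \<open>The exterior product of the linear forms \<open>\<phi> 0, \<dots>, \<phi> (d - 1)\<close>, as an alternating form in
  the vectors \<open>v 0, \<dots>, v (d - 1)\<close>.\<close>

definition wedge :: "nat \<Rightarrow> (nat \<Rightarrow> complex^'n \<Rightarrow> complex) \<Rightarrow> (nat \<Rightarrow> complex^'n) \<Rightarrow> complex" where
  "wedge d \<phi> = (\<lambda>v. \<Sum>\<pi> | \<pi> permutes {..<d}. of_int (sign \<pi>) * (\<Prod>i<d. \<phi> i (v (\<pi> i))))"

text \<open>\<open>M\<close> is, near \<open>0 \<in> M\<close>, a real-analytic generic submanifold of codimension \<open>d\<close> with (complexified)
  defining functions \<open>\<rho> 0, \<dots>, \<rho> (d - 1)\<close>.\<close>

definition generic_submanifold ::
    "nat \<Rightarrow> (nat \<Rightarrow> complex^'n \<Rightarrow> complex^'n \<Rightarrow> complex) \<Rightarrow> (complex^'n) set \<Rightarrow> bool" where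
  "generic_submanifold d \<rho> M \<longleftrightarrow>
     0 \<in> M \<and>
     (\<forall>i<d. holomorphic2_near (\<rho> i) (0, 0)) \<and>
     (\<forall>\<^sub>F (Z, \<zeta>) in nhds (0, 0). \<forall>i<d. \<rho> i Z \<zeta> = cnj (\<rho> i (vcnj \<zeta>) (vcnj Z))) \<and>
     (\<forall>\<^sub>F (Z, \<zeta>) in nhds (0, 0). wedge d (\<lambda>i. dZ (\<rho> i) Z \<zeta>) \<noteq> (\<lambda>_. 0)) \<and>
     (\<forall>\<^sub>F Z in nhds 0. Z \<in> M \<longleftrightarrow> (\<forall>i<d. \<rho> i Z (vcnj Z) = 0))"


section \<open>Finite type\<close>

primrec Ck_on ::
    "nat \<Rightarrow> ('a::real_normed_vector \<Rightarrow> 'b::real_normed_vector) \<Rightarrow> 'a set \<Rightarrow> bool" where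
  "Ck_on 0 f S \<longleftrightarrow> continuous_on S f"
| "Ck_on (Suc k) f S \<longleftrightarrow>
     (\<forall>x\<in>S. f differentiable (at x)) \<and> (\<forall>v. Ck_on k (\<lambda>x. frechet_derivative f (at x) v) S)"

definition smooth_near :: "('a::real_normed_vector \<Rightarrow> 'b::real_normed_vector) \<Rightarrow> 'a \<Rightarrow> bool" where
  "smooth_near f a \<longleftrightarrow> (\<exists>S. open S \<and> a \<in> S \<and> (\<forall>k. Ck_on k f S))"

text \<open>The Wirtinger derivatives \<open>\<partial>f/\<partial>z\<^sub>j\<close> and \<open>\<partial>f/\<partial>\<bar>z\<^sub>j\<close>.\<close>

definition wirtinger :: "'n \<Rightarrow> (complex^'n \<Rightarrow> complex) \<Rightarrow> complex^'n \<Rightarrow> complex" where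
  "wirtinger j f p = (frechet_derivative f (at p) (axis j 1)
                       - \<i> * frechet_derivative f (at p) (axis j \<i>)) / 2"

definition wirtinger_bar :: "'n \<Rightarrow> (complex^'n \<Rightarrow> complex) \<Rightarrow> complex^'n \<Rightarrow> complex" where
  "wirtinger_bar j f p = (frechet_derivative f (at p) (axis j 1)
                           + \<i> * frechet_derivative f (at p) (axis j \<i>)) / 2"

text \<open>A complex tangent vector \<open>\<Sum>\<^sub>j a\<^sub>j \<partial>/\<partial>z\<^sub>j + b\<^sub>j \<partial>/\<partial>\<bar>z\<^sub>j\<close> of \<open>\<complex>\<^sup>N\<close> is represented by the pair
  \<open>(a, b)\<close>, and a complex vector field by the function taking a point to its coefficients there.\<close>

type_synonym 'n cvector = "(complex^'n) \<times> (complex^'n)"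

type_synonym 'n cfield = "complex^'n \<Rightarrow> 'n cvector"

definition cvector_apply :: "('n::finite) cvector \<Rightarrow> (complex^'n \<Rightarrow> complex) \<Rightarrow> complex^'n \<Rightarrow> complex"
  where "cvector_apply x f p =
     (\<Sum>j\<in>UNIV. fst x $ j * wirtinger j f p + snd x $ j * wirtinger_bar j f p)"

definition lie_bracket :: "('n::finite) cfield \<Rightarrow> 'n cfield \<Rightarrow> 'n cfield" where
  "lie_bracket X Y p =
     ((\<chi> k. cvector_apply (X p) (\<lambda>q. fst (Y q) $ k) p - cvector_apply (Y p) (\<lambda>q. fst (X q) $ k) p),
      (\<chi> k. cvector_apply (X p) (\<lambda>q. snd (Y q) $ k) p - cvector_apply (Y p) (\<lambda>q. snd (X q) $ k) p))"

text \<open>\<open>\<complex>T\<^sub>pM\<close>: the complex tangent vectors at \<open>p \<in> M\<close> annihilating the (real-valued) local equations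
  \<open>\<rho>\<^sub>i(Z, \<bar>Z) = 0\<close> of \<open>M\<close>.\<close>

definition complexified_tangent_space ::
    "nat \<Rightarrow> (nat \<Rightarrow> complex^'n \<Rightarrow> complex^'n \<Rightarrow> complex) \<Rightarrow> complex^'n \<Rightarrow> ('n::finite) cvector set" where
  "complexified_tangent_space d \<rho> p =
     {x. \<forall>i<d. cvector_apply x (\<lambda>Z. \<rho> i Z (vcnj Z)) p = 0}"

definition tangent_field ::
    "nat \<Rightarrow> (nat \<Rightarrow> complex^'n \<Rightarrow> complex^'n \<Rightarrow> complex) \<Rightarrow> (complex^'n) set \<Rightarrow> ('n::finite) cfield \<Rightarrow> bool"
  where "tangent_field d \<rho> M X \<longleftrightarrow>
     (\<forall>\<^sub>F p in nhds 0. p \<in> M \<longrightarrow> X p \<in> complexified_tangent_space d \<rho> p)"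

text \<open>The complex Lie algebra generated by the germs at \<open>0\<close> of smooth \<open>(1,0)\<close> and \<open>(0,1)\<close> vector fields
  tangent to \<open>M\<close>. The fields are given on a neighbourhood of \<open>0\<close> in the ambient space: every smooth
  \<open>(1,0)\<close> or \<open>(0,1)\<close> field on \<open>M\<close> extends to one, and the bracket of fields tangent to \<open>M\<close> depends
  along \<open>M\<close> only on their restrictions to \<open>M\<close>.\<close>

inductive_set cr_lie_algebra ::
    "nat \<Rightarrow> (nat \<Rightarrow> complex^'n \<Rightarrow> complex^'n \<Rightarrow> complex) \<Rightarrow> (complex^'n) set \<Rightarrow> ('n::finite) cfield set"
  for d \<rho> M where
  field_1_0: "\<lbrakk>smooth_near X 0; tangent_field d \<rho> M X; \<forall>\<^sub>F p in nhds 0. snd (X p) = 0\<rbrakk>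
      \<Longrightarrow> X \<in> cr_lie_algebra d \<rho> M"
| field_0_1: "\<lbrakk>smooth_near X 0; tangent_field d \<rho> M X; \<forall>\<^sub>F p in nhds 0. fst (X p) = 0\<rbrakk>
      \<Longrightarrow> X \<in> cr_lie_algebra d \<rho> M"
| add: "\<lbrakk>X \<in> cr_lie_algebra d \<rho> M; Y \<in> cr_lie_algebra d \<rho> M\<rbrakk>
      \<Longrightarrow> (\<lambda>p. X p + Y p) \<in> cr_lie_algebra d \<rho> M"
| scale: "X \<in> cr_lie_algebra d \<rho> M
      \<Longrightarrow> (\<lambda>p. (c *s fst (X p), c *s snd (X p))) \<in> cr_lie_algebra d \<rho> M"
| bracket: "\<lbrakk>X \<in> cr_lie_algebra d \<rho> M; Y \<in> cr_lie_algebra d \<rho> M\<rbrakk>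
      \<Longrightarrow> lie_bracket X Y \<in> cr_lie_algebra d \<rho> M"

definition finite_type_at_0 ::
    "nat \<Rightarrow> (nat \<Rightarrow> complex^'n \<Rightarrow> complex^'n \<Rightarrow> complex) \<Rightarrow> (complex^('n::finite)) set \<Rightarrow> bool" where
  "finite_type_at_0 d \<rho> M \<longleftrightarrow>
     (\<lambda>X. X 0) ` cr_lie_algebra d \<rho> M = complexified_tangent_space d \<rho> 0"


section \<open>Maps into \<open>M'\<close> and into the Segre variety\<close>

definition sends_germ_into ::
    "(complex^'n \<Rightarrow> complex^'m) \<Rightarrow> (complex^'n) set \<Rightarrow> (complex^'m) set \<Rightarrow> bool" where
  "sends_germ_into H M M' \<longleftrightarrow> (\<forall>\<^sub>F Z in nhds 0. Z \<in> M \<longrightarrow> H Z \<in> M')"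

definition segre_variety ::
    "nat \<Rightarrow> (nat \<Rightarrow> complex^'n \<Rightarrow> complex^'n \<Rightarrow> complex) \<Rightarrow> (complex^'n) set \<Rightarrow> complex^'n \<Rightarrow> (complex^'n) set"
  where "segre_variety d \<rho> U p = {Z \<in> U. \<forall>i<d. \<rho> i Z (vcnj p) = 0}"

text \<open>The (holomorphic) tangent space at \<open>q\<close> of the Segre variety at \<open>p\<close>, whose equations
  \<open>\<rho>\<^sub>i(Z, \<bar>p) = 0\<close> have independent differentials.\<close>

definition segre_tangent_space ::
    "nat \<Rightarrow> (nat \<Rightarrow> complex^'n \<Rightarrow> complex^'n \<Rightarrow> complex) \<Rightarrow> complex^'n \<Rightarrow> complex^'n \<Rightarrow> (complex^'n) set"
  where "segre_tangent_space d \<rho> p q = {v. \<forall>i<d. dZ (\<rho> i) q (vcnj p) v = 0}"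

text \<open>A germ of a holomorphic submersion \<open>(\<complex>\<^sup>N, 0) \<rightarrow> (\<Sigma>\<^sub>0, 0)\<close>, regarded as a map into \<open>\<complex>\<^sup>N\<close> with
  values in \<open>\<Sigma>\<^sub>0\<close>. As \<open>f 0 = 0\<close>, this does not depend on the choice of the neighbourhood \<open>U\<close> of \<open>0\<close>.\<close>

definition submersion_onto_segre ::
    "nat \<Rightarrow> (nat \<Rightarrow> complex^'n \<Rightarrow> complex^'n \<Rightarrow> complex) \<Rightarrow> (complex^'n) set \<Rightarrow>
     (complex^'n \<Rightarrow> complex^'n) \<Rightarrow> bool" where
  "submersion_onto_segre d \<rho> U f \<longleftrightarrow>
     holomorphic_near f 0 \<and> f 0 = 0 \<and>
     (\<forall>\<^sub>F Z in nhds 0. f Z \<in> segre_variety d \<rho> U 0) \<and>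
     (\<forall>\<^sub>F Z in nhds 0. range (frechet_derivative f (at Z)) = segre_tangent_space d \<rho> 0 (f Z))"

text \<open>Transversality at \<open>0\<close> of \<open>f\<^sup>-\<^sup>1(0)\<close> and \<open>\<Sigma>\<^sub>0\<close>: their tangent spaces at \<open>0\<close> span \<open>\<complex>\<^sup>N\<close>. As \<open>f\<close> is
  a submersion, the tangent space of the fibre is the kernel of the differential of \<open>f\<close>.\<close>

definition fibre_transversal_to_segre ::
    "nat \<Rightarrow> (nat \<Rightarrow> complex^'n \<Rightarrow> complex^'n \<Rightarrow> complex) \<Rightarrow> (complex^'n \<Rightarrow> complex^'n) \<Rightarrow> bool" where
  "fibre_transversal_to_segre d \<rho> f \<longleftrightarrow>
     {u + v | u v. frechet_derivative f (at 0) u = 0 \<and> v \<in> segre_tangent_space d \<rho> 0 0} = UNIV"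

end

theory Submission
  imports Defs "HOL-Complex_Analysis.Cauchy_Integral_Formula"
begin

text \<open>Let \<open>D = H\<^sub>1 - H\<^sub>2\<close>. The proof finds a linear system of differential equations on \<open>M\<close> that \<open>D\<close>
  satisfies up to an error of high order, and then uses that a solution of a homogeneous linear system
  is determined by its value at one point.

  Two relations are available. The jets of \<open>zt \<circ> H\<^sub>1\<close> and \<open>zt \<circ> H\<^sub>2\<close> agree, and \<open>\<rho>'(H\<^sub>i, \<bar>H\<^sub>i) = 0\<close> on \<open>M\<close>.
  By Hadamard's lemma (\<open>Hadamard_difference\<close>) the differences of both are linear in \<open>D\<close> and \<open>\<bar>D\<close> with
  smooth coefficients: \<open>t D = O(k + 1)\<close> and \<open>P D + Q \<bar>D = 0\<close> on \<open>M\<close>. As the fibre of \<open>zt\<close> is transversal to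
  the Segre variety, whose tangent space is \<open>ker P(0)\<close>, the map \<open>(t, P)(0)\<close> is injective. Solving for \<open>D\<close> gives
  \<open>D = N D + B \<bar>D\<close> with \<open>N(0) = 0\<close>, and by iteration \<open>D = A \<bar>D\<close> along \<open>M\<close> up to high order
  (\<open>conj_relationI\<close>, \<open>conj_relation_of_maps\<close>).

  Let \<open>X\<close> be tangent to \<open>M\<close>. If \<open>X\<close> is of type \<open>(0, 1)\<close>, then \<open>X D = 0\<close>. If it is of type
  \<open>(1, 0)\<close>, then \<open>X \<bar>D = 0\<close>, hence \<open>X D = (X A) \<bar>D = (X A) \<bar>A D\<close>. So in both cases \<open>X D = C D\<close> for a smooth matrix \<open>C\<close>,
  up to one order less. This property passes to brackets, each of which costs one more order, and so holds on
  the whole Lie algebra (\<open>cr_lie_algebra_linear_system\<close>). By finite type finitely many of its elements span the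
  tangent space at \<open>0\<close>, so the loss of order is bounded by some \<open>m\<close> that depends on \<open>M\<close> only
  (\<open>finite_type_uniform_loss\<close>). Since \<open>D(0) = 0\<close>, differentiating the system repeatedly shows that all
  derivatives of \<open>D\<close> along \<open>M\<close> up to order \<open>k - m\<close> vanish at \<open>0\<close> (\<open>conj_relation_vanishes\<close>). Finally, \<open>M\<close> is generic, so the
  derivatives of a holomorphic function along \<open>M\<close> determine its jet (\<open>partials_vanish_if_vanishes\<close>). Thus
  \<open>k = k\<^sub>0 + m + 1\<close> works, where \<open>k\<^sub>0\<close> is the order of jet determination of \<open>F\<close>.

  The order of vanishing along \<open>M\<close> is measured by iterated derivatives along tangent vector fields
  (\<open>vanishes\<close>). This makes all estimates algebraic. The geometry of \<open>M\<close> enters only through the fact that tangent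
  vectors annihilate the functions vanishing on \<open>M\<close> (\<open>tangent_vector_annihilates\<close>).\<close>

section \<open>Calculus of smooth functions\<close>

abbreviation fd where "fd \<equiv> frechet_derivative"

definition smooth_on ::
    "('a::real_normed_vector \<Rightarrow> 'b::real_normed_vector) \<Rightarrow> 'a set \<Rightarrow> bool" where
  "smooth_on f S \<longleftrightarrow> (\<forall>k. Ck_on k f S)"

lemma smooth_near_iff: "smooth_near f a \<longleftrightarrow> (\<exists>S. open S \<and> a \<in> S \<and> smooth_on f S)"
  by (auto simp: smooth_near_def smooth_on_def)

lemma fd_cong_open:
  assumes "open S" "x \<in> S" "\<And>y. y \<in> S \<Longrightarrow> f y = g y"
  shows "fd f (at x) = fd g (at x)"
proof -
  have "(f has_derivative D) (at x) = (g has_derivative D) (at x)" for D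
    using has_derivative_transform_within_open[OF _ assms(1,2), of f D UNIV g]
      has_derivative_transform_within_open[OF _ assms(1,2), of g D UNIV f] assms(3) by auto
  then show ?thesis unfolding frechet_derivative_def by simp
qed

lemma fd_cong_eventually:
  assumes "\<forall>\<^sub>F y in nhds x. f y = g y"
  shows "fd f (at x) = fd g (at x)"
  using assms fd_cong_open[of _ x f g] unfolding eventually_nhds by metis

lemma fd_eqI: "(f has_derivative D) (at x) \<Longrightarrow> fd f (at x) = D"
  by (metis frechet_derivative_at)

lemma differentiable_cong_open:
  assumes "open S" "x \<in> S" "\<And>y. y \<in> S \<Longrightarrow> f y = g y" "f differentiable (at x)"
  shows "g differentiable (at x)"
  using assms has_derivative_transform_within_open[OF _ assms(1,2)] unfolding differentiable_def
  by metis

lemma Ck_on_cong: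
  assumes "open S" "\<And>y. y \<in> S \<Longrightarrow> f y = g y" "Ck_on k f S"
  shows "Ck_on k g S"
  using assms(2,3)
proof (induction k arbitrary: f g)
  case 0
  then show ?case using continuous_on_cong by force
next
  case (Suc k)
  have "g differentiable (at x)" if "x \<in> S" for x
    using Suc.prems differentiable_cong_open[OF assms(1) that, of f g] that by auto
  moreover have "Ck_on k (\<lambda>x. fd g (at x) v) S" for v
  proof (rule Suc.IH)
    show "Ck_on k (\<lambda>x. fd f (at x) v) S" using Suc.prems by auto
    show "fd f (at y) v = fd g (at y) v" if "y \<in> S" for y
      using fd_cong_open[OF assms(1) that, of f g] Suc.prems(1) by auto
  qed
  ultimately show ?case by simp
qed

lemma Ck_on_subset: "Ck_on k f S \<Longrightarrow> T \<subseteq> S \<Longrightarrow> Ck_on k f T"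
  by (induction k arbitrary: f) (auto intro: continuous_on_subset)

lemma Ck_on_continuous: "Ck_on k f S \<Longrightarrow> continuous_on S f"
  by (cases k) (auto intro: continuous_at_imp_continuous_on differentiable_imp_continuous_within)

lemma Ck_on_Suc_D: "Ck_on (Suc k) f S \<Longrightarrow> Ck_on k f S"
proof (induction k arbitrary: f)
  case 0
  then show ?case using Ck_on_continuous by (metis Ck_on.simps(1))
next
  case (Suc k)
  have "Ck_on k (\<lambda>x. fd f (at x) v) S" for v
    using Suc.prems Suc.IH by auto
  then show ?case using Suc.prems by simp
qed

lemma Ck_on_const: "Ck_on k (\<lambda>_. c) S"
proof (induction k arbitrary: c)
  case (Suc k)
  have "fd (\<lambda>_. c) (at x) v = 0" for x :: 'a and v
    using fd_eqI[OF has_derivative_const] by metis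
  then show ?case using Suc by auto
qed simp

lemma Ck_on_bounded_linear_compose:
  assumes "bounded_linear h" "open S" "Ck_on k f S"
  shows "Ck_on k (\<lambda>x. h (f x)) S"
  using assms(3)
proof (induction k arbitrary: f)
  case 0
  then show ?case using bounded_linear.continuous_on[OF assms(1)] by simp
next
  case (Suc k)
  have d: "((\<lambda>x. h (f x)) has_derivative (\<lambda>v. h (fd f (at x) v))) (at x)" if "x \<in> S" for x
    using bounded_linear.has_derivative[OF assms(1)] Suc.prems that
    by (auto simp: frechet_derivative_works)
  have "Ck_on k (\<lambda>x. h (fd f (at x) v)) S" for v using Suc by auto
  then have "Ck_on k (\<lambda>x. fd (\<lambda>x. h (f x)) (at x) v) S" for v
    by (rule Ck_on_cong[OF assms(2), rotated]) (use fd_eqI[OF d] in auto)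
  then show ?case using d unfolding Ck_on.simps differentiable_def by blast
qed

lemma Ck_on_add:
  assumes "open S" "Ck_on k f S" "Ck_on k g S"
  shows "Ck_on k (\<lambda>x. f x + g x) S"
  using assms(2,3)
proof (induction k arbitrary: f g)
  case 0
  then show ?case by (auto intro: continuous_intros)
next
  case (Suc k)
  have d: "((\<lambda>x. f x + g x) has_derivative (\<lambda>v. fd f (at x) v + fd g (at x) v)) (at x)"
    if "x \<in> S" for x
    using Suc.prems that by (auto simp: frechet_derivative_works intro!: has_derivative_add)
  have "Ck_on k (\<lambda>x. fd f (at x) v + fd g (at x) v) S" for v using Suc by auto
  then have "Ck_on k (\<lambda>x. fd (\<lambda>x. f x + g x) (at x) v) S" for v
    by (rule Ck_on_cong[OF assms(1), rotated]) (use fd_eqI[OF d] in auto)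
  then show ?case using d unfolding Ck_on.simps differentiable_def by blast
qed

lemma Ck_on_sum:
  assumes "open S" "\<And>i. i \<in> I \<Longrightarrow> Ck_on k (f i) S"
  shows "Ck_on k (\<lambda>x. \<Sum>i\<in>I. f i x) S"
  using assms(2) by (induction I rule: infinite_finite_induct) (auto intro: Ck_on_const Ck_on_add[OF assms(1)])

lemma Ck_on_bounded_bilinear:
  assumes "bounded_bilinear prd" "open S" "Ck_on k f S" "Ck_on k g S"
  shows "Ck_on k (\<lambda>x. prd (f x) (g x)) S"
  using assms(3,4)
proof (induction k arbitrary: f g)
  case 0
  then show ?case using bounded_bilinear.continuous_on[OF assms(1)] by auto
next
  case (Suc k)
  have d: "((\<lambda>x. prd (f x) (g x)) has_derivative
      (\<lambda>v. prd (f x) (fd g (at x) v) + prd (fd f (at x) v) (g x))) (at x)" if "x \<in> S" for x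
    using Suc.prems that
    by (intro bounded_bilinear.FDERIV[OF assms(1)]) (auto simp: frechet_derivative_works[symmetric])
  have "Ck_on k f S" "Ck_on k g S" using Suc.prems Ck_on_Suc_D by blast+
  then have "Ck_on k (\<lambda>x. prd (f x) (fd g (at x) v) + prd (fd f (at x) v) (g x)) S" for v
    using Suc by (auto intro!: Ck_on_add[OF assms(2)])
  then have "Ck_on k (\<lambda>x. fd (\<lambda>x. prd (f x) (g x)) (at x) v) S" for v
    by (rule Ck_on_cong[OF assms(2), rotated]) (use fd_eqI[OF d] in auto)
  then show ?case using d unfolding Ck_on.simps differentiable_def by blast
qed

lemma has_derivative_linear_sum:
  fixes v :: "'b::euclidean_space"
  assumes "(f has_derivative D) F"
  shows "D v = (\<Sum>b\<in>Basis. (v \<bullet> b) *\<^sub>R D b)"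
proof -
  interpret bounded_linear D using assms has_derivative_bounded_linear by blast
  show ?thesis
    by (subst (1) euclidean_representation[symmetric, of v]) (simp add: sum scaleR)
qed

lemma Ck_on_compose:
  fixes g :: "'a::real_normed_vector \<Rightarrow> 'b::euclidean_space"
  assumes "open S" "open T" "g ` S \<subseteq> T" "Ck_on k f T" "Ck_on k g S"
  shows "Ck_on k (\<lambda>x. f (g x)) S"
  using assms(4,5)
proof (induction k arbitrary: f)
  case 0
  then show ?case using assms(3) continuous_on_compose2 by fastforce
next
  case (Suc k)
  have df: "(f has_derivative fd f (at (g x))) (at (g x))" if "x \<in> S" for x
    using Suc.prems that assms(3) frechet_derivative_works by auto
  have d: "((\<lambda>x. f (g x)) has_derivative (\<lambda>v. fd f (at (g x)) (fd g (at x) v))) (at x)"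
    if "x \<in> S" for x
    using has_derivative_compose[of g "fd g (at x)" x UNIV, OF _ df[OF that]] Suc.prems that
    by (auto simp: frechet_derivative_works)
  have "Ck_on k g S" using Suc.prems Ck_on_Suc_D by blast
  then have c: "Ck_on k (\<lambda>x. fd f (at (g x)) b) S" for b
    using Suc.IH[of "\<lambda>y. fd f (at y) b"] Suc.prems by auto
  have "Ck_on k (\<lambda>x. \<Sum>b\<in>Basis. (fd g (at x) v \<bullet> b) *\<^sub>R fd f (at (g x)) b) S" for v
    using Suc.prems
    by (intro Ck_on_sum assms Ck_on_bounded_bilinear[OF bounded_bilinear_scaleR] c
        Ck_on_bounded_linear_compose[OF bounded_linear_inner_left]) auto
  then have "Ck_on k (\<lambda>x. fd (\<lambda>x. f (g x)) (at x) v) S" for v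
    by (rule Ck_on_cong[OF assms(1), rotated])
      (use fd_eqI[OF d] has_derivative_linear_sum[OF df] in auto)
  then show ?case using d unfolding Ck_on.simps differentiable_def by blast
qed

lemma Ck_on_Pair:
  assumes "open S" "Ck_on k f S" "Ck_on k g S"
  shows "Ck_on k (\<lambda>x. (f x, g x)) S"
proof -
  have "Ck_on k (\<lambda>x. (f x, 0) + (0, g x)) S"
    by (intro Ck_on_add assms Ck_on_bounded_linear_compose[where h="\<lambda>x. (x, 0)"]
        Ck_on_bounded_linear_compose[where h="\<lambda>x. (0, x)"] bounded_linear_intros)
  then show ?thesis by simp
qed

lemma Ck_on_ident:
  assumes "open S" shows "Ck_on k (\<lambda>x. x) S"
proof (cases k)
  case (Suc l)
  have "Ck_on l (\<lambda>x. fd (\<lambda>x. x) (at x) v) S" for v :: 'a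
    using Ck_on_const by (simp add: fd_eqI[OF has_derivative_ident])
  then show ?thesis using Suc by simp
qed simp

lemma smooth_on_fd: "smooth_on f S \<Longrightarrow> smooth_on (\<lambda>x. fd f (at x) v) S"
  unfolding smooth_on_def by (metis Ck_on.simps(2))

lemma smooth_on_differentiable: "smooth_on f S \<Longrightarrow> x \<in> S \<Longrightarrow> f differentiable (at x)"
  unfolding smooth_on_def by (metis Ck_on.simps(2))

lemma smooth_on_continuous: "smooth_on f S \<Longrightarrow> continuous_on S f"
  unfolding smooth_on_def by (metis Ck_on.simps(1))

lemma smooth_on_subset: "smooth_on f S \<Longrightarrow> T \<subseteq> S \<Longrightarrow> smooth_on f T"
  unfolding smooth_on_def by (metis Ck_on_subset)

lemma smooth_near2:
  assumes "smooth_near f a" "smooth_near g a"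
  obtains S where "open S" "a \<in> S" "smooth_on f S" "smooth_on g S"
proof -
  obtain S T where "open S" "a \<in> S" "smooth_on f S" "open T" "a \<in> T" "smooth_on g T"
    using assms unfolding smooth_near_iff by blast
  then show ?thesis using that[of "S \<inter> T"] by (auto intro: smooth_on_subset)
qed

lemma smooth_near_const: "smooth_near (\<lambda>_. c) a"
  unfolding smooth_near_def using Ck_on_const by blast

lemma smooth_near_add:
  assumes "smooth_near f a" "smooth_near g a" shows "smooth_near (\<lambda>x. f x + g x) a"
  using smooth_near2[OF assms] Ck_on_add unfolding smooth_near_def smooth_on_def by metis

lemma smooth_near_bilinear:
  assumes "bounded_bilinear prd" "smooth_near f a" "smooth_near g a"
  shows "smooth_near (\<lambda>x. prd (f x) (g x)) a"
  using smooth_near2[OF assms(2,3)] Ck_on_bounded_bilinear[OF assms(1)]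
  unfolding smooth_near_def smooth_on_def by metis

lemma smooth_near_mult:
  fixes f g :: "'a::real_normed_vector \<Rightarrow> 'b::real_normed_algebra"
  assumes "smooth_near f a" "smooth_near g a" shows "smooth_near (\<lambda>x. f x * g x) a"
  by (rule smooth_near_bilinear[OF bounded_bilinear_mult assms])

lemma smooth_near_linear:
  assumes "bounded_linear h" "smooth_near f a" shows "smooth_near (\<lambda>x. h (f x)) a"
  using assms Ck_on_bounded_linear_compose unfolding smooth_near_def by metis

lemma smooth_near_sum:
  assumes "\<And>i. i \<in> I \<Longrightarrow> smooth_near (f i) a"
  shows "smooth_near (\<lambda>x. \<Sum>i\<in>I. f i x) a"
  using assms by (induction I rule: infinite_finite_induct) (auto intro: smooth_near_const smooth_near_add)

lemma smooth_near_Pair: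
  assumes "smooth_near f a" "smooth_near g a" shows "smooth_near (\<lambda>x. (f x, g x)) a"
  using smooth_near2[OF assms] Ck_on_Pair unfolding smooth_near_def smooth_on_def by metis

lemma smooth_near_fd: "smooth_near f a \<Longrightarrow> smooth_near (\<lambda>x. fd f (at x) v) a"
  unfolding smooth_near_iff using smooth_on_fd by blast

lemma smooth_near_differentiable:
  "smooth_near f a \<Longrightarrow> \<forall>\<^sub>F x in nhds a. f differentiable (at x)"
  unfolding smooth_near_iff eventually_nhds using smooth_on_differentiable by blast

lemma smooth_near_cong:
  assumes "\<forall>\<^sub>F x in nhds a. f x = g x" "smooth_near f a"
  shows "smooth_near g a"
proof -
  obtain S where S: "open S" "a \<in> S" "\<And>x. x \<in> S \<Longrightarrow> f x = g x"
    using assms(1) unfolding eventually_nhds by blast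
  obtain T where T: "open T" "a \<in> T" "smooth_on f T" using assms(2) unfolding smooth_near_iff by blast
  have "open (S \<inter> T)" using S T by auto
  moreover have "Ck_on k g (S \<inter> T)" for k
    by (rule Ck_on_cong[OF \<open>open (S \<inter> T)\<close>, of f])
      (use S(3) T(3) in \<open>auto simp: smooth_on_def intro: Ck_on_subset[of _ _ T]\<close>)
  ultimately show ?thesis unfolding smooth_near_def using S T by blast
qed

lemma smooth_near_nhds:
  assumes "smooth_near f a" shows "\<forall>\<^sub>F x in nhds a. smooth_near f x"
  using assms unfolding smooth_near_iff eventually_nhds by blast

lemma smooth_near_isCont: "smooth_near f a \<Longrightarrow> isCont f a"
  unfolding smooth_near_iff using smooth_on_continuous continuous_on_eq_continuous_at by blast

lemma smooth_near_has_derivative: "smooth_near f a \<Longrightarrow> (f has_derivative fd f (at a)) (at a)"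
  using smooth_near_differentiable eventually_nhds_x_imp_x frechet_derivative_works by blast

lemma smooth_near_compose:
  fixes g :: "'a::real_normed_vector \<Rightarrow> 'b::euclidean_space"
  assumes "smooth_near f (g a)" "smooth_near g a"
  shows "smooth_near (\<lambda>x. f (g x)) a"
proof -
  obtain T where T: "open T" "g a \<in> T" "smooth_on f T" using assms(1) unfolding smooth_near_iff by blast
  obtain S where S: "open S" "a \<in> S" "smooth_on g S" using assms(2) unfolding smooth_near_iff by blast
  have o: "open (S \<inter> g -` T)"
    using continuous_open_preimage[OF smooth_on_continuous[OF S(3)] S(1) T(1)] .
  have "Ck_on k (\<lambda>x. f (g x)) (S \<inter> g -` T)" for k
    by (rule Ck_on_compose[OF o T(1)])
      (use S(3) T(3) in \<open>auto simp: smooth_on_def intro: Ck_on_subset\<close>)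
  then show ?thesis unfolding smooth_near_def using o S T by blast
qed

section \<open>Integrals depending on a parameter\<close>

text \<open>Leibniz' rule, arranged so that the derivative of the integrand is taken jointly in \<open>(t, y)\<close>: its
  directional derivatives are again functions of \<open>(t, y)\<close>, to which the rule can be applied once more.\<close>

lemma has_derivative_integral_parameter:
  fixes g :: "real \<times> 'b::euclidean_space \<Rightarrow> 'c::euclidean_space"
  assumes W: "{0..1} \<times> S \<subseteq> W" and S: "open S" "x \<in> S"
    and d: "\<And>w. w \<in> W \<Longrightarrow> g differentiable (at w)"
    and c: "\<And>v. continuous_on W (\<lambda>w. fd g (at w) v)"
  shows "((\<lambda>y. integral {0..1} (\<lambda>t. g (t, y))) has_derivative
          (\<lambda>v. integral {0..1} (\<lambda>t. fd g (at (t, x)) (0, v)))) (at x)"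
proof -
  obtain e where e: "0 < e" "ball x e \<subseteq> S" using S open_contains_ball by blast
  define U where "U = ball x e"
  define D where "D y t = Blinfun (\<lambda>v. fd g (at (t, y)) (0, v))" for y t
  have WU: "(t, y) \<in> W" if "y \<in> U" "t \<in> cbox 0 1" for y t
  proof -
    have "y \<in> S" using that(1) e(2) unfolding U_def by blast
    then have "(t, y) \<in> {0..1} \<times> S" using that(2) by simp
    then show ?thesis using W by (rule rev_subsetD)
  qed
  have gd: "(g has_derivative fd g (at (t, y))) (at (t, y))" if "y \<in> U" "t \<in> cbox 0 1" for y t
    using d[OF WU[OF that]] unfolding frechet_derivative_works .
  have hd: "((\<lambda>y. g (t, y)) has_derivative (\<lambda>v. fd g (at (t, y)) (0, v))) (at y)"
    if "y \<in> U" "t \<in> cbox 0 1" for y t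
  proof -
    have "((\<lambda>y. (t, y)) has_derivative (\<lambda>v. (0, v))) (at y)"
      by (intro has_derivative_Pair has_derivative_const has_derivative_ident)
    from has_derivative_compose[OF this gd[OF that]] show ?thesis .
  qed
  have Dv: "blinfun_apply (D y t) = (\<lambda>v. fd g (at (t, y)) (0, v))" if "y \<in> U" "t \<in> cbox 0 1" for y t
    unfolding D_def using bounded_linear_Blinfun_apply[OF has_derivative_bounded_linear[OF hd[OF that]]] .
  have gc: "continuous_on W g"
    using d by (intro continuous_at_imp_continuous_on) (auto intro: differentiable_imp_continuous_within)
  have swap: "continuous_on (U \<times> cbox 0 1) (\<lambda>(y, t). h (t, y))" if "continuous_on W h" for h :: "_ \<Rightarrow> 'd::topological_space"
    unfolding split_beta
    by (rule continuous_on_compose2[OF that]) (use WU in \<open>auto intro!: continuous_intros\<close>)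
  have cD: "continuous_on (U \<times> cbox 0 1) (\<lambda>(y, t). D y t)"
  proof (unfold split_beta, rule continuous_on_blinfun_componentwise)
    fix i :: 'b assume "i \<in> Basis"
    have "continuous_on (U \<times> cbox 0 1) (\<lambda>(y, t). fd g (at (t, y)) (0, i))"
      by (rule swap[OF c])
    then show "continuous_on (U \<times> cbox 0 1) (\<lambda>p. blinfun_apply (D (fst p) (snd p)) i)"
      by (rule continuous_on_cong[THEN iffD1, rotated -1]) (auto simp: Dv split_beta)
  qed
  have "((\<lambda>y. integral (cbox 0 1) (\<lambda>t. g (t, y))) has_derivative
          blinfun_apply (integral (cbox 0 1) (D x))) (at x within U)"
  proof (rule leibniz_rule[OF _ _ cD])
    show "((\<lambda>y. g (t, y)) has_derivative blinfun_apply (D y t)) (at y within U)"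
      if "y \<in> U" "t \<in> cbox 0 1" for y t
      using hd[OF that] Dv[OF that] has_derivative_at_withinI by metis
    show "(\<lambda>t. g (t, y)) integrable_on cbox 0 1" if "y \<in> U" for y
    proof (rule integrable_continuous)
      show "continuous_on (cbox 0 1) (\<lambda>t. g (t, y))"
        by (rule continuous_on_compose2[OF gc]) (use W e that in \<open>auto simp: U_def intro!: continuous_intros\<close>)
    qed
  qed (use e in \<open>auto simp: U_def\<close>)
  note * = this
  have **: "blinfun_apply (integral (cbox 0 1) (D x)) v = integral {0..1} (\<lambda>t. fd g (at (t, x)) (0, v))" for v
  proof -
    have xU: "x \<in> U" using e by (auto simp: U_def)
    have "continuous_on (cbox 0 1) (D x)"
    proof -
      have "continuous_on (cbox 0 1) (\<lambda>t::real. (x, t))"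
        by (intro continuous_on_Pair continuous_on_const continuous_on_id)
      then have "continuous_on (cbox 0 1) (\<lambda>t. case (x, t) of (y, t) \<Rightarrow> D y t)"
        by (rule continuous_on_compose2[OF cD]) (use xU in blast)
      then show ?thesis by simp
    qed
    then have "D x integrable_on cbox 0 1" by (rule integrable_continuous)
    then have "blinfun_apply (integral (cbox 0 1) (D x)) v = integral (cbox 0 1) (\<lambda>t. blinfun_apply (D x t) v)"
      by (rule blinfun_apply_integral)
    also have "\<dots> = integral (cbox 0 1) (\<lambda>t. fd g (at (t, x)) (0, v))"
      by (rule Henstock_Kurzweil_Integration.integral_cong) (use xU in \<open>auto simp: Dv\<close>)
    finally show ?thesis by (simp add: cbox_interval)
  qed
  have at: "at x within U = at x" unfolding U_def by (rule at_within_open) (use e(1) in auto)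
  have eq: "blinfun_apply (integral (cbox 0 1) (D x)) = (\<lambda>v. integral {0..1} (\<lambda>t. fd g (at (t, x)) (0, v)))"
    by (rule ext) (rule **)
  from * show ?thesis unfolding cbox_interval at eq[unfolded cbox_interval] .
qed

lemma continuous_on_integral_parameter:
  fixes g :: "real \<times> 'b::euclidean_space \<Rightarrow> 'c::euclidean_space"
  assumes "{0..1} \<times> S \<subseteq> W" "continuous_on W g"
  shows "continuous_on S (\<lambda>y. integral {0..1} (\<lambda>t. g (t, y)))"
proof -
  have "continuous_on (S \<times> cbox 0 1) (\<lambda>(y, t). g (t, y))"
    unfolding split_beta
    by (rule continuous_on_compose2[OF assms(2)]) (use assms(1) in \<open>auto intro!: continuous_intros\<close>)
  from integral_continuous_on_param[OF this] show ?thesis by (simp add: cbox_interval)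
qed

lemma Ck_on_integral_parameter:
  fixes g :: "real \<times> 'b::euclidean_space \<Rightarrow> 'c::euclidean_space"
  assumes "{0..1} \<times> S \<subseteq> W" "open S" "Ck_on k g W"
  shows "Ck_on k (\<lambda>y. integral {0..1} (\<lambda>t. g (t, y))) S"
  using assms(3)
proof (induction k arbitrary: g)
  case 0
  then show ?case using continuous_on_integral_parameter[OF assms(1)] by simp
next
  case (Suc k)
  have d: "((\<lambda>y. integral {0..1} (\<lambda>t. g (t, y))) has_derivative
          (\<lambda>v. integral {0..1} (\<lambda>t. fd g (at (t, x)) (0, v)))) (at x)" if "x \<in> S" for x
    using Suc.prems that
    by (intro has_derivative_integral_parameter[OF assms(1,2)]) (auto intro: Ck_on_continuous)
  have "Ck_on k (\<lambda>y. integral {0..1} (\<lambda>t. fd g (at (t, y)) (0, v))) S" for v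
    using Suc.IH[of "\<lambda>w. fd g (at w) (0, v)"] Suc.prems by auto
  then have "Ck_on k (\<lambda>x. fd (\<lambda>y. integral {0..1} (\<lambda>t. g (t, y))) (at x) v) S" for v
    by (rule Ck_on_cong[OF assms(2), rotated]) (use fd_eqI[OF d] in auto)
  then show ?case using d unfolding Ck_on.simps differentiable_def by blast
qed

lemma fd_segment_integral:
  fixes f :: "'a::euclidean_space \<Rightarrow> 'b::euclidean_space"
  assumes "\<And>t. t \<in> {0..1} \<Longrightarrow> f differentiable (at (y + t *\<^sub>R u))"
  shows "((\<lambda>t. fd f (at (y + t *\<^sub>R u)) u) has_integral (f (y + u) - f y)) {0..1}"
proof -
  have "((\<lambda>t. f (y + t *\<^sub>R u)) has_vector_derivative fd f (at (y + t *\<^sub>R u)) u) (at t within {0..1})"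
    if "t \<in> {0..1}" for t
  proof -
    have "((\<lambda>t. y + t *\<^sub>R u) has_vector_derivative u) (at t within {0..1})"
      by (auto intro!: derivative_eq_intros simp: has_vector_derivative_def)
    then show ?thesis
      using vector_derivative_diff_chain_within[of "\<lambda>t. y + t *\<^sub>R u" u t "{0..1}" f] assms[OF that]
      by (auto simp: frechet_derivative_works o_def has_derivative_at_withinI)
  qed
  from fundamental_theorem_of_calculus[OF _ this] show ?thesis by simp
qed

text \<open>Hadamard's lemma for \<open>f\<close> along two families of points. The linear dependence of the coefficients
  on the direction survives integration, and so does complex linearity with respect to \<open>J\<close>.\<close>

lemma Hadamard_difference:
  fixes f :: "'a::euclidean_space \<Rightarrow> complex" and w1 w2 :: "'c::euclidean_space \<Rightarrow> 'a"
  assumes f: "smooth_near f p" and w: "smooth_near w1 a" "smooth_near w2 a" "w1 a = p" "w2 a = p"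
    and J: "\<forall>\<^sub>F y in nhds p. \<forall>e. fd f (at y) (J e) = \<i> * fd f (at y) e"
  shows "\<exists>I. (\<forall>e. smooth_near (I e) a) \<and> (\<forall>e. I e a = fd f (at p) e) \<and>
    (\<forall>\<^sub>F x in nhds a. linear (\<lambda>e. I e x) \<and> (\<forall>e. I (J e) x = \<i> * I e x) \<and>
       f (w1 x) - f (w2 x) = I (w1 x - w2 x) x)"
proof -
  obtain B0 where B0: "open B0" "p \<in> B0" "smooth_on f B0" using f unfolding smooth_near_iff by blast
  obtain B1 where B1: "open B1" "p \<in> B1" "\<And>y e. y \<in> B1 \<Longrightarrow> fd f (at y) (J e) = \<i> * fd f (at y) e"
    using J unfolding eventually_nhds by blast
  obtain r where r: "r > 0" "ball p r \<subseteq> B0 \<inter> B1" using B0 B1 open_contains_ball[of "B0 \<inter> B1"] by blast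
  define B where "B = ball p r"
  have B: "open B" "p \<in> B" "smooth_on f B" "convex B" "B \<subseteq> B1"
    using r B0 smooth_on_subset[of f B0] unfolding B_def by auto
  obtain S0 where S0: "open S0" "a \<in> S0" "smooth_on w1 S0" "smooth_on w2 S0"
    using smooth_near2[OF w(1,2)] .
  define S where "S = (S0 \<inter> w1 -` B) \<inter> (S0 \<inter> w2 -` B)"
  have S: "open S" "a \<in> S" "smooth_on w1 S" "smooth_on w2 S"
  proof -
    have "open (S0 \<inter> w1 -` B)" "open (S0 \<inter> w2 -` B)"
      using S0 B(1) continuous_open_preimage smooth_on_continuous by blast+
    then show "open S" unfolding S_def by (rule open_Int)
    show "a \<in> S" using S0(2) B(2) w(3,4) by (simp add: S_def)
    show "smooth_on w1 S" "smooth_on w2 S"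
      using S0(3,4) by (auto simp: S_def intro: smooth_on_subset[of _ S0])
  qed
  define h where "h tx = w2 (snd tx) + fst tx *\<^sub>R (w1 (snd tx) - w2 (snd tx))" for tx
  define W where "W = (UNIV \<times> S) \<inter> h -` B"
  have o: "open (UNIV \<times> S :: (real \<times> 'c) set)" using S(1) by (simp add: open_Times)
  have id: "Ck_on k (\<lambda>tx. tx) (UNIV \<times> S :: (real \<times> 'c) set)" for k
    by (rule Ck_on_ident[OF o])
  have sm: "Ck_on k (\<lambda>tx. wi (snd tx)) (UNIV \<times> S :: (real \<times> 'c) set)" if "smooth_on wi S" for k and wi :: "'c \<Rightarrow> 'a"
    by (rule Ck_on_compose[OF o S(1)])
      (use that Ck_on_bounded_linear_compose[OF bounded_linear_snd o id] in \<open>auto simp: smooth_on_def\<close>)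
  have sh: "Ck_on k h (UNIV \<times> S)" for k
  proof -
    have "Ck_on k (\<lambda>tx. w2 (snd tx) + fst tx *\<^sub>R (w1 (snd tx) + (- w2 (snd tx)))) (UNIV \<times> S)"
      by (intro Ck_on_add[OF o] Ck_on_bounded_bilinear[OF bounded_bilinear_scaleR o] sm S
          Ck_on_bounded_linear_compose[OF bounded_linear_fst o id]
          Ck_on_bounded_linear_compose[OF bounded_linear_minus[OF bounded_linear_ident] o])
    then show ?thesis by (simp add: h_def[abs_def])
  qed
  have oW: "open W"
    unfolding W_def by (rule continuous_open_preimage[OF Ck_on_continuous[OF sh] o B(1)])
  have "h (t, x) \<in> B" if "t \<in> {0..1}" "x \<in> S" for t x
  proof -
    have "w2 x \<in> B" "w1 x \<in> B" using that by (auto simp: S_def)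
    then have "(1 - t) *\<^sub>R w2 x + t *\<^sub>R w1 x \<in> B" using B(4) that by (intro convexD) auto
    then show ?thesis by (simp add: h_def algebra_simps)
  qed
  then have W: "{0..1} \<times> S \<subseteq> W" by (auto simp: W_def)
  have sg: "Ck_on k (\<lambda>tx. fd f (at (h tx)) e) W" for k e
    by (rule Ck_on_compose[OF oW B(1)])
      (use smooth_on_fd[OF B(3)] in \<open>auto simp: W_def smooth_on_def intro!: Ck_on_subset[OF sh]\<close>)
  define I where "I e x = integral {0..1} (\<lambda>t. fd f (at (h (t, x))) e)" for e x
  have "Ck_on k (I e) S" for k e
    using Ck_on_integral_parameter[OF W S(1) sg, of k e] unfolding I_def .
  then have 1: "smooth_near (I e) a" for e unfolding smooth_near_def using S by blast
  have 2: "I e a = fd f (at p) e" for e using w by (simp add: I_def h_def)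
  have 3: "\<forall>x\<in>S. \<forall>t\<in>{0..1}. f differentiable (at (h (t, x)))"
    using smooth_on_differentiable[OF B(3)] W by (auto simp: W_def)
  have 4: "(\<lambda>t. fd f (at (h (t, x))) e) integrable_on {0..1}" if "x \<in> S" for x e
  proof -
    have "continuous_on {0..1} (\<lambda>t. fd f (at (h (t, x))) e)"
      by (rule continuous_on_compose2[OF Ck_on_continuous[OF sg[of 0 e]], of _ "\<lambda>t. (t, x)", simplified])
        (use W that in \<open>auto intro!: continuous_intros\<close>)
    then show ?thesis using integrable_continuous_interval by blast
  qed
  have lin: "linear (fd f (at (h (t, x))))" if "t \<in> {0..1}" "x \<in> S" for t x
    using 3 that by (meson frechet_derivative_works has_derivative_linear)
  have 5: "linear (\<lambda>e. I e x)" if "x \<in> S" for x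
  proof (rule linearI)
    fix e e'
    have "I (e + e') x = integral {0..1} (\<lambda>t. fd f (at (h (t, x))) e + fd f (at (h (t, x))) e')"
      unfolding I_def using linear_add[OF lin[OF _ that]]
      by (intro Henstock_Kurzweil_Integration.integral_cong) auto
    then show "I (e + e') x = I e x + I e' x"
      unfolding I_def using Henstock_Kurzweil_Integration.integral_add[OF 4[OF that] 4[OF that], of e e'] by simp
  next
    fix c e
    have "I (c *\<^sub>R e) x = integral {0..1} (\<lambda>t. c *\<^sub>R fd f (at (h (t, x))) e)"
      unfolding I_def using linear_scale[OF lin[OF _ that]]
      by (intro Henstock_Kurzweil_Integration.integral_cong) auto
    then show "I (c *\<^sub>R e) x = c *\<^sub>R I e x"
      unfolding I_def by simp
  qed
  have 6: "I (J e) x = \<i> * I e x" if "x \<in> S" for x e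
  proof -
    have "I (J e) x = integral {0..1} (\<lambda>t. \<i> * fd f (at (h (t, x))) e)"
      unfolding I_def
    proof (rule Henstock_Kurzweil_Integration.integral_cong)
      fix t assume "t \<in> {0..1::real}"
      then have "(t, x) \<in> W" using that W by (meson SigmaI subsetD)
      then have "h (t, x) \<in> B1" using B(5) by (auto simp: W_def)
      then show "fd f (at (h (t, x))) (J e) = \<i> * fd f (at (h (t, x))) e" by (rule B1(3))
    qed
    then show ?thesis unfolding I_def by simp
  qed
  have 7: "f (w1 x) - f (w2 x) = I (w1 x - w2 x) x" if "x \<in> S" for x
    using integral_unique[OF fd_segment_integral[of f "w2 x" "w1 x - w2 x"]] 3 that
    by (simp add: I_def h_def)
  have "\<forall>\<^sub>F x in nhds a. linear (\<lambda>e. I e x) \<and> (\<forall>e. I (J e) x = \<i> * I e x) \<and>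
      f (w1 x) - f (w2 x) = I (w1 x - w2 x) x"
    unfolding eventually_nhds using 5 6 7 S(1,2) by (intro exI[of _ S] conjI ballI allI)
  then show ?thesis using 1 2 by (intro exI[of _ I] conjI allI)
qed

section \<open>Symmetry of second derivatives\<close>

text \<open>The difference quotient of \<open>y \<mapsto> D\<^sub>v f y\<close> in the direction \<open>u\<close> is a mean of \<open>D\<^sub>v D\<^sub>u f\<close> over a segment, which
  converges to \<open>D\<^sub>v D\<^sub>u f\<close> as the segment shrinks.\<close>

lemma fd_fd_symmetric:
  fixes f :: "'a::euclidean_space \<Rightarrow> 'b::euclidean_space"
  assumes S: "open S" "x \<in> S" and f: "smooth_on f S"
  shows "fd (\<lambda>y. fd f (at y) v) (at x) u = fd (\<lambda>y. fd f (at y) u) (at x) v"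
proof -
  obtain r where r: "r > 0" "ball x r \<subseteq> S" using S open_contains_ball by blast
  define B where "B = ball x r"
  have B: "open B" "x \<in> B" "smooth_on f B" using r f smooth_on_subset by (auto simp: B_def)
  define e where "e = r / (norm u + 1)"
  have e: "e > 0" using r by (simp add: e_def add_nonneg_pos)
  have small: "\<bar>s\<bar> * norm u < r" if "\<bar>s\<bar> < e" for s
  proof -
    have "\<bar>s\<bar> * norm u \<le> \<bar>s\<bar> * (norm u + 1)" by (simp add: mult_left_mono)
    also have "\<dots> < r" using that by (simp add: e_def pos_less_divide_eq add_nonneg_pos)
    finally show ?thesis .
  qed
  have in_B: "y + (t * s) *\<^sub>R u \<in> B" if "t \<in> {0..1}" "y \<in> ball x (r - \<bar>s\<bar> * norm u)" for s t y
  proof -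
    have "norm (x - (y + (t * s) *\<^sub>R u)) \<le> norm (x - y) + norm ((t * s) *\<^sub>R u)"
      by (metis diff_diff_eq norm_triangle_ineq4)
    also have "norm ((t * s) *\<^sub>R u) \<le> \<bar>s\<bar> * norm u"
      using that by (auto simp: abs_mult intro!: mult_right_mono mult_left_le_one_le)
    finally show ?thesis using that by (auto simp: B_def dist_norm)
  qed
  have Df: "(f has_derivative fd f (at y)) (at y)" if "y \<in> B" for y
    using smooth_on_differentiable[OF B(3) that] by (simp add: frechet_derivative_works)
  have DDf: "((\<lambda>y. fd f (at y) w) has_derivative fd (\<lambda>y. fd f (at y) w) (at y)) (at y)" if "y \<in> B" for y w
    using smooth_on_differentiable[OF smooth_on_fd[OF B(3)] that] by (simp add: frechet_derivative_works)
  define I where "I s = integral {0..1} (\<lambda>t. fd (\<lambda>y. fd f (at y) u) (at (x + (t * s) *\<^sub>R u)) v)" for s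
  \<comment> \<open>Differentiate \<open>f (y + s u) - f y = s \<integral> D\<^sub>u f (y + t s u) dt\<close> in \<open>y\<close> along \<open>v\<close>.\<close>
  have key: "fd f (at (x + s *\<^sub>R u)) v - fd f (at x) v = s *\<^sub>R I s" if s: "\<bar>s\<bar> < e" for s
  proof -
    define S' where "S' = ball x (r - \<bar>s\<bar> * norm u)"
    have S': "open S'" "x \<in> S'" using small[OF s] by (auto simp: S'_def)
    define l where "l ty = snd ty + (fst ty * s) *\<^sub>R u" for ty :: "real \<times> 'a"
    define W where "W = l -` B"
    have oW: "open W"
      unfolding W_def l_def by (intro open_vimage B continuous_intros)
    have W: "{0..1} \<times> S' \<subseteq> W" using in_B by (auto simp: W_def l_def S'_def)
    have Dl: "(l has_derivative (\<lambda>w. snd w + (fst w * s) *\<^sub>R u)) (at w)" for w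
      unfolding l_def by (auto intro!: derivative_eq_intros)
    have Ckl: "Ck_on k l W" for k
      unfolding l_def
      by (intro Ck_on_add[OF oW] Ck_on_bounded_bilinear[OF bounded_bilinear_scaleR oW] Ck_on_const
          Ck_on_bounded_bilinear[OF bounded_bilinear_mult oW]
          Ck_on_bounded_linear_compose[OF bounded_linear_fst oW]
          Ck_on_bounded_linear_compose[OF bounded_linear_snd oW] Ck_on_ident oW)
    have g: "Ck_on k (\<lambda>w. fd f (at (l w)) u) W" for k
      by (rule Ck_on_compose[OF oW B(1) _ _ Ckl])
        (use smooth_on_fd[OF B(3)] in \<open>auto simp: W_def smooth_on_def\<close>)
    have Dg: "((\<lambda>w. fd f (at (l w)) u) has_derivative
        (\<lambda>w'. fd (\<lambda>y. fd f (at y) u) (at (l w)) (snd w' + (fst w' * s) *\<^sub>R u))) (at w)" if "w \<in> W" for w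
      using has_derivative_compose[OF Dl DDf, of w u] that by (auto simp: W_def)
    have "((\<lambda>y. integral {0..1} (\<lambda>t. fd f (at (l (t, y))) u)) has_derivative
          (\<lambda>w. integral {0..1} (\<lambda>t. fd (\<lambda>w. fd f (at (l w)) u) (at (t, x)) (0, w)))) (at x)"
      using g[of 1] by (intro has_derivative_integral_parameter[OF W S']) auto
    also have "(\<lambda>w. integral {0..1} (\<lambda>t. fd (\<lambda>w. fd f (at (l w)) u) (at (t, x)) (0, w))) =
       (\<lambda>w. integral {0..1} (\<lambda>t. fd (\<lambda>y. fd f (at y) u) (at (x + (t * s) *\<^sub>R u)) w))"
    proof (intro ext Henstock_Kurzweil_Integration.integral_cong)
      fix w t assume "t \<in> {0..1::real}"
      then have "(t, x) \<in> W" using W S' by auto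
      from fd_eqI[OF Dg[OF this]] show "fd (\<lambda>w. fd f (at (l w)) u) (at (t, x)) (0, w) =
          fd (\<lambda>y. fd f (at y) u) (at (x + (t * s) *\<^sub>R u)) w"
        by (simp add: l_def)
    qed
    finally have "((\<lambda>y. s *\<^sub>R integral {0..1} (\<lambda>t. fd f (at (l (t, y))) u)) has_derivative
        (\<lambda>w. s *\<^sub>R integral {0..1} (\<lambda>t. fd (\<lambda>y. fd f (at y) u) (at (x + (t * s) *\<^sub>R u)) w))) (at x)"
      by (rule has_derivative_scaleR_right)
    moreover have "s *\<^sub>R integral {0..1} (\<lambda>t. fd f (at (l (t, y))) u) = f (y + s *\<^sub>R u) - f y" if "y \<in> S'" for y
    proof -
      have "f differentiable (at (y + t *\<^sub>R s *\<^sub>R u))" if "t \<in> {0..1}" for t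
        using smooth_on_differentiable[OF B(3) in_B[OF that, of y s]] \<open>y \<in> S'\<close> by (simp add: S'_def)
      from fd_segment_integral[OF this]
      have "((\<lambda>t. fd f (at (y + t *\<^sub>R s *\<^sub>R u)) (s *\<^sub>R u)) has_integral (f (y + s *\<^sub>R u) - f y)) {0..1}" by simp
      moreover have "fd f (at (y + t *\<^sub>R s *\<^sub>R u)) (s *\<^sub>R u) = s *\<^sub>R fd f (at (l (t, y))) u" if "t \<in> {0..1}" for t
      proof -
        have "y + (t * s) *\<^sub>R u \<in> B" using in_B[OF that, of y s] \<open>y \<in> S'\<close> by (simp add: S'_def)
        from linear_scale[OF has_derivative_linear[OF Df[OF this]]] show ?thesis by (simp add: l_def)
      qed
      ultimately have "((\<lambda>t. s *\<^sub>R fd f (at (l (t, y))) u) has_integral (f (y + s *\<^sub>R u) - f y)) {0..1}"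
        by (subst has_integral_cong[symmetric]) auto
      then show ?thesis using integral_unique[of "\<lambda>t. s *\<^sub>R fd f (at (l (t, y))) u"] by simp
    qed
    ultimately have 1: "((\<lambda>y. f (y + s *\<^sub>R u) - f y) has_derivative
        (\<lambda>w. s *\<^sub>R integral {0..1} (\<lambda>t. fd (\<lambda>y. fd f (at y) u) (at (x + (t * s) *\<^sub>R u)) w))) (at x)"
      by (rule has_derivative_transform_within_open[OF _ S'])
    have "x + s *\<^sub>R u \<in> B" using in_B[of 1 x s] S' by (auto simp: S'_def)
    moreover have "((\<lambda>y. y + s *\<^sub>R u) has_derivative (\<lambda>w. w)) (at x)"
      by (auto intro!: derivative_eq_intros)
    ultimately have "((\<lambda>y. f (y + s *\<^sub>R u)) has_derivative fd f (at (x + s *\<^sub>R u))) (at x)"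
      using has_derivative_compose[OF _ Df] by blast
    then have 2: "((\<lambda>y. f (y + s *\<^sub>R u) - f y) has_derivative (\<lambda>w. fd f (at (x + s *\<^sub>R u)) w - fd f (at x) w)) (at x)"
      by (rule has_derivative_diff[OF _ Df[OF B(2)]])
    show ?thesis using fun_cong[OF has_derivative_unique[OF 1 2], of v] unfolding I_def by simp
  qed
  have cI: "isCont I 0"
  proof -
    define l where "l ts = x + (fst ts * snd ts) *\<^sub>R u" for ts :: "real \<times> real"
    have "x + (t * s) *\<^sub>R u \<in> B" if "t \<in> {0..1}" "\<bar>s\<bar> < e" for t s
      using in_B[of t x s] that small[of s] by auto
    then have 1: "{0..1} \<times> ball 0 e \<subseteq> l -` B" by (auto simp: l_def)
    have "continuous_on (l -` B) (\<lambda>ts. fd (\<lambda>y. fd f (at y) u) (at (l ts)) v)"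
      by (rule continuous_on_compose2[OF smooth_on_continuous[OF smooth_on_fd[OF smooth_on_fd[OF B(3)]]]])
        (auto simp: l_def intro!: continuous_intros)
    from continuous_on_integral_parameter[OF 1 this]
    have "continuous_on (ball 0 e) I" unfolding I_def l_def by simp
    then show ?thesis using e by (simp add: continuous_on_eq_continuous_at)
  qed
  have "((\<lambda>s. fd f (at (x + s *\<^sub>R u)) v) has_derivative (\<lambda>s. fd (\<lambda>y. fd f (at y) v) (at x) (s *\<^sub>R u))) (at 0)"
  proof -
    have "((\<lambda>s. x + s *\<^sub>R u) has_derivative (\<lambda>s. s *\<^sub>R u)) (at 0)"
      by (auto intro!: derivative_eq_intros)
    moreover have "((\<lambda>y. fd f (at y) v) has_derivative fd (\<lambda>y. fd f (at y) v) (at x)) (at (x + 0 *\<^sub>R u))"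
      using DDf[OF B(2)] by simp
    ultimately show ?thesis by (rule has_derivative_compose)
  qed
  then have "((\<lambda>s. fd f (at (x + s *\<^sub>R u)) v) has_vector_derivative fd (\<lambda>y. fd f (at y) v) (at x) u) (at 0)"
    unfolding has_vector_derivative_def
    using linear_scale[OF has_derivative_linear[OF DDf[OF B(2)]]] by simp
  then have L: "((\<lambda>s. (1 / s) *\<^sub>R (fd f (at (x + s *\<^sub>R u)) v - fd f (at x) v)) \<longlongrightarrow> fd (\<lambda>y. fd f (at y) v) (at x) u) (at 0)"
  proof -
    let ?q = "\<lambda>s. (1 / s) *\<^sub>R (fd f (at (x + s *\<^sub>R u)) v - fd f (at x) v)"
    let ?D = "fd (\<lambda>y. fd f (at y) v) (at x) u"
    have "((\<lambda>s. norm (fd f (at (x + s *\<^sub>R u)) v - fd f (at x) v - s *\<^sub>R ?D) / norm s) \<longlongrightarrow> 0) (at 0)"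
      using \<open>(_ has_vector_derivative _) _\<close> unfolding has_vector_derivative_def has_derivative_at by simp
    moreover have "\<forall>\<^sub>F s in at (0::real). s \<noteq> 0" by (simp add: eventually_at_filter)
    then have "\<forall>\<^sub>F s in at 0. norm (fd f (at (x + s *\<^sub>R u)) v - fd f (at x) v - s *\<^sub>R ?D) / norm s = norm (?q s - ?D)"
    proof eventually_elim
      case (elim s)
      have "fd f (at (x + s *\<^sub>R u)) v - fd f (at x) v - s *\<^sub>R ?D = s *\<^sub>R (?q s - ?D)"
        using elim by (simp add: scaleR_diff_right)
      then show ?case using elim by simp
    qed
    ultimately have "((\<lambda>s. norm (?q s - ?D)) \<longlongrightarrow> 0) (at 0)" by (rule Lim_transform_eventually)
    then show ?thesis by (simp add: Lim_null[of ?q] tendsto_norm_zero_iff)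
  qed
  have "((\<lambda>s. (1 / s) *\<^sub>R (fd f (at (x + s *\<^sub>R u)) v - fd f (at x) v)) \<longlongrightarrow> I 0) (at 0)"
  proof (rule Lim_transform_eventually)
    show "(I \<longlongrightarrow> I 0) (at 0)" using cI by (simp add: isCont_def)
    have "\<forall>\<^sub>F s in at 0. \<bar>s\<bar> < e" "\<forall>\<^sub>F s in at (0::real). s \<noteq> 0"
      using e by (auto simp: eventually_at dist_real_def)
    then show "\<forall>\<^sub>F s in at 0. I s = (1 / s) *\<^sub>R (fd f (at (x + s *\<^sub>R u)) v - fd f (at x) v)"
      by eventually_elim (simp add: key)
  qed
  from tendsto_unique[OF _ L this] show ?thesis by (simp add: I_def)
qed

section \<open>Holomorphic functions are smooth\<close>

text \<open>Holomorphy with respect to a complex structure \<open>J\<close> on a real vector space.\<close>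

definition hol_on :: "('a::euclidean_space \<Rightarrow> 'a) \<Rightarrow> ('a \<Rightarrow> complex) \<Rightarrow> 'a set \<Rightarrow> bool" where
  "hol_on J f S \<longleftrightarrow>
     (\<forall>x\<in>S. f differentiable (at x) \<and> (\<forall>v. fd f (at x) (J v) = \<i> * fd f (at x) v))"

text \<open>Cauchy's integral formula on the complex line through \<open>x\<close> spanned by \<open>e\<close> and \<open>J e\<close>.\<close>

lemma hol_on_fd_circle:
  assumes f: "hol_on J f S" and r: "0 < r"
    and disc: "\<And>\<zeta>. cmod \<zeta> \<le> r \<Longrightarrow> x + (Re \<zeta> *\<^sub>R e + Im \<zeta> *\<^sub>R J e) \<in> S"
  shows "fd f (at x) e = 
    integral {0..1} (\<lambda>t::real. f (x + (Re (r * exp (2 * of_real pi * \<i> * of_real t)) *\<^sub>R e + Im (r * exp (2 * of_real pi * \<i> * of_real t)) *\<^sub>R J e)) 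
       * exp (- (2 * of_real pi * \<i> * of_real t)) / r)"
proof -
  define g where "g \<zeta> = f (x + (Re \<zeta> *\<^sub>R e + Im \<zeta> *\<^sub>R J e))" for \<zeta>
  have dg: "(g has_field_derivative fd f (at (x + (Re \<zeta> *\<^sub>R e + Im \<zeta> *\<^sub>R J e))) e) (at \<zeta>)" if "cmod \<zeta> \<le> r" for \<zeta>
  proof -
    let ?y = "x + (Re \<zeta> *\<^sub>R e + Im \<zeta> *\<^sub>R J e)"
    have d: "(f has_derivative fd f (at ?y)) (at ?y)"
      using f disc[OF that] by (auto simp: hol_on_def frechet_derivative_works)
    have "((\<lambda>\<zeta>. x + (Re \<zeta> *\<^sub>R e + Im \<zeta> *\<^sub>R J e)) has_derivative (\<lambda>\<zeta>. Re \<zeta> *\<^sub>R e + Im \<zeta> *\<^sub>R J e)) (at \<zeta>)"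
      by (auto intro!: derivative_eq_intros)
    from has_derivative_compose[OF this d]
    have "(g has_derivative (\<lambda>\<eta>. fd f (at ?y) (Re \<eta> *\<^sub>R e + Im \<eta> *\<^sub>R J e))) (at \<zeta>)"
      by (simp add: g_def[abs_def])
    moreover have "fd f (at ?y) (Re \<eta> *\<^sub>R e + Im \<eta> *\<^sub>R J e) = fd f (at ?y) e * \<eta>" for \<eta>
    proof -
      have "fd f (at ?y) (Re \<eta> *\<^sub>R e + Im \<eta> *\<^sub>R J e) = Re \<eta> *\<^sub>R fd f (at ?y) e + Im \<eta> *\<^sub>R (\<i> * fd f (at ?y) e)"
        using has_derivative_linear[OF d] f disc[OF that] by (simp add: linear_add linear_scale hol_on_def)
      also have "\<dots> = fd f (at ?y) e * (Re \<eta> + \<i> * Im \<eta>)" by (simp add: scaleR_conv_of_real algebra_simps)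
      also have "Re \<eta> + \<i> * Im \<eta> = \<eta>" by (rule complex_eq[symmetric])
      finally show ?thesis .
    qed
    ultimately show ?thesis by (simp add: has_field_derivative_def)
  qed
  have h: "g holomorphic_on ball 0 r"
    unfolding holomorphic_on_def field_differentiable_def
    using dg by (metis has_field_derivative_at_within less_imp_le mem_ball_0)
  have c: "continuous_on (cball 0 r) g"
    by (intro continuous_at_imp_continuous_on ballI) (use dg DERIV_isCont in auto)
  have "(g has_field_derivative 1 / (2 * of_real pi * \<i>) * contour_integral (circlepath 0 r) (\<lambda>u. g u / (u - 0)\<^sup>2)) (at 0)"
    by (rule Cauchy_derivative_integral_circlepath(2)[OF c h]) (use r in auto)
  from DERIV_unique[OF this dg[of 0]] r
  have "fd f (at x) e = 1 / (2 * of_real pi * \<i>) * contour_integral (circlepath 0 r) (\<lambda>u. g u / u\<^sup>2)" by simp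
  also have "\<dots> = 1 / (2 * of_real pi * \<i>) * integral {0..1} (\<lambda>t::real. g (circlepath 0 r t) / (circlepath 0 r t)\<^sup>2 * vector_derivative (circlepath 0 r) (at t))"
    by (simp add: contour_integral_integral)
  also have "\<dots> = integral {0..1} (\<lambda>t::real. 1 / (2 * of_real pi * \<i>) * (g (circlepath 0 r t) / (circlepath 0 r t)\<^sup>2 * vector_derivative (circlepath 0 r) (at t)))"
    by (rule integral_mult_right[symmetric])
  also have "\<dots> = integral {0..1} (\<lambda>t::real. g (r * exp (2 * of_real pi * \<i> * of_real t)) * exp (- (2 * of_real pi * \<i> * of_real t)) / r)"
  proof (rule Henstock_Kurzweil_Integration.integral_cong)
    fix t :: real
    show "1 / (2 * of_real pi * \<i>) * (g (circlepath 0 r t) / (circlepath 0 r t)\<^sup>2 * vector_derivative (circlepath 0 r) (at t))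
      = g (r * exp (2 * of_real pi * \<i> * of_real t)) * exp (- (2 * of_real pi * \<i> * of_real t)) / r"
      unfolding vector_derivative_circlepath
      using r by (simp add: circlepath exp_minus power2_eq_square field_simps)
  qed
  finally show ?thesis by (simp add: g_def)
qed

lemma Ck_on_exp: "Ck_on k (exp :: complex \<Rightarrow> complex) UNIV"
proof (induction k)
  case 0
  then show ?case by (auto intro: continuous_intros)
next
  case (Suc k)
  have d: "((exp :: complex \<Rightarrow> complex) has_derivative (\<lambda>v. exp x * v)) (at x)" for x
    using DERIV_exp[of x] by (simp add: has_field_derivative_def)
  have "Ck_on k (\<lambda>x. fd exp (at x) v) UNIV" for v :: complex
    unfolding fd_eqI[OF d] by (intro Ck_on_bounded_bilinear[OF bounded_bilinear_mult] Suc Ck_on_const) auto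
  then show ?case using d by (auto simp: differentiable_def)
qed

text \<open>The circle can be chosen uniformly for \<open>x\<close> near \<open>x\<^sub>0\<close>, so that the derivative becomes an integral over a
  fixed parameter domain of translates of \<open>f\<close>. Smoothness in \<open>x\<close> can then be read off under the integral sign.\<close>

lemma hol_on_fd_integral:
  assumes S: "open S" "x0 \<in> S" and f: "hol_on J f S"
  obtains B c k where "open B" "x0 \<in> B" "B \<subseteq> S" "\<And>t x. x \<in> B \<Longrightarrow> x + c t \<in> S"
    "\<And>n. Ck_on n (c :: real \<Rightarrow> _) UNIV" "\<And>n. Ck_on n (k :: real \<Rightarrow> complex) UNIV"
    "\<And>x. x \<in> B \<Longrightarrow> fd f (at x) e = integral {0..1} (\<lambda>t. f (x + c t) * k t)"
proof -
  obtain d where d: "d > 0" "ball x0 d \<subseteq> S" using S open_contains_ball by blast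
  \<comment> \<open>The summand \<open>1\<close> only keeps \<open>n\<close> positive.\<close>
  define n where "n = norm e + norm (J e) + 1"
  define r where "r = d / (2 * n)"
  have n: "n > 0" by (simp add: n_def add_nonneg_pos)
  then have r: "r > 0" using d by (simp add: r_def)
  have small: "norm (Re \<zeta> *\<^sub>R e + Im \<zeta> *\<^sub>R J e) \<le> d / 2" if "cmod \<zeta> \<le> r" for \<zeta>
  proof -
    have "norm (Re \<zeta> *\<^sub>R e + Im \<zeta> *\<^sub>R J e) \<le> \<bar>Re \<zeta>\<bar> * norm e + \<bar>Im \<zeta>\<bar> * norm (J e)"
      by (metis norm_scaleR norm_triangle_ineq)
    also have "\<dots> \<le> r * norm e + r * norm (J e)"
      using that abs_Re_le_cmod[of \<zeta>] abs_Im_le_cmod[of \<zeta>] by (intro add_mono mult_right_mono) auto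
    also have "\<dots> \<le> r * n" using r by (simp add: n_def algebra_simps)
    finally show ?thesis using n by (simp add: r_def)
  qed
  define B where "B = ball x0 (d / 2)"
  have in_S: "x + (Re \<zeta> *\<^sub>R e + Im \<zeta> *\<^sub>R J e) \<in> S" if "x \<in> B" "cmod \<zeta> \<le> r" for x \<zeta>
  proof -
    let ?c = "Re \<zeta> *\<^sub>R e + Im \<zeta> *\<^sub>R J e"
    have "dist x0 (x + ?c) \<le> dist x0 x + norm ?c"
      using dist_triangle[of x0 "x + ?c" x] by (metis add_diff_cancel_left' dist_commute dist_norm)
    also have "\<dots> < d" using that small[OF that(2)] by (simp add: B_def)
    finally show ?thesis using d by auto
  qed
  define \<zeta> where "\<zeta> t = r * exp (2 * of_real pi * \<i> * of_real t)" for t :: real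
  define c where "c t = Re (\<zeta> t) *\<^sub>R e + Im (\<zeta> t) *\<^sub>R J e" for t
  define k where "k t = exp (- (2 * of_real pi * \<i> * of_real t)) / of_real r" for t :: real
  have \<zeta>: "cmod (\<zeta> t) \<le> r" for t using r by (simp add: \<zeta>_def norm_mult)
  have lin: "Ck_on m (\<lambda>t. exp (a * of_real t)) UNIV" for m and a :: complex
  proof (rule Ck_on_compose[OF _ _ _ Ck_on_exp])
    show "Ck_on m (\<lambda>t. a * of_real t) UNIV"
      using Ck_on_bounded_linear_compose[OF bounded_linear_const_mult[OF bounded_linear_of_real, of a] open_UNIV Ck_on_ident] by auto
  qed auto
  have \<zeta>s: "Ck_on m \<zeta> UNIV" for m
    unfolding \<zeta>_def by (rule Ck_on_bounded_linear_compose[OF bounded_linear_mult_right open_UNIV lin])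
  show thesis
  proof (rule that[of B c k])
    show "x + c t \<in> S" if "x \<in> B" for t x using in_S[OF that \<zeta>] by (simp add: c_def)
    show "Ck_on m c UNIV" for m
      unfolding c_def
      by (intro Ck_on_add Ck_on_bounded_bilinear[OF bounded_bilinear_scaleR] Ck_on_const open_UNIV
          Ck_on_bounded_linear_compose[OF bounded_linear_Re] Ck_on_bounded_linear_compose[OF bounded_linear_Im] \<zeta>s)
    show "Ck_on m k UNIV" for m
      using Ck_on_bounded_linear_compose[OF bounded_linear_divide[of "of_real r"] open_UNIV lin[of m "- (2 * of_real pi * \<i>)"]]
      unfolding k_def by simp
    show "fd f (at x) e = integral {0..1} (\<lambda>t. f (x + c t) * k t)" if "x \<in> B" for x
      using hol_on_fd_circle[OF f r in_S[OF that]] by (simp add: c_def k_def \<zeta>_def)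
  qed (use d in \<open>auto simp: B_def\<close>)
qed

lemma hol_on_fd_continuous:
  assumes "open S" "hol_on J f S"
  shows "continuous_on S (\<lambda>x. fd f (at x) e)"
proof (intro continuous_at_imp_continuous_on ballI)
  fix x0 assume "x0 \<in> S"
  from hol_on_fd_integral[OF assms(1) this assms(2)] obtain B c k where B: "open B" "x0 \<in> B" "B \<subseteq> S"
    "\<And>t x. x \<in> B \<Longrightarrow> x + c t \<in> S" "\<And>n. Ck_on n c UNIV" "\<And>n. Ck_on n (k :: real \<Rightarrow> complex) UNIV"
    "\<And>x. x \<in> B \<Longrightarrow> fd f (at x) e = integral {0..1} (\<lambda>t. f (x + c t) * k t)" by blast
  have f: "continuous_on S f"
    using assms(2) by (auto simp: hol_on_def intro!: continuous_at_imp_continuous_on differentiable_imp_continuous_within)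
  have fst: "continuous_on (UNIV \<times> B) (\<lambda>tx. h (fst tx))" if "continuous_on UNIV h" for h :: "real \<Rightarrow> 'd::topological_space"
    by (rule continuous_on_compose2[OF that continuous_on_fst[OF continuous_on_id]]) simp
  have "continuous_on (UNIV \<times> B) (\<lambda>tx. f (snd tx + c (fst tx)))"
    by (rule continuous_on_compose2[OF f continuous_on_add[OF continuous_on_snd[OF continuous_on_id]
            fst[OF Ck_on_continuous[OF B(5)[of 0]]]]])
      (use B(4) in auto)
  from continuous_on_mult[OF this fst[OF Ck_on_continuous[OF B(6)[of 0]]]]
  have *: "continuous_on (UNIV \<times> B) (\<lambda>tx. f (snd tx + c (fst tx)) * k (fst tx))" .
  have "continuous_on B (\<lambda>x. integral {0..1} (\<lambda>t. f (x + c t) * k t))"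
    using continuous_on_integral_parameter[OF _ *, of B] by simp blast
  then have "continuous_on B (\<lambda>x. fd f (at x) e)"
    by (rule continuous_on_cong[THEN iffD1, rotated -1]) (use B in auto)
  then show "isCont (\<lambda>x. fd f (at x) e) x0" using B(1,2) continuous_on_eq_continuous_at by blast
qed

text \<open>Differentiation under the integral requires continuous first derivatives, which the preceding lemma
  supplies from the continuity of \<open>f\<close> alone.\<close>

lemma hol_on_fd:
  assumes "open S" "hol_on J f S"
  shows "hol_on J (\<lambda>x. fd f (at x) e) S"
  unfolding hol_on_def
proof
  fix x0 assume "x0 \<in> S"
  from hol_on_fd_integral[OF assms(1) this assms(2)] obtain B c k where B: "open B" "x0 \<in> B" "B \<subseteq> S"
    "\<And>t x. x \<in> B \<Longrightarrow> x + c t \<in> S" "\<And>n. Ck_on n c UNIV" "\<And>n. Ck_on n (k :: real \<Rightarrow> complex) UNIV"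
    "\<And>x. x \<in> B \<Longrightarrow> fd f (at x) e = integral {0..1} (\<lambda>t. f (x + c t) * k t)" by blast
  define g where "g tx = f (snd tx + c (fst tx)) * k (fst tx)" for tx
  have f1: "Ck_on 1 f S" using hol_on_fd_continuous[OF assms] assms(2) by (simp add: hol_on_def)
  have o: "open (UNIV \<times> B :: (real \<times> 'a) set)" using B(1) by (simp add: open_Times)
  have fst: "Ck_on 1 (\<lambda>tx. h (fst tx)) (UNIV \<times> B :: (real \<times> 'a) set)"
    if "Ck_on 1 h UNIV" for h :: "real \<Rightarrow> 'd::euclidean_space"
    by (rule Ck_on_compose[OF o open_UNIV _ that Ck_on_bounded_linear_compose[OF bounded_linear_fst o Ck_on_ident[OF o]]]) auto
  have g1: "Ck_on 1 g (UNIV \<times> B)"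
    unfolding g_def
    by (intro Ck_on_bounded_bilinear[OF bounded_bilinear_mult o] fst B(6)
        Ck_on_compose[OF o assms(1) _ f1] Ck_on_add[OF o] B(5)
        Ck_on_bounded_linear_compose[OF bounded_linear_snd o Ck_on_ident[OF o]]) (use B(4) in auto)
  have Dg: "fd g (at (t, x)) (0, v) = fd f (at (x + c t)) v * k t" if "x \<in> B" for t x v
  proof -
    have "(g has_derivative fd g (at (t, x))) (at (t, x))"
      using g1 that by (auto simp: frechet_derivative_works)
    from has_derivative_compose[OF has_derivative_Pair[OF has_derivative_const has_derivative_ident] this]
    have 1: "((\<lambda>y. f (y + c t) * k t) has_derivative (\<lambda>v. fd g (at (t, x)) (0, v))) (at x)"
      by (simp add: g_def)
    have "((\<lambda>y. y + c t) has_derivative (\<lambda>v. v)) (at x)" by (auto intro!: derivative_eq_intros)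
    moreover have "(f has_derivative fd f (at (x + c t))) (at (x + c t))"
      using assms(2) B(4)[OF that] unfolding hol_on_def frechet_derivative_works[symmetric] by blast
    ultimately have "((\<lambda>y. f (y + c t)) has_derivative fd f (at (x + c t))) (at x)"
      using has_derivative_compose by blast
    from has_derivative_unique[OF 1 has_derivative_mult_left[OF this]] show ?thesis by (rule fun_cong)
  qed
  have "((\<lambda>x. integral {0..1} (\<lambda>t. g (t, x))) has_derivative
      (\<lambda>v. integral {0..1} (\<lambda>t. fd g (at (t, x0)) (0, v)))) (at x0)"
    using g1 by (intro has_derivative_integral_parameter[where W = "UNIV \<times> B", OF _ B(1,2)]) auto
  moreover have "integral {0..1} (\<lambda>t. g (t, x)) = fd f (at x) e" if "x \<in> B" for x
    using B(7)[OF that] by (simp add: g_def)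
  ultimately have "((\<lambda>x. fd f (at x) e) has_derivative
      (\<lambda>v. integral {0..1} (\<lambda>t. fd f (at (x0 + c t)) v * k t))) (at x0)"
    unfolding Dg[OF B(2)] by (rule has_derivative_transform_within_open[OF _ B(1,2)])
  note d = this
  have "integral {0..1} (\<lambda>t. fd f (at (x0 + c t)) (J v) * k t) = \<i> * integral {0..1} (\<lambda>t. fd f (at (x0 + c t)) v * k t)" for v
  proof -
    have "fd f (at (x0 + c t)) (J v) = \<i> * fd f (at (x0 + c t)) v" for t
      using assms(2) B(4)[OF B(2)] unfolding hol_on_def by blast
    then show ?thesis by (simp add: mult.assoc)
  qed
  note J = this
  show "(\<lambda>x. fd f (at x) e) differentiable (at x0) \<and>
     (\<forall>v. fd (\<lambda>x. fd f (at x) e) (at x0) (J v) = \<i> * fd (\<lambda>x. fd f (at x) e) (at x0) v)"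
  proof
    show "(\<lambda>x. fd f (at x) e) differentiable (at x0)" by (rule differentiableI[OF d])
    show "\<forall>v. fd (\<lambda>x. fd f (at x) e) (at x0) (J v) = \<i> * fd (\<lambda>x. fd f (at x) e) (at x0) v"
      unfolding fd_eqI[OF d] using J by (rule allI)
  qed
qed

lemma hol_on_smooth:
  assumes "open S" "hol_on J f S"
  shows "smooth_on f S"
proof -
  have "Ck_on k f S" for k
    using assms(2)
  proof (induction k arbitrary: f)
    case 0
    then show ?case
      by (auto simp: hol_on_def intro!: continuous_at_imp_continuous_on differentiable_imp_continuous_within)
  next
    case (Suc k)
    have "Ck_on k (\<lambda>x. fd f (at x) v) S" for v by (rule Suc.IH[OF hol_on_fd[OF assms(1) Suc.prems]])
    moreover have "\<forall>x\<in>S. f differentiable (at x)" using Suc.prems unfolding hol_on_def by blast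
    ultimately show ?case by simp
  qed
  then show ?thesis by (simp add: smooth_on_def)
qed

section \<open>Complex vector fields\<close>

lemma vcnj_component [simp]: "vcnj v $ j = cnj (v $ j)"
  by (simp add: vcnj_def)

lemma vcnj_vcnj [simp]: "vcnj (vcnj v) = v" by (simp add: vec_eq_iff)

lemma vcnj_add: "vcnj (u + v) = vcnj u + vcnj v" by (simp add: vec_eq_iff)

lemma vcnj_0 [simp]: "vcnj 0 = 0" by (simp add: vec_eq_iff)

lemma vcnj_smult: "vcnj (c *s v) = cnj c *s vcnj v" by (simp add: vec_eq_iff)

lemma vcnj_scaleR: "vcnj (r *\<^sub>R v) = r *\<^sub>R vcnj v" by (simp add: vec_eq_iff)

lemma bounded_linear_vcnj: "bounded_linear vcnj"
  by (intro linear_conv_bounded_linear[THEN iffD1] linearI vcnj_add vcnj_scaleR)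

lemma scaleR_vec_smult: "r *\<^sub>R (v :: complex^'n) = complex_of_real r *s v"
  by (simp only: vec_eq_iff vector_scaleR_component vector_smult_component) (simp add: scaleR_conv_of_real)

text \<open>A complex tangent vector is \<open>u + \<i> v\<close> for two real ones; these are \<open>u\<close> and \<open>v\<close>.\<close>

definition real_part :: "('n::finite) cvector \<Rightarrow> complex^'n" where
  "real_part x = (1 / 2) *s (fst x + vcnj (snd x))"

definition imag_part :: "('n::finite) cvector \<Rightarrow> complex^'n" where
  "imag_part x = (- \<i> / 2) *s (fst x - vcnj (snd x))"

lemma complex_vec_expand:
  fixes v :: "complex^'n"
  shows "v = (\<Sum>j\<in>UNIV. Re (v $ j) *\<^sub>R axis j 1 + Im (v $ j) *\<^sub>R axis j \<i>)"
proof -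
  have "(\<Sum>j\<in>UNIV. (Re (v $ j) *\<^sub>R axis j 1 + Im (v $ j) *\<^sub>R axis j \<i>) $ i) = v $ i" for i
  proof -
    have "(\<Sum>j\<in>UNIV. (Re (v $ j) *\<^sub>R axis j 1 + Im (v $ j) *\<^sub>R axis j \<i>) $ i)
      = (\<Sum>j\<in>UNIV. if i = j then v $ j else 0)"
      by (intro sum.cong refl) (auto simp: axis_def complex_eq_iff)
    then show ?thesis by simp
  qed
  then have "(\<Sum>j\<in>UNIV. Re (v $ j) *\<^sub>R axis j 1 + Im (v $ j) *\<^sub>R axis j \<i>) $ i = v $ i" for i
    unfolding sum_component .
  then show ?thesis unfolding vec_eq_iff[of v] by presburger
qed

lemma linear_complex_vec_expand:
  fixes D :: "complex^'n \<Rightarrow> complex"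
  assumes "linear D"
  shows "D v = (\<Sum>j\<in>UNIV. Re (v $ j) * D (axis j 1) + Im (v $ j) * D (axis j \<i>))"
  by (subst complex_vec_expand[of v])
    (simp only: linear_sum[OF assms] linear_add[OF assms] linear_scale[OF assms], simp add: scaleR_conv_of_real)

text \<open>This reduces the calculus of complex tangent vectors to that of the real differential.\<close>

lemma cvector_apply_real_imag:
  assumes "\<phi> differentiable (at p)"
  shows "cvector_apply x \<phi> p = fd \<phi> (at p) (real_part x) + \<i> * fd \<phi> (at p) (imag_part x)"
proof -
  let ?D = "fd \<phi> (at p)"
  have lin: "linear ?D" using assms frechet_derivative_works has_derivative_linear by blast
  have "?D (real_part x) + \<i> * ?D (imag_part x) =
    (\<Sum>j\<in>UNIV. (Re (real_part x $ j) + \<i> * Re (imag_part x $ j)) * ?D (axis j 1) +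
                (Im (real_part x $ j) + \<i> * Im (imag_part x $ j)) * ?D (axis j \<i>))"
    unfolding linear_complex_vec_expand[OF lin, of "real_part x"] linear_complex_vec_expand[OF lin, of "imag_part x"]
    by (simp add: sum_distrib_left sum.distrib[symmetric] algebra_simps)
  also have "\<dots> = cvector_apply x \<phi> p"
    unfolding cvector_apply_def
  proof (rule sum.cong)
    fix j
    have "Re (real_part x $ j) + \<i> * Re (imag_part x $ j) = (fst x $ j + snd x $ j) / 2"
      "Im (real_part x $ j) + \<i> * Im (imag_part x $ j) = - \<i> * (fst x $ j - snd x $ j) / 2"
      by (auto simp: real_part_def imag_part_def complex_eq_iff diff_divide_distrib)
    then show "(Re (real_part x $ j) + \<i> * Re (imag_part x $ j)) * ?D (axis j 1) +
                (Im (real_part x $ j) + \<i> * Im (imag_part x $ j)) * ?D (axis j \<i>) =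
               fst x $ j * wirtinger j \<phi> p + snd x $ j * wirtinger_bar j \<phi> p"
      by (simp only:) (simp add: wirtinger_def wirtinger_bar_def field_simps)
  qed simp
  finally show ?thesis by simp
qed

lemma cvector_apply_cong:
  assumes "\<forall>\<^sub>F q in nhds p. \<phi> q = \<psi> q"
  shows "cvector_apply x \<phi> p = cvector_apply x \<psi> p"
  unfolding cvector_apply_def wirtinger_def wirtinger_bar_def fd_cong_eventually[OF assms] ..

lemma cvector_apply_add_vector:
  "cvector_apply (x + y) \<phi> p = cvector_apply x \<phi> p + cvector_apply y \<phi> p"
  by (simp add: cvector_apply_def algebra_simps sum.distrib)

lemma cvector_apply_diff_vector:
  "cvector_apply (x - y) \<phi> p = cvector_apply x \<phi> p - cvector_apply y \<phi> p"
  by (simp add: cvector_apply_def algebra_simps sum.distrib sum_subtractf)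

lemma cvector_apply_scale_vector:
  "cvector_apply (c *s fst x, c *s snd x) \<phi> p = c * cvector_apply x \<phi> p"
  by (simp add: cvector_apply_def algebra_simps sum_distrib_left sum.distrib)

lemma cvector_apply_0 [simp]: "cvector_apply 0 \<phi> p = 0"
  by (simp add: cvector_apply_def)

lemma cvector_apply_add:
  assumes "\<phi> differentiable (at p)" "\<psi> differentiable (at p)"
  shows "cvector_apply x (\<lambda>q. \<phi> q + \<psi> q) p = cvector_apply x \<phi> p + cvector_apply x \<psi> p"
proof -
  have "fd (\<lambda>q. \<phi> q + \<psi> q) (at p) = (\<lambda>v. fd \<phi> (at p) v + fd \<psi> (at p) v)"
    using assms by (intro fd_eqI has_derivative_add) (auto simp: frechet_derivative_works[symmetric])
  then show ?thesis
    using assms by (simp add: cvector_apply_real_imag differentiable_add algebra_simps)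
qed

lemma cvector_apply_mult:
  assumes "\<phi> differentiable (at p)" "\<psi> differentiable (at p)"
  shows "cvector_apply x (\<lambda>q. \<phi> q * \<psi> q) p = \<phi> p * cvector_apply x \<psi> p + cvector_apply x \<phi> p * \<psi> p"
proof -
  have "fd (\<lambda>q. \<phi> q * \<psi> q) (at p) = (\<lambda>v. \<phi> p * fd \<psi> (at p) v + fd \<phi> (at p) v * \<psi> p)"
    using assms by (intro fd_eqI has_derivative_mult) (auto simp: frechet_derivative_works[symmetric])
  then show ?thesis
    using assms by (simp add: cvector_apply_real_imag differentiable_mult algebra_simps)
qed

lemma cvector_apply_const [simp]: "cvector_apply x (\<lambda>_. c) p = 0"
  by (simp add: cvector_apply_real_imag fd_eqI[OF has_derivative_const])

lemma cvector_apply_sum: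
  assumes "\<And>i. i \<in> I \<Longrightarrow> \<phi> i differentiable (at p)"
  shows "cvector_apply x (\<lambda>q. \<Sum>i\<in>I. \<phi> i q) p = (\<Sum>i\<in>I. cvector_apply x (\<phi> i) p)"
  using assms
  by (induction I rule: infinite_finite_induct) (simp_all add: cvector_apply_add differentiable_sum)

definition cvector_cnj :: "('n::finite) cvector \<Rightarrow> 'n cvector" where
  "cvector_cnj x = (vcnj (snd x), vcnj (fst x))"

lemma cvector_apply_cnj:
  assumes "\<phi> differentiable (at p)"
  shows "cvector_apply x (\<lambda>q. cnj (\<phi> q)) p = cnj (cvector_apply (cvector_cnj x) \<phi> p)"
proof -
  have d: "(\<phi> has_derivative fd \<phi> (at p)) (at p)" using assms frechet_derivative_works by blast
  have "((\<lambda>q. cnj (\<phi> q)) has_derivative (\<lambda>v. cnj (fd \<phi> (at p) v))) (at p)"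
    by (rule has_derivative_cnj[OF d])
  moreover have "real_part (cvector_cnj x) = real_part x" "imag_part (cvector_cnj x) = - imag_part x"
    by (simp_all add: real_part_def imag_part_def cvector_cnj_def vec_eq_iff field_simps)
  ultimately show ?thesis
    using assms linear_neg[OF has_derivative_linear[OF d]]
    by (simp add: cvector_apply_real_imag fd_eqI differentiableI)
qed

lemma cvector_apply_holomorphic:
  assumes "\<phi> differentiable (at p)" "\<And>v. fd \<phi> (at p) (\<i> *s v) = \<i> * fd \<phi> (at p) v"
  shows "cvector_apply x \<phi> p = fd \<phi> (at p) (fst x)"
proof -
  have "real_part x + \<i> *s imag_part x = fst x"
    by (simp add: real_part_def imag_part_def vec_eq_iff field_simps)
  moreover have "linear (fd \<phi> (at p))"
    using assms(1) frechet_derivative_works has_derivative_linear by blast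
  ultimately show ?thesis
    using assms linear_add[of "fd \<phi> (at p)" "real_part x" "\<i> *s imag_part x"]
    by (simp add: cvector_apply_real_imag)
qed

lemma smooth_near_component:
  "smooth_near f a \<Longrightarrow> smooth_near (\<lambda>x. f x $ j) a"
  by (rule smooth_near_linear[OF bounded_linear_vec_nth])

lemma smooth_near_cnj: "smooth_near f a \<Longrightarrow> smooth_near (\<lambda>x. cnj (f x)) a"
  by (rule smooth_near_linear[OF bounded_linear_cnj])

lemma smooth_near_vcnj: "smooth_near f a \<Longrightarrow> smooth_near (\<lambda>x. vcnj (f x)) a"
  by (rule smooth_near_linear[OF bounded_linear_vcnj])

lemma smooth_near_wirtinger:
  assumes "smooth_near \<phi> a"
  shows "smooth_near (wirtinger j \<phi>) a" "smooth_near (wirtinger_bar j \<phi>) a"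
proof -
  have D: "smooth_near (\<lambda>q. c * fd \<phi> (at q) v) a" for c v
    by (intro smooth_near_mult smooth_near_const smooth_near_fd assms)
  have "wirtinger j \<phi> = (\<lambda>p. (1/2) * fd \<phi> (at p) (axis j 1) + (- \<i> / 2) * fd \<phi> (at p) (axis j \<i>))"
    "wirtinger_bar j \<phi> = (\<lambda>p. (1/2) * fd \<phi> (at p) (axis j 1) + (\<i> / 2) * fd \<phi> (at p) (axis j \<i>))"
    by (auto simp: wirtinger_def wirtinger_bar_def diff_divide_distrib add_divide_distrib)
  then show "smooth_near (wirtinger j \<phi>) a" "smooth_near (wirtinger_bar j \<phi>) a"
    by (auto simp only: intro!: smooth_near_add D)
qed

lemma smooth_near_fst: "smooth_near f a \<Longrightarrow> smooth_near (\<lambda>x. fst (f x)) a"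
  by (rule smooth_near_linear[OF bounded_linear_fst])

lemma smooth_near_snd: "smooth_near f a \<Longrightarrow> smooth_near (\<lambda>x. snd (f x)) a"
  by (rule smooth_near_linear[OF bounded_linear_snd])

lemma smooth_near_cvector_apply:
  assumes "smooth_near X a" "smooth_near \<phi> a"
  shows "smooth_near (\<lambda>p. cvector_apply (X p) \<phi> p) a"
  unfolding cvector_apply_def
  by (intro smooth_near_sum smooth_near_add smooth_near_mult smooth_near_component smooth_near_fst
      smooth_near_snd smooth_near_wirtinger assms)

lemma smooth_near_differentiable_at: "smooth_near f a \<Longrightarrow> f differentiable (at a)"
  using smooth_near_has_derivative differentiableI by blast

lemma smooth_near_vec:
  assumes "\<And>j. smooth_near (\<lambda>x. f x $ j) a"
  shows "smooth_near (f :: 'a::real_normed_vector \<Rightarrow> complex^'n) a"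
proof -
  have "bounded_linear (axis j :: complex \<Rightarrow> complex^'n)" for j
    by (intro linear_conv_bounded_linear[THEN iffD1] linearI) (auto simp: axis_def vec_eq_iff)
  then have "smooth_near (\<lambda>x. \<Sum>j\<in>UNIV. axis j (f x $ j)) a"
    using assms by (intro smooth_near_sum smooth_near_linear[of "axis _"])
  moreover have "(\<Sum>j\<in>UNIV. axis j (f x $ j)) = f x" for x
    by (simp add: vec_eq_iff axis_def if_distrib cong: if_cong)
  ultimately show ?thesis by simp
qed

lemma smooth_near_lie_bracket:
  assumes "smooth_near X a" "smooth_near Y a"
  shows "smooth_near (lie_bracket X Y) a"
proof -
  have *: "smooth_near (\<lambda>p. cvector_apply (X p) \<phi> p - cvector_apply (Y p) \<psi> p) a"
    if "smooth_near \<phi> a" "smooth_near \<psi> a" for \<phi> \<psi>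
  proof -
    have "smooth_near (\<lambda>p. cvector_apply (X p) \<phi> p + (-1) * cvector_apply (Y p) \<psi> p) a"
      by (intro smooth_near_add smooth_near_mult smooth_near_const smooth_near_cvector_apply assms that)
    then show ?thesis by simp
  qed
  show ?thesis
    unfolding lie_bracket_def[abs_def]
    by (intro smooth_near_Pair smooth_near_vec)
      (simp_all add: * smooth_near_component smooth_near_fst smooth_near_snd assms)
qed

text \<open>The derivative along \<open>x\<close> falls either on the coefficients of \<open>Y\<close> or on \<open>\<phi>\<close>. The second part is symmetric
  in the two vectors and cancels in a commutator.\<close>

lemma cvector_apply_cvector_apply:
  assumes "smooth_near Y p" "smooth_near \<phi> p"
  shows "cvector_apply x (\<lambda>q. cvector_apply (Y q) \<phi> q) p =
    cvector_apply ((\<chi> k. cvector_apply x (\<lambda>q. fst (Y q) $ k) p), (\<chi> k. cvector_apply x (\<lambda>q. snd (Y q) $ k) p)) \<phi> p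
    + cvector_apply x (\<lambda>q. cvector_apply (Y p) \<phi> q) p"
proof -
  have d: "(\<lambda>q. fst (Y q) $ j) differentiable (at p)" "(\<lambda>q. snd (Y q) $ j) differentiable (at p)"
    "wirtinger j \<phi> differentiable (at p)" "wirtinger_bar j \<phi> differentiable (at p)" for j
    by (intro smooth_near_differentiable_at smooth_near_component smooth_near_fst smooth_near_snd
        smooth_near_wirtinger assms)+
  note rules = cvector_apply_sum cvector_apply_add cvector_apply_mult differentiable_mult differentiable_add d
  define a b where "a j = cvector_apply x (wirtinger j \<phi>) p" and "b j = cvector_apply x (wirtinger_bar j \<phi>) p" for j
  have 1: "cvector_apply x (\<lambda>q. cvector_apply (Y q) \<phi> q) p = (\<Sum>j\<in>UNIV.
     (fst (Y p) $ j * a j + cvector_apply x (\<lambda>q. fst (Y q) $ j) p * wirtinger j \<phi> p)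
    + (snd (Y p) $ j * b j + cvector_apply x (\<lambda>q. snd (Y q) $ j) p * wirtinger_bar j \<phi> p))"
    unfolding cvector_apply_def[of "Y _"] a_def b_def by (simp add: rules)
  have 2: "cvector_apply x (\<lambda>q. cvector_apply (Y p) \<phi> q) p = (\<Sum>j\<in>UNIV. fst (Y p) $ j * a j + snd (Y p) $ j * b j)"
    unfolding cvector_apply_def[of "Y _"] a_def b_def by (simp add: rules)
  show ?thesis
    unfolding 1 2
    unfolding cvector_apply_def[of "(_, _)"] by (simp add: sum.distrib algebra_simps)
qed

lemma cvector_apply_commute:
  assumes "smooth_near \<phi> p"
  shows "cvector_apply x (\<lambda>q. cvector_apply y \<phi> q) p = cvector_apply y (\<lambda>q. cvector_apply x \<phi> q) p"
proof -
  obtain S where S: "open S" "p \<in> S" "smooth_on \<phi> S" using assms unfolding smooth_near_iff by blast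
  have *: "cvector_apply x (\<lambda>q. cvector_apply y \<phi> q) p =
      fd (\<lambda>q. fd \<phi> (at q) (real_part y)) (at p) (real_part x) + \<i> * fd (\<lambda>q. fd \<phi> (at q) (imag_part y)) (at p) (real_part x)
     + \<i> * (fd (\<lambda>q. fd \<phi> (at q) (real_part y)) (at p) (imag_part x) + \<i> * fd (\<lambda>q. fd \<phi> (at q) (imag_part y)) (at p) (imag_part x))"
    for x y
  proof -
    have "\<forall>\<^sub>F q in nhds p. cvector_apply y \<phi> q = fd \<phi> (at q) (real_part y) + \<i> * fd \<phi> (at q) (imag_part y)"
      unfolding eventually_nhds
      by (intro exI[of _ S] conjI ballI S(1,2) cvector_apply_real_imag smooth_on_differentiable[OF S(3)])
    from cvector_apply_cong[OF this]
    have "cvector_apply x (\<lambda>q. cvector_apply y \<phi> q) p =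
      cvector_apply x (\<lambda>q. fd \<phi> (at q) (real_part y) + \<i> * fd \<phi> (at q) (imag_part y)) p" .
    moreover have d: "(\<lambda>q. fd \<phi> (at q) v) differentiable (at p)" for v
      using smooth_near_differentiable_at smooth_near_fd assms by blast
    ultimately show ?thesis
      by (simp add: cvector_apply_add cvector_apply_mult differentiable_mult cvector_apply_real_imag[OF d] algebra_simps)
  qed
  show ?thesis
    unfolding *[of x y] *[of y x]
    unfolding fd_fd_symmetric[OF S, of _ "real_part x"] fd_fd_symmetric[OF S, of _ "imag_part x"]
    by (simp add: algebra_simps)
qed

lemma cvector_apply_lie_bracket:
  assumes "smooth_near X p" "smooth_near Y p" "smooth_near \<phi> p"
  shows "cvector_apply (lie_bracket X Y p) \<phi> p =
    cvector_apply (X p) (\<lambda>q. cvector_apply (Y q) \<phi> q) p - cvector_apply (Y p) (\<lambda>q. cvector_apply (X q) \<phi> q) p"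
proof -
  have "lie_bracket X Y p =
    ((\<chi> k. cvector_apply (X p) (\<lambda>q. fst (Y q) $ k) p), (\<chi> k. cvector_apply (X p) (\<lambda>q. snd (Y q) $ k) p)) -
    ((\<chi> k. cvector_apply (Y p) (\<lambda>q. fst (X q) $ k) p), (\<chi> k. cvector_apply (Y p) (\<lambda>q. snd (X q) $ k) p))"
    by (simp add: lie_bracket_def vec_eq_iff)
  then have "cvector_apply (lie_bracket X Y p) \<phi> p =
    cvector_apply ((\<chi> k. cvector_apply (X p) (\<lambda>q. fst (Y q) $ k) p), (\<chi> k. cvector_apply (X p) (\<lambda>q. snd (Y q) $ k) p)) \<phi> p -
    cvector_apply ((\<chi> k. cvector_apply (Y p) (\<lambda>q. fst (X q) $ k) p), (\<chi> k. cvector_apply (Y p) (\<lambda>q. snd (X q) $ k) p)) \<phi> p"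
    by (simp only: cvector_apply_diff_vector)
  then show ?thesis
    using cvector_apply_cvector_apply[OF assms(2,3), of "X p"] cvector_apply_cvector_apply[OF assms(1,3), of "Y p"]
      cvector_apply_commute[OF assms(3), of "X p" "Y p"]
    by simp
qed

section \<open>Order of vanishing along vector fields\<close>

text \<open>For fields \<open>T\<close> spanning the tangent spaces of a manifold, this is vanishing to order \<open>l\<close> at \<open>0\<close> of the
  restriction of \<open>\<phi>\<close> to the manifold, expressed without coordinates on the manifold.\<close>

primrec vanishes :: "('n::finite) cfield set \<Rightarrow> nat \<Rightarrow> (complex^'n \<Rightarrow> complex) \<Rightarrow> bool" where
  "vanishes T 0 \<phi> \<longleftrightarrow> smooth_near \<phi> 0"
| "vanishes T (Suc l) \<phi> \<longleftrightarrow> smooth_near \<phi> 0 \<and> \<phi> 0 = 0 \<and>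
     (\<forall>X\<in>T. vanishes T l (\<lambda>p. cvector_apply (X p) \<phi> p))"

locale smooth_fields =
  fixes T :: "('n::finite) cfield set"
  assumes smooth: "X \<in> T \<Longrightarrow> smooth_near X 0"
    and bracket: "X \<in> T \<Longrightarrow> Y \<in> T \<Longrightarrow> lie_bracket X Y \<in> T"
begin

lemma vanishes_smooth: "vanishes T l \<phi> \<Longrightarrow> smooth_near \<phi> 0"
  by (cases l) auto

lemma vanishes_cong:
  assumes "\<forall>\<^sub>F p in nhds 0. \<phi> p = \<psi> p" "vanishes T l \<phi>"
  shows "vanishes T l \<psi>"
  using assms
proof (induction l arbitrary: \<phi> \<psi>)
  case 0
  then show ?case using smooth_near_cong by fastforce
next
  case (Suc l)
  have e: "\<forall>\<^sub>F p in nhds 0. cvector_apply (X p) \<phi> p = cvector_apply (X p) \<psi> p" for X :: "'n cfield"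
  proof -
    have "\<forall>\<^sub>F p in nhds 0. \<forall>\<^sub>F q in nhds p. \<phi> q = \<psi> q"
      using Suc.prems(1) by (simp add: eventually_eventually)
    then show ?thesis by eventually_elim (rule cvector_apply_cong)
  qed
  have "\<phi> 0 = \<psi> 0" using eventually_nhds_x_imp_x[OF Suc.prems(1)] .
  moreover have "smooth_near \<psi> 0" using smooth_near_cong[OF Suc.prems(1)] Suc.prems(2) by simp
  moreover have "vanishes T l (\<lambda>p. cvector_apply (X p) \<psi> p)" if "X \<in> T" for X
    using Suc.IH[OF e[of X]] Suc.prems(2) that by simp
  ultimately show ?case using Suc.prems(2) by simp
qed

lemma vanishes_Suc_D: "vanishes T (Suc l) \<phi> \<Longrightarrow> vanishes T l \<phi>"
  by (induction l arbitrary: \<phi>) auto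

lemma vanishes_mono: "vanishes T l \<phi> \<Longrightarrow> l' \<le> l \<Longrightarrow> vanishes T l' \<phi>"
  by (induction l) (auto simp: le_Suc_eq simp del: vanishes.simps dest: vanishes_Suc_D)

lemma vanishes_apply: "vanishes T (Suc l) \<phi> \<Longrightarrow> X \<in> T \<Longrightarrow> vanishes T l (\<lambda>p. cvector_apply (X p) \<phi> p)"
  by simp

lemma vanishes_add:
  assumes "vanishes T l \<phi>" "vanishes T l \<psi>"
  shows "vanishes T l (\<lambda>p. \<phi> p + \<psi> p)"
  using assms
proof (induction l arbitrary: \<phi> \<psi>)
  case 0
  then show ?case by (simp add: smooth_near_add)
next
  case (Suc l)
  then have s: "smooth_near \<phi> 0" "smooth_near \<psi> 0" by auto
  have "vanishes T l (\<lambda>p. cvector_apply (X p) (\<lambda>q. \<phi> q + \<psi> q) p)" if "X \<in> T" for X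
  proof (rule vanishes_cong)
    show "vanishes T l (\<lambda>p. cvector_apply (X p) \<phi> p + cvector_apply (X p) \<psi> p)"
      using Suc that by simp
    show "\<forall>\<^sub>F p in nhds 0. cvector_apply (X p) \<phi> p + cvector_apply (X p) \<psi> p = cvector_apply (X p) (\<lambda>q. \<phi> q + \<psi> q) p"
      using smooth_near_differentiable[OF s(1)] smooth_near_differentiable[OF s(2)]
      by eventually_elim (simp add: cvector_apply_add)
  qed
  then show ?case using Suc.prems s by (simp add: smooth_near_add)
qed

lemma vanishes_apply_mult:
  assumes s: "smooth_near f 0" "smooth_near \<phi> 0"
    and "vanishes T l (\<lambda>p. f p * cvector_apply (X p) \<phi> p)" "vanishes T l (\<lambda>p. cvector_apply (X p) f p * \<phi> p)"
  shows "vanishes T l (\<lambda>p. cvector_apply (X p) (\<lambda>q. f q * \<phi> q) p)"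
proof (rule vanishes_cong[OF _ vanishes_add[OF assms(3,4)]])
  show "\<forall>\<^sub>F p in nhds 0. f p * cvector_apply (X p) \<phi> p + cvector_apply (X p) f p * \<phi> p = cvector_apply (X p) (\<lambda>q. f q * \<phi> q) p"
    using smooth_near_differentiable[OF s(1)] smooth_near_differentiable[OF s(2)]
    by eventually_elim (simp add: cvector_apply_mult)
qed

lemma vanishes_mult:
  assumes "smooth_near f 0" "vanishes T l \<phi>"
  shows "vanishes T l (\<lambda>p. f p * \<phi> p)"
  using assms
proof (induction l arbitrary: f \<phi>)
  case 0
  then show ?case by (simp add: smooth_near_mult)
next
  case (Suc l)
  then have s: "smooth_near \<phi> 0" by auto
  have "vanishes T l (\<lambda>p. cvector_apply (X p) (\<lambda>q. f q * \<phi> q) p)" if "X \<in> T" for X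
    using Suc.IH[OF Suc.prems(1) vanishes_apply[OF Suc.prems(2) that]]
      Suc.IH[OF smooth_near_cvector_apply[OF smooth[OF that] Suc.prems(1)] vanishes_Suc_D[OF Suc.prems(2)]]
    by (rule vanishes_apply_mult[OF Suc.prems(1) s])
  then show ?case using Suc.prems s by (simp add: smooth_near_mult)
qed

text \<open>Both terms of \<open>X (f \<phi>) = f X \<phi> + (X f) \<phi>\<close> vanish to order \<open>l\<close>: in the first one \<open>f\<close> makes up for the order
  lost by differentiating \<open>\<phi>\<close>.\<close>

lemma vanishes_mult_gain:
  assumes "smooth_near f 0" "f 0 = 0" "vanishes T l \<phi>"
  shows "vanishes T (Suc l) (\<lambda>p. f p * \<phi> p)"
  using assms(3)
proof (induction l arbitrary: \<phi>)
  case 0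
  then show ?case using assms(1,2) by (simp add: smooth_near_mult smooth_near_cvector_apply smooth)
next
  case (Suc l)
  then have s: "smooth_near \<phi> 0" by auto
  have "vanishes T (Suc l) (\<lambda>p. cvector_apply (X p) (\<lambda>q. f q * \<phi> q) p)" if "X \<in> T" for X
    using Suc.IH[OF vanishes_apply[OF Suc.prems that]]
      vanishes_mult[OF smooth_near_cvector_apply[OF smooth[OF that] assms(1)] Suc.prems]
    by (rule vanishes_apply_mult[OF assms(1) s])
  then show ?case using s assms(1,2) vanishes.simps(2)[of T "Suc l"] by (simp add: smooth_near_mult)
qed

lemma vanishes_zero: "vanishes T l (\<lambda>_. 0)"
  by (induction l) (simp_all add: smooth_near_const)

lemma vanishes_sum:
  "(\<And>i. i \<in> I \<Longrightarrow> vanishes T l (\<phi> i)) \<Longrightarrow> vanishes T l (\<lambda>p. \<Sum>i\<in>I. \<phi> i p)"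
  by (induction I rule: infinite_finite_induct) (auto intro: vanishes_zero vanishes_add)

lemma vanishes_diff:
  assumes "vanishes T l \<phi>" "vanishes T l \<psi>"
  shows "vanishes T l (\<lambda>p. \<phi> p - \<psi> p)"
  using vanishes_add[OF assms(1) vanishes_mult[OF smooth_near_const[of "-1"] assms(2)]] by simp

text \<open>Only the value at \<open>0\<close> of a field matters to leading order. In \<open>Y X \<phi> = X Y \<phi> + [Y, X] \<phi>\<close> the bracket lies in
  \<open>T\<close> again, and \<open>X\<close> can be moved to the front, where it is evaluated at \<open>0\<close>.\<close>

lemma vanishes_field_vanishing_at_0:
  assumes "X \<in> T" "X 0 = 0" "vanishes T l \<phi>"
  shows "vanishes T l (\<lambda>p. cvector_apply (X p) \<phi> p)"
  using assms(3)
proof (induction l arbitrary: \<phi>)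
  case 0
  then show ?case by (simp add: smooth_near_cvector_apply smooth assms(1))
next
  case (Suc l)
  then have s: "smooth_near \<phi> 0" by auto
  have "vanishes T l (\<lambda>p. cvector_apply (Y p) (\<lambda>q. cvector_apply (X q) \<phi> q) p)" if Y: "Y \<in> T" for Y
  proof (rule vanishes_cong)
    show "vanishes T l (\<lambda>p. cvector_apply (X p) (\<lambda>q. cvector_apply (Y q) \<phi> q) p + cvector_apply (lie_bracket Y X p) \<phi> p)"
      using Suc.IH[OF vanishes_apply[OF Suc.prems Y]] vanishes_apply[OF Suc.prems bracket[OF Y assms(1)]]
      by (rule vanishes_add)
    show "\<forall>\<^sub>F p in nhds 0. cvector_apply (X p) (\<lambda>q. cvector_apply (Y q) \<phi> q) p + cvector_apply (lie_bracket Y X p) \<phi> p =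
        cvector_apply (Y p) (\<lambda>q. cvector_apply (X q) \<phi> q) p"
      using smooth_near_nhds[OF smooth[OF Y]] smooth_near_nhds[OF smooth[OF assms(1)]] smooth_near_nhds[OF s]
      by eventually_elim (simp add: cvector_apply_lie_bracket)
  qed
  then show ?case using s assms(1,2) by (simp add: smooth_near_cvector_apply smooth)
qed

lemma vanishes_cnj:
  assumes T: "\<And>X. X \<in> T \<Longrightarrow> (\<lambda>p. cvector_cnj (X p)) \<in> T" and "vanishes T l \<phi>"
  shows "vanishes T l (\<lambda>p. cnj (\<phi> p))"
  using assms(2)
proof (induction l arbitrary: \<phi>)
  case 0
  then show ?case by (simp add: smooth_near_cnj)
next
  case (Suc l)
  then have s: "smooth_near \<phi> 0" by auto
  have "vanishes T l (\<lambda>p. cvector_apply (X p) (\<lambda>q. cnj (\<phi> q)) p)" if "X \<in> T" for X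
  proof (rule vanishes_cong)
    show "vanishes T l (\<lambda>p. cnj (cvector_apply (cvector_cnj (X p)) \<phi> p))"
      using Suc.IH[OF vanishes_apply[OF Suc.prems T[OF that]]] .
    show "\<forall>\<^sub>F p in nhds 0. cnj (cvector_apply (cvector_cnj (X p)) \<phi> p) = cvector_apply (X p) (\<lambda>q. cnj (\<phi> q)) p"
      using smooth_near_differentiable[OF s] by eventually_elim (simp add: cvector_apply_cnj)
  qed
  then show ?case using Suc.prems s by (simp add: smooth_near_cnj)
qed

end

section \<open>Independent linear forms\<close>

lemma sum_of_bool_mult:
  fixes f :: "nat \<Rightarrow> complex"
  assumes "i < d" shows "(\<Sum>j<d. f j * of_bool (i = j)) = f i"
proof -
  have "(\<Sum>j<d. f j * of_bool (i = j)) = (\<Sum>j<d. if i = j then f j else 0)"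
    by (intro sum.cong) auto
  then show ?thesis using assms by (simp add: sum.delta)
qed

text \<open>One step of Gaussian elimination: the part of \<open>\<phi> d\<close> not explained by its values on the dual vectors found
  so far is either zero, or yields a new dual vector by which the old ones are corrected.\<close>

lemma dual_vectors_or_dependent:
  fixes \<phi> :: "nat \<Rightarrow> complex^'n \<Rightarrow> complex"
  assumes "\<And>i. i < d \<Longrightarrow> Vector_Spaces.linear (*s) (*) (\<phi> i)"
  shows "(\<exists>w. \<forall>i<d. \<forall>j<d. \<phi> i (w j) = of_bool (i = j)) \<or>
         (\<exists>e<d. \<exists>c. \<forall>v. \<phi> e v = (\<Sum>j<e. c j * \<phi> j v))"
  using assms
proof (induction d)
  case 0
  then show ?case by simp
next
  case (Suc d)
  consider w where "\<forall>i<d. \<forall>j<d. \<phi> i (w j) = of_bool (i = j)" |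
      "\<exists>e<d. \<exists>c. \<forall>v. \<phi> e v = (\<Sum>j<e. c j * \<phi> j v)"
    using Suc.IH[OF Suc.prems[OF less_SucI]] by metis
  then show ?case
  proof cases
    case w: 1
    have lin: "\<phi> i (u + v) = \<phi> i u + \<phi> i v" "\<phi> i (u - v) = \<phi> i u - \<phi> i v" "\<phi> i (c *s v) = c * \<phi> i v"
      "\<phi> i (sum f I) = (\<Sum>x\<in>I. \<phi> i (f x))"
      if "i < Suc d" for i u v c and f :: "nat \<Rightarrow> complex^'n" and I
    proof -
      interpret Vector_Spaces.linear "(*s)" "(*)" "\<phi> i" using Suc.prems[OF that] .
      show "\<phi> i (u + v) = \<phi> i u + \<phi> i v" "\<phi> i (u - v) = \<phi> i u - \<phi> i v" "\<phi> i (c *s v) = c * \<phi> i v"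
        "\<phi> i (sum f I) = (\<Sum>x\<in>I. \<phi> i (f x))" by (fact add diff scale sum)+
    qed
    show ?thesis
    proof (cases "\<forall>v. \<phi> d v = (\<Sum>j<d. \<phi> d (w j) * \<phi> j v)")
      case True
      then show ?thesis by (intro disjI2 exI[of _ d] conjI exI[of _ "\<lambda>j. \<phi> d (w j)"] lessI)
    next
      case False
      then obtain v where v: "\<phi> d v \<noteq> (\<Sum>j<d. \<phi> d (w j) * \<phi> j v)" by blast
      define u where "u = v - (\<Sum>j<d. \<phi> j v *s w j)"
      have u0: "\<phi> i u = 0" if "i < d" for i
      proof -
        have "\<phi> i u = \<phi> i v - (\<Sum>j<d. \<phi> j v * \<phi> i (w j))"
          using that by (simp add: u_def lin)
        also have "(\<Sum>j<d. \<phi> j v * \<phi> i (w j)) = (\<Sum>j<d. \<phi> j v * of_bool (i = j))"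
          using w that by (intro sum.cong) auto
        finally show ?thesis using sum_of_bool_mult[OF that] by simp
      qed
      have ud: "\<phi> d u \<noteq> 0" using v by (simp add: u_def lin mult.commute)
      define u' where "u' = (1 / \<phi> d u) *s u"
      define w' where "w' j = (if j = d then u' else w j - \<phi> d (w j) *s u')" for j
      have "\<phi> i (w' j) = of_bool (i = j)" if "i < Suc d" "j < Suc d" for i j
      proof -
        have u': "\<phi> i u' = of_bool (i = d)"
          using that u0 ud by (auto simp: u'_def lin less_Suc_eq)
        show ?thesis
        proof (cases "j = d")
          case True
          then show ?thesis using u' by (simp add: w'_def)
        next
          case False
          then have "\<phi> i (w' j) = \<phi> i (w j) - \<phi> d (w j) * \<phi> i u'" using that by (simp add: w'_def lin)
          then show ?thesis using u' w that False by (cases "i = d") (auto simp: less_Suc_eq)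
        qed
      qed
      then show ?thesis by (intro disjI1 exI[of _ w']) simp
    qed
  next
    case 2
    then obtain e c where "e < d" "\<forall>v. \<phi> e v = (\<Sum>j<e. c j * \<phi> j v)" by blast
    then show ?thesis by (intro disjI2 exI[of _ e] conjI exI[of _ c] less_SucI)
  qed
qed

text \<open>Expanding \<open>\<phi> e\<close> leaves wedges in which some form occurs twice; in these, composition with the
  transposition of the two places changes the sign of every summand.\<close>

lemma wedge_eq_0_if_dependent:
  assumes e: "e < d" and dep: "\<And>v. \<phi> e v = (\<Sum>j<e. c j * \<phi> j v)"
  shows "wedge d \<phi> = (\<lambda>_. 0)"
proof
  fix v
  let ?P = "{\<pi>. \<pi> permutes {..<d}}"
  define F where "F j \<pi> = of_int (sign \<pi>) * (\<phi> j (v (\<pi> e)) * (\<Prod>i\<in>{..<d} - {e}. \<phi> i (v (\<pi> i))))" for j \<pi>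
  have "sum (F j) ?P = 0" if "j < e" for j
  proof -
    let ?\<tau> = "Transposition.transpose e j"
    have \<tau>: "?\<tau> permutes {..<d}" using that e by (intro permutes_swap_id) auto
    have "F j (\<pi> \<circ> ?\<tau>) = - F j \<pi>" if "\<pi> \<in> ?P" for \<pi>
    proof -
      have s: "sign (\<pi> \<circ> ?\<tau>) = - sign \<pi>"
        using that \<open>j < e\<close> \<tau> by (subst sign_compose) (auto simp: sign_swap_id intro: permutes_imp_permutation)
      define R where "R \<sigma> = (\<Prod>i\<in>{..<d} - {e} - {j}. \<phi> i (v (\<sigma> i)))" for \<sigma>
      have F: "F j \<sigma> = of_int (sign \<sigma>) * (\<phi> j (v (\<sigma> e)) * (\<phi> j (v (\<sigma> j)) * R \<sigma>))" for \<sigma>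
      proof -
        have "(\<Prod>i\<in>{..<d} - {e}. \<phi> i (v (\<sigma> i))) = \<phi> j (v (\<sigma> j)) * R \<sigma>"
          unfolding R_def using \<open>j < e\<close> e by (intro prod.remove) auto
        then show ?thesis by (simp only: F_def)
      qed
      have "R (\<pi> \<circ> ?\<tau>) = R \<pi>"
        unfolding R_def by (intro prod.cong) (auto simp: transpose_apply_other)
      moreover have "(\<pi> \<circ> ?\<tau>) e = \<pi> j" "(\<pi> \<circ> ?\<tau>) j = \<pi> e" by simp_all
      ultimately show ?thesis unfolding F s by (simp only:) (simp add: mult.left_commute)
    qed
    then have "sum (\<lambda>\<pi>. F j (\<pi> \<circ> ?\<tau>)) ?P = sum (\<lambda>\<pi>. - F j \<pi>) ?P" by (rule sum.cong[OF refl])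
    then have "sum (\<lambda>\<pi>. F j (\<pi> \<circ> ?\<tau>)) ?P = - sum (F j) ?P" unfolding sum_negf .
    then have "sum (F j) ?P = - sum (F j) ?P" using sum_permutations_compose_right[OF \<tau>, of "F j"] by simp
    then show ?thesis by simp
  qed
  moreover have "wedge d \<phi> v = (\<Sum>\<pi>\<in>?P. \<Sum>j<e. c j * F j \<pi>)"
    unfolding wedge_def F_def
  proof (intro sum.cong refl)
    fix \<pi>
    have "(\<Prod>i<d. \<phi> i (v (\<pi> i))) = \<phi> e (v (\<pi> e)) * (\<Prod>i\<in>{..<d} - {e}. \<phi> i (v (\<pi> i)))"
      using e by (intro prod.remove) auto
    then show "of_int (sign \<pi>) * (\<Prod>i<d. \<phi> i (v (\<pi> i))) =
       (\<Sum>j<e. c j * (of_int (sign \<pi>) * (\<phi> j (v (\<pi> e)) * (\<Prod>i\<in>{..<d} - {e}. \<phi> i (v (\<pi> i))))))"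
      unfolding dep by (simp add: sum_distrib_left sum_distrib_right mult.assoc mult.left_commute)
  qed
  ultimately show "wedge d \<phi> v = 0"
    using sum.swap[of "\<lambda>\<pi> j. c j * F j \<pi>" "{..<e}" ?P] by (simp add: sum_distrib_left[symmetric])
qed

lemma wedge_nonzero_dual_vectors:
  fixes \<phi> :: "nat \<Rightarrow> complex^'n \<Rightarrow> complex"
  assumes "\<And>i. i < d \<Longrightarrow> Vector_Spaces.linear (*s) (*) (\<phi> i)" "wedge d \<phi> \<noteq> (\<lambda>_. 0)"
  obtains w where "\<And>i j. i < d \<Longrightarrow> j < d \<Longrightarrow> \<phi> i (w j) = of_bool (i = j)"
proof -
  have "\<not> (\<exists>e<d. \<exists>c. \<forall>v. \<phi> e v = (\<Sum>j<e. c j * \<phi> j v))"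
  proof
    assume "\<exists>e<d. \<exists>c. \<forall>v. \<phi> e v = (\<Sum>j<e. c j * \<phi> j v)"
    then obtain e c where e: "e < d" "\<And>v. \<phi> e v = (\<Sum>j<e. c j * \<phi> j v)" by blast
    show False using wedge_eq_0_if_dependent[OF e] assms(2) by contradiction
  qed
  moreover have "(\<exists>w. \<forall>i<d. \<forall>j<d. \<phi> i (w j) = of_bool (i = j)) \<or>
         (\<exists>e<d. \<exists>c. \<forall>v. \<phi> e v = (\<Sum>j<e. c j * \<phi> j v))"
    by (rule dual_vectors_or_dependent) (rule assms(1))
  ultimately obtain w where "\<forall>i<d. \<forall>j<d. \<phi> i (w j) = of_bool (i = j)" by blast
  then show thesis by (intro that[of w]) simp
qed

section \<open>Curves in level sets\<close>

lemma smooth_on_blinfun_derivative: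
  fixes f :: "'a::euclidean_space \<Rightarrow> 'b::real_normed_vector"
  assumes "smooth_on f S"
  shows "\<And>x. x \<in> S \<Longrightarrow> (f has_derivative blinfun_apply (Blinfun (fd f (at x)))) (at x)"
    "continuous_on S (\<lambda>x. Blinfun (fd f (at x)))"
proof -
  have d: "(f has_derivative fd f (at x)) (at x)" if "x \<in> S" for x
    using smooth_on_differentiable[OF assms that] frechet_derivative_works by blast
  have e: "blinfun_apply (Blinfun (fd f (at x))) = fd f (at x)" if "x \<in> S" for x
    by (rule bounded_linear_Blinfun_apply[OF has_derivative_bounded_linear[OF d[OF that]]])
  show "(f has_derivative blinfun_apply (Blinfun (fd f (at x)))) (at x)" if "x \<in> S" for x
    unfolding e[OF that] by (rule d[OF that])
  show "continuous_on S (\<lambda>x. Blinfun (fd f (at x)))"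
  proof (rule continuous_on_blinfun_componentwise)
    fix i
    have "continuous_on S (\<lambda>x. fd f (at x) i)"
      by (rule smooth_on_continuous[OF smooth_on_fd[OF assms]])
    then show "continuous_on S (\<lambda>x. blinfun_apply (Blinfun (fd f (at x))) i)"
      by (rule continuous_on_cong[THEN iffD1, rotated -1]) (simp_all add: e)
  qed
qed

text \<open>The curve is the image of the line \<open>t v\<close> under the local inverse of a map \<open>\<Phi>\<close> whose components transversal to
  the level set are the functions \<open>r i\<close> themselves. The number \<open>d\<close> of functions is a variable, hence \<open>\<Phi>\<close> is built on
  the whole space from vectors \<open>w\<close> dual to the differentials.\<close>

lemma level_set_curve:
  fixes r :: "nat \<Rightarrow> 'a::euclidean_space \<Rightarrow> real"
  assumes r: "\<And>i. i < d \<Longrightarrow> smooth_near (r i) p" "\<And>i. i < d \<Longrightarrow> r i p = 0"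
    and w: "\<And>i j. i < d \<Longrightarrow> j < d \<Longrightarrow> fd (r i) (at p) (w j) = of_bool (i = j)"
    and v: "\<And>i. i < d \<Longrightarrow> fd (r i) (at p) v = 0"
  obtains c :: "real \<Rightarrow> 'a" where "c 0 = p" "(c has_derivative (\<lambda>t. t *\<^sub>R v)) (at 0)"
    "\<forall>\<^sub>F t in nhds 0. \<forall>i<d. r i (c t) = 0"
proof -
  define L where "L i = fd (r i) (at p)" for i
  have DL: "(r i has_derivative L i) (at p)" if "i < d" for i
    using smooth_near_has_derivative[OF r(1)[OF that]] by (simp add: L_def)
  then have bl: "bounded_linear (L i)" if "i < d" for i using that has_derivative_bounded_linear by blast
  then have linL: "linear (L i)" if "i < d" for i using that bounded_linear.linear by blast
  have L: "L i (w j) = of_bool (i = j)" "L i v = 0" if "i < d" "j < d" for i j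
    using w[OF that] v that by (auto simp: L_def)
  \<comment> \<open>In the coordinates \<open>\<Phi>\<close> the level set is the kernel of the differentials.\<close>
  define \<Phi> where "\<Phi> x = (x + (- p)) + (\<Sum>j<d. (r j x + (- L j (x + (- p)))) *\<^sub>R w j)" for x
  have id: "smooth_near (\<lambda>x::'a. x) p"
    unfolding smooth_near_iff smooth_on_def using Ck_on_ident[of UNIV] by blast
  have "smooth_near \<Phi> p"
    unfolding \<Phi>_def
    by (intro smooth_near_add id smooth_near_const smooth_near_sum smooth_near_bilinear[OF bounded_bilinear_scaleR]
        r(1) smooth_near_linear[OF bounded_linear_minus] smooth_near_linear[OF bl]) auto
  then obtain S where S: "open S" "p \<in> S" "smooth_on \<Phi> S" unfolding smooth_near_iff by blast
  have "(\<Phi> has_derivative (\<lambda>u. (u + 0) + (\<Sum>j<d. (L j u + - L j (u + 0)) *\<^sub>R w j))) (at p)"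
    unfolding \<Phi>_def
    by (intro has_derivative_add has_derivative_sum has_derivative_scaleR_left has_derivative_minus
        has_derivative_ident has_derivative_const DL bounded_linear.has_derivative[OF bl]) auto
  then have D\<Phi>: "fd \<Phi> (at p) = (\<lambda>u. u)" by (intro fd_eqI) simp
  have "id_blinfun o\<^sub>L Blinfun (fd \<Phi> (at p)) = id_blinfun"
    by (rule blinfun_eqI) (simp add: D\<Phi> bounded_linear_Blinfun_apply bounded_linear_ident)
  from inverse_function_theorem[OF S(1) smooth_on_blinfun_derivative[OF S(3)] S(2) this]
  obtain U' V g g' where U: "open U'" "U' \<subseteq> S" "p \<in> U'" "open V" "\<Phi> p \<in> V" and hom: "homeomorphism U' V \<Phi> g"
    and g: "\<And>y. y \<in> V \<Longrightarrow> (g has_derivative g' y) (at y)"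
      "\<And>y. y \<in> V \<Longrightarrow> g' y = inv (blinfun_apply (Blinfun (fd \<Phi> (at (g y)))))" by metis
  have \<Phi>p: "\<Phi> p = 0" using r(2) linear_0[OF linL] by (simp add: \<Phi>_def)
  have gp: "g 0 = p" using hom U(3) \<Phi>p unfolding homeomorphism_def by metis
  have "g' 0 = inv (\<lambda>u. u)"
    using g(2)[OF U(5)] by (simp add: \<Phi>p gp D\<Phi> bounded_linear_Blinfun_apply bounded_linear_ident)
  then have Dg: "(g has_derivative (\<lambda>u. u)) (at 0)"
    using g(1)[OF U(5)] \<Phi>p by (simp add: inv_id[unfolded id_def])
  define c where "c t = g (t *\<^sub>R v)" for t
  have rc: "L i (\<Phi> x) = r i x" if "i < d" for i x
  proof -
    note l = linL[OF that]
    have "L i (\<Phi> x) = L i (x - p) + (\<Sum>j<d. (r j x - L j (x - p)) * L i (w j))"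
      using that by (simp add: \<Phi>_def linear_add[OF l] linear_sum[OF l] linear_scale[OF l])
    also have "(\<Sum>j<d. (r j x - L j (x - p)) * L i (w j)) = (\<Sum>j<d. if i = j then r j x - L j (x - p) else 0)"
      using L(1) that by (intro sum.cong) auto
    finally show ?thesis using that by simp
  qed
  show thesis
  proof (rule that[of c])
    show "c 0 = p" by (simp add: c_def gp)
    have "((\<lambda>t. t *\<^sub>R v) has_derivative (\<lambda>t. t *\<^sub>R v)) (at 0)" by (auto intro!: derivative_eq_intros)
    moreover have "(g has_derivative (\<lambda>u. u)) (at (0 *\<^sub>R v))" using Dg by simp
    ultimately show "(c has_derivative (\<lambda>t. t *\<^sub>R v)) (at 0)"
      unfolding c_def by (rule has_derivative_compose)
    have "open ((\<lambda>t. t *\<^sub>R v) -` V)" by (intro open_vimage U continuous_intros)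
    moreover have "\<forall>i<d. r i (c t) = 0" if "t *\<^sub>R v \<in> V" for t
    proof -
      have "\<Phi> (c t) = t *\<^sub>R v" using hom that unfolding c_def homeomorphism_def by blast
      then show ?thesis using rc[of _ "c t"] L(2) linear_scale[OF linL] by (metis scaleR_zero_right)
    qed
    ultimately show "\<forall>\<^sub>F t in nhds 0. \<forall>i<d. r i (c t) = 0"
      unfolding eventually_nhds using U(5) \<Phi>p
      by (intro exI[of _ "(\<lambda>t. t *\<^sub>R v) -` V"]) auto
  qed
qed

lemma fd_eq_0_if_vanishes_on_level_set:
  fixes r :: "nat \<Rightarrow> 'a::euclidean_space \<Rightarrow> real" and \<phi> :: "'a \<Rightarrow> 'b::real_normed_vector"
  assumes r: "\<And>i. i < d \<Longrightarrow> smooth_near (r i) p" "\<And>i. i < d \<Longrightarrow> r i p = 0"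
    and w: "\<And>i j. i < d \<Longrightarrow> j < d \<Longrightarrow> fd (r i) (at p) (w j) = of_bool (i = j)"
    and v: "\<And>i. i < d \<Longrightarrow> fd (r i) (at p) v = 0"
    and \<phi>: "\<phi> differentiable (at p)" "\<forall>\<^sub>F q in nhds p. (\<forall>i<d. r i q = 0) \<longrightarrow> \<phi> q = 0"
  shows "fd \<phi> (at p) v = 0"
proof -
  from level_set_curve[OF r w v] obtain c where c: "c 0 = p" "(c has_derivative (\<lambda>t. t *\<^sub>R v)) (at 0)"
    "\<forall>\<^sub>F t in nhds 0. \<forall>i<d. r i (c t) = 0" by blast
  have "isCont c 0" using has_derivative_continuous[OF c(2)] .
  then have "filterlim c (nhds p) (nhds 0)"
    using c(1) by (metis continuous_at_imp_continuous_within isCont_def tendsto_at_iff_tendsto_nhds)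
  from eventually_compose_filterlim[OF \<phi>(2) this] c(3)
  have e: "\<forall>\<^sub>F t in nhds 0. 0 = \<phi> (c t)" by eventually_elim auto
  have "(\<phi> has_derivative fd \<phi> (at p)) (at (c 0))" using \<phi>(1) c(1) frechet_derivative_works by auto
  from has_derivative_compose[OF c(2) this]
  have "((\<lambda>t. \<phi> (c t)) has_derivative (\<lambda>t. fd \<phi> (at p) (t *\<^sub>R v))) (at 0)" .
  then have "fd (\<lambda>t. \<phi> (c t)) (at 0) = (\<lambda>t. fd \<phi> (at p) (t *\<^sub>R v))" by (rule fd_eqI)
  moreover have "fd (\<lambda>t. \<phi> (c t)) (at 0) = (\<lambda>t. 0)"
    using fd_cong_eventually[OF e] fd_eqI[OF has_derivative_const] by metis
  ultimately show ?thesis by (metis scaleR_one)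
qed

section \<open>Vector fields tangent to a generic submanifold\<close>

lemma smooth_near_ident: "smooth_near (\<lambda>x. x) a"
  unfolding smooth_near_def using Ck_on_ident[OF open_UNIV] by blast

lemma complex_linear_form_iff:
  "Vector_Spaces.linear (*s) (*) A \<longleftrightarrow>
     (\<forall>u v. A (u + v) = A u + A v) \<and> (\<forall>c v. A (c *s v) = (c::complex) * A v)"
proof
  assume "Vector_Spaces.linear (*s) (*) A"
  then interpret Vector_Spaces.linear "(*s)" "(*)" A .
  show "(\<forall>u v. A (u + v) = A u + A v) \<and> (\<forall>c v. A (c *s v) = c * A v)" using add scale by blast
next
  assume "(\<forall>u v. A (u + v) = A u + A v) \<and> (\<forall>c v. A (c *s v) = c * A v)"
  then show "Vector_Spaces.linear (*s) (*) A"
    by (unfold_locales) (auto simp: algebra_simps vector_add_ldistrib vector_sadd_rdistrib)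
qed

text \<open>The complex structure of \<open>\<complex>\<^sup>n \<times> \<complex>\<^sup>n\<close>, for which \<open>hol_on\<close> is the joint holomorphy of \<open>holomorphic2_near\<close>.\<close>

definition \<i>_pair :: "(complex^'n) \<times> (complex^'n) \<Rightarrow> (complex^'n) \<times> (complex^'n)" where
  "\<i>_pair w = (\<i> *s fst w, \<i> *s snd w)"

lemma holomorphic2_near_local:
  assumes "holomorphic2_near r a"
  obtains S where "open S" "a \<in> S" "hol_on \<i>_pair (\<lambda>w. r (fst w) (snd w)) S"
    "\<And>w. w \<in> S \<Longrightarrow> \<exists>A B. Vector_Spaces.linear (*s) (*) A \<and> Vector_Spaces.linear (*s) (*) B \<and>
        ((\<lambda>w. r (fst w) (snd w)) has_derivative (\<lambda>u. A (fst u) + B (snd u))) (at w)"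
proof -
  obtain S where S: "open S" "a \<in> S" and
    D: "\<And>w. w \<in> S \<Longrightarrow> \<exists>A B. Vector_Spaces.linear (*s) (*) A \<and> Vector_Spaces.linear (*s) (*) B \<and>
        ((\<lambda>w. r (fst w) (snd w)) has_derivative (\<lambda>u. A (fst u) + B (snd u))) (at w)"
    using assms unfolding holomorphic2_near_def eventually_nhds case_prod_unfold by blast
  have "hol_on \<i>_pair (\<lambda>w. r (fst w) (snd w)) S"
    unfolding hol_on_def
  proof
    fix w assume "w \<in> S"
    from D[OF this] obtain A B where AB: "Vector_Spaces.linear (*s) (*) A" "Vector_Spaces.linear (*s) (*) B"
      "((\<lambda>w. r (fst w) (snd w)) has_derivative (\<lambda>u. A (fst u) + B (snd u))) (at w)" by blast
    show "(\<lambda>w. r (fst w) (snd w)) differentiable (at w) \<and>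
      (\<forall>v. fd (\<lambda>w. r (fst w) (snd w)) (at w) (\<i>_pair v) = \<i> * fd (\<lambda>w. r (fst w) (snd w)) (at w) v)"
      using AB(1,2) differentiableI[OF AB(3)] unfolding fd_eqI[OF AB(3)] complex_linear_form_iff
      by (simp add: \<i>_pair_def algebra_simps)
  qed
  then show thesis using that S D by blast
qed

lemma filterlim_nhds_vcnj_pair: "filterlim (\<lambda>Z. (Z, vcnj Z)) (nhds (0, 0)) (nhds (0 :: complex^'n))"
proof -
  have "continuous_on UNIV (\<lambda>Z :: complex^'n. (Z, vcnj Z))"
    using linear_continuous_on[OF bounded_linear_vcnj] by (intro continuous_on_Pair continuous_on_id)
  then have "isCont (\<lambda>Z :: complex^'n. (Z, vcnj Z)) 0" by (simp add: continuous_on_eq_continuous_at)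
  then have "((\<lambda>Z :: complex^'n. (Z, vcnj Z)) \<longlongrightarrow> (0, vcnj 0)) (nhds 0)"
    unfolding isCont_def by (subst (asm) tendsto_at_iff_tendsto_nhds)
  then show ?thesis by simp
qed

locale generic_manifold =
  fixes d :: nat and \<rho> :: "nat \<Rightarrow> complex^'n \<Rightarrow> complex^'n \<Rightarrow> complex" and M :: "(complex^('n::finite)) set"
  assumes generic: "generic_submanifold d \<rho> M"
begin

text \<open>The equations of \<open>M\<close> on the diagonal \<open>\<zeta> = \<bar>Z\<close>, and the \<open>(1, 0)\<close> parts of their differentials.\<close>

definition r :: "nat \<Rightarrow> complex^'n \<Rightarrow> complex" where "r i Z = \<rho> i Z (vcnj Z)"

definition A :: "nat \<Rightarrow> complex^'n \<Rightarrow> complex^'n \<Rightarrow> complex" where "A i p = dZ (\<rho> i) p (vcnj p)"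

text \<open>The consequences of genericity at a single point. The form \<open>B\<close> is the \<open>(0, 1)\<close> part of the differential; that
  it is conjugate to \<open>A\<close> needs \<open>r i\<close> to be real on a neighbourhood of \<open>p\<close>, and is derived from \<open>good\<close> near \<open>p\<close>.\<close>

definition good :: "complex^'n \<Rightarrow> bool" where
  "good p \<longleftrightarrow> (\<forall>i<d. smooth_near (r i) p \<and> cnj (r i p) = r i p \<and>
      Vector_Spaces.linear (*s) (*) (A i p) \<and>
      (\<exists>B. Vector_Spaces.linear (*s) (*) B \<and> (\<forall>v. fd (r i) (at p) v = A i p v + B (vcnj v)))) \<and>
    (p \<in> M \<longleftrightarrow> (\<forall>i<d. r i p = 0)) \<and> (\<exists>w. \<forall>i<d. \<forall>j<d. A i p (w j) = of_bool (i = j))"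

lemma goodD:
  assumes "good p" "i < d"
  shows "smooth_near (r i) p" "cnj (r i p) = r i p" "Vector_Spaces.linear (*s) (*) (A i p)"
    "\<exists>B. Vector_Spaces.linear (*s) (*) B \<and> (\<forall>v. fd (r i) (at p) v = A i p v + B (vcnj v))"
    "A i p (u + v) = A i p u + A i p v" "A i p (c *s v) = c * A i p v"
proof -
  note a = assms(1)[unfolded good_def, THEN conjunct1, rule_format, OF assms(2)]
  show "smooth_near (r i) p" "cnj (r i p) = r i p" and l: "Vector_Spaces.linear (*s) (*) (A i p)"
    and "\<exists>B. Vector_Spaces.linear (*s) (*) B \<and> (\<forall>v. fd (r i) (at p) v = A i p v + B (vcnj v))"
    using a by simp_all
  show "A i p (u + v) = A i p u + A i p v" "A i p (c *s v) = c * A i p v"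
    using l[unfolded complex_linear_form_iff] by simp_all
qed

lemma good_in_M_iff: "good p \<Longrightarrow> p \<in> M \<longleftrightarrow> (\<forall>i<d. r i p = 0)"
  unfolding good_def by simp

lemma good_dual_vectors: "good p \<Longrightarrow> \<exists>w. \<forall>i<d. \<forall>j<d. A i p (w j) = of_bool (i = j)"
  unfolding good_def by simp

lemma eventually_good: "\<forall>\<^sub>F p in nhds 0. good p"
proof -
  have 1: "\<forall>\<^sub>F p in nhds 0. smooth_near (r i) p \<and>  Vector_Spaces.linear (*s) (*) (A i p) \<and>
      (\<exists>B. Vector_Spaces.linear (*s) (*) B \<and> (\<forall>v. fd (r i) (at p) v = A i p v + B (vcnj v)))" if "i < d" for i
  proof -
    let ?f = "\<lambda>w. \<rho> i (fst w) (snd w)"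
    have "holomorphic2_near (\<rho> i) (0, 0)" using generic that unfolding generic_submanifold_def by blast
    from holomorphic2_near_local[OF this] obtain S where S: "open S" "(0, 0) \<in> S" "hol_on \<i>_pair ?f S"
      and D: "\<And>w. w \<in> S \<Longrightarrow> \<exists>A B. Vector_Spaces.linear (*s) (*) A \<and> Vector_Spaces.linear (*s) (*) B \<and>
        (?f has_derivative (\<lambda>u. A (fst u) + B (snd u))) (at w)" by blast
    have "\<forall>\<^sub>F w in nhds (0, 0). w \<in> S" using S eventually_nhds by blast
    from eventually_compose_filterlim[OF this filterlim_nhds_vcnj_pair]
    show ?thesis
    proof eventually_elim
      case (elim p)
      have "smooth_near ?f (p, vcnj p)" using hol_on_smooth[OF S(1,3)] S(1) elim unfolding smooth_near_iff by blast
      moreover have "smooth_near (\<lambda>Z. (Z, vcnj Z)) p"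
        by (intro smooth_near_Pair smooth_near_vcnj smooth_near_ident)
      ultimately have "smooth_near (\<lambda>Z. ?f (Z, vcnj Z)) p" by (rule smooth_near_compose)
      then have s: "smooth_near (r i) p" by (simp add: r_def[abs_def])
      obtain A' B where AB: "Vector_Spaces.linear (*s) (*) A'" "Vector_Spaces.linear (*s) (*) B"
        "(?f has_derivative (\<lambda>u. A' (fst u) + B (snd u))) (at (p, vcnj p))" using D[OF elim] by blast
      have "((\<lambda>Z. (Z, vcnj p)) has_derivative (\<lambda>v. (v, 0))) (at p)"
        by (intro has_derivative_Pair has_derivative_const has_derivative_ident)
      from has_derivative_compose[OF this AB(3)]
      have "((\<lambda>Z. \<rho> i Z (vcnj p)) has_derivative (\<lambda>v. A' v + B 0)) (at p)" by simp
      moreover have "B 0 = 0" using AB(2) unfolding complex_linear_form_iff by (metis vector_smult_lzero mult_zero_left)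
      ultimately have A: "A i p = A'" unfolding A_def dZ_def using fd_eqI by fastforce
      have "((\<lambda>Z. (Z, vcnj Z)) has_derivative (\<lambda>v. (v, vcnj v))) (at p)"
        by (intro has_derivative_Pair has_derivative_ident bounded_linear.has_derivative[OF bounded_linear_vcnj])
      from has_derivative_compose[OF this AB(3)]
      have "(r i has_derivative (\<lambda>v. A' v + B (vcnj v))) (at p)" by (simp add: r_def[abs_def])
      from fd_eqI[OF this] show ?case using s A AB(1,2) by metis
    qed
  qed
  have 2: "\<forall>\<^sub>F p in nhds 0. \<forall>i<d. cnj (r i p) = r i p"
  proof -
    have "\<forall>\<^sub>F w in nhds (0, 0). \<forall>i<d. \<rho> i (fst w) (snd w) = cnj (\<rho> i (vcnj (snd w)) (vcnj (fst w)))"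
      using generic unfolding generic_submanifold_def case_prod_unfold by blast
    from eventually_compose_filterlim[OF this filterlim_nhds_vcnj_pair]
    show ?thesis by eventually_elim (metis complex_cnj_cnj fst_conv r_def snd_conv vcnj_vcnj)
  qed
  have 3: "\<forall>\<^sub>F p in nhds 0. wedge d (\<lambda>i. A i p) \<noteq> (\<lambda>_. 0)"
  proof -
    have "\<forall>\<^sub>F w in nhds (0, 0). wedge d (\<lambda>i. dZ (\<rho> i) (fst w) (snd w)) \<noteq> (\<lambda>_. 0)"
      using generic unfolding generic_submanifold_def case_prod_unfold by blast
    from eventually_compose_filterlim[OF this filterlim_nhds_vcnj_pair]
    show ?thesis by (simp add: A_def[abs_def])
  qed
  have 4: "\<forall>\<^sub>F p in nhds 0. p \<in> M \<longleftrightarrow> (\<forall>i<d. r i p = 0)"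
    using generic unfolding generic_submanifold_def r_def by blast
  have "\<forall>\<^sub>F p in nhds 0. \<forall>i\<in>{..<d}. smooth_near (r i) p \<and> Vector_Spaces.linear (*s) (*) (A i p) \<and>
      (\<exists>B. Vector_Spaces.linear (*s) (*) B \<and> (\<forall>v. fd (r i) (at p) v = A i p v + B (vcnj v)))"
    using 1 by (intro eventually_ball_finite) auto
  with 2 3 4 show ?thesis
  proof eventually_elim
    case (elim p)
    have "\<exists>w. \<forall>i<d. \<forall>j<d. A i p (w j) = of_bool (i = j)"
      using wedge_nonzero_dual_vectors[of d "\<lambda>i. A i p"] elim(2,4) by (metis lessThan_iff)
    then show ?case using elim unfolding good_def by simp
  qed
qed

lemma eventually_eventually_good: "\<forall>\<^sub>F p in nhds 0. \<forall>\<^sub>F q in nhds p. good q"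
  using eventually_good by (simp add: eventually_eventually)

lemma good_at_0: "good 0"
  using eventually_nhds_x_imp_x[OF eventually_good] .

lemma zero_in_M: "0 \<in> M"
  using generic unfolding generic_submanifold_def by blast

text \<open>The differential of the real function \<open>r i\<close> is real at \<open>v\<close> and at \<open>\<i> v\<close>; this forces its \<open>(0, 1)\<close> part to be
  the conjugate of its \<open>(1, 0)\<close> part.\<close>

lemma fd_r:
  assumes "\<forall>\<^sub>F q in nhds p. good q" "i < d"
  shows "fd (r i) (at p) v = A i p v + cnj (A i p v)"
proof -
  have g: "good p" using eventually_nhds_x_imp_x[OF assms(1)] .
  obtain B where B: "Vector_Spaces.linear (*s) (*) B" "\<And>v. fd (r i) (at p) v = A i p v + B (vcnj v)"
    using goodD(4)[OF g assms(2)] by (elim exE conjE) simp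
  note s = goodD(1)[OF g assms(2)]
  have "\<forall>\<^sub>F q in nhds p. cnj (r i q) = r i q"
    using assms(1) by eventually_elim (rule goodD(2)[OF _ assms(2)])
  from fd_cong_eventually[OF this] have "fd (r i) (at p) = fd (\<lambda>q. cnj (r i q)) (at p)" by simp
  also have "\<dots> = (\<lambda>v. cnj (fd (r i) (at p) v))"
    by (intro fd_eqI has_derivative_cnj smooth_near_has_derivative s)
  finally have real: "cnj (fd (r i) (at p) v) = fd (r i) (at p) v" for v by (metis)
  have "fd (r i) (at p) (\<i> *s v) = \<i> * (A i p v - B (vcnj v))"
    using B(1)[unfolded complex_linear_form_iff, THEN conjunct2, rule_format, of "- \<i>" "vcnj v"]
    by (simp only: B(2) vcnj_smult goodD(6)[OF g assms(2)] complex_cnj_i) (simp add: algebra_simps)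
  then have "B (vcnj v) = cnj (A i p v)"
    using real[of v] real[of "\<i> *s v"] by (simp add: B(2) complex_eq_iff)
  then show ?thesis by (simp add: B(2))
qed

lemma cvector_apply_r:
  assumes "\<forall>\<^sub>F q in nhds p. good q" "i < d"
  shows "cvector_apply x (r i) p = A i p (fst x) + cnj (A i p (vcnj (snd x)))"
proof -
  have g: "good p" using eventually_nhds_x_imp_x[OF assms(1)] .
  note A = goodD(5,6)[OF g assms(2)]
  have e: "fst x = real_part x + \<i> *s imag_part x" "vcnj (snd x) = real_part x + (- \<i>) *s imag_part x"
    by (simp_all add: real_part_def imag_part_def vec_eq_iff field_simps)
  have "(r i) differentiable (at p)"
    by (rule smooth_near_differentiable_at[OF goodD(1)[OF g assms(2)]])
  then have "cvector_apply x (r i) p = fd (r i) (at p) (real_part x) + \<i> * fd (r i) (at p) (imag_part x)"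
    by (rule cvector_apply_real_imag)
  then show ?thesis unfolding e fd_r[OF assms] A by (simp add: algebra_simps)
qed

lemma in_complexified_tangent_space_iff:
  "x \<in> complexified_tangent_space d \<rho> p \<longleftrightarrow> (\<forall>i<d. cvector_apply x (r i) p = 0)"
  unfolding complexified_tangent_space_def r_def[abs_def] by simp

text \<open>As the equations \<open>r i\<close> are real, they annihilate the real and the imaginary part of \<open>x\<close> separately, and each of
  the two is the velocity of a curve in \<open>M\<close>.\<close>

lemma tangent_vector_annihilates:
  assumes g: "\<forall>\<^sub>F q in nhds p. good q" and p: "p \<in> M" and x: "x \<in> complexified_tangent_space d \<rho> p"
    and \<phi>: "\<phi> differentiable (at p)" "\<forall>\<^sub>F q in nhds p. q \<in> M \<longrightarrow> \<phi> q = 0"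
  shows "cvector_apply x \<phi> p = 0"
proof -
  have gp: "good p" using eventually_nhds_x_imp_x[OF g] .
  obtain w where w: "\<forall>i<d. \<forall>j<d. A i p (w j) = of_bool (i = j)"
    using good_dual_vectors[OF gp] by (elim exE)
  define R where "R i Z = Re (r i Z)" for i Z
  have sr: "smooth_near (r i) p" if "i < d" for i by (rule goodD(1)[OF gp that])
  have sR: "smooth_near (R i) p" if "i < d" for i
    unfolding R_def by (rule smooth_near_linear[OF bounded_linear_Re sr[OF that]])
  have DR: "fd (R i) (at p) v = 2 * Re (A i p v)" if "i < d" for i v
  proof -
    have "fd (R i) (at p) = (\<lambda>v. Re (fd (r i) (at p) v))"
      unfolding R_def
      by (intro fd_eqI bounded_linear.has_derivative[OF bounded_linear_Re] smooth_near_has_derivative sr that)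
    then show ?thesis by (simp add: fd_r[OF g that])
  qed
  have lin: "A i p (c *s v) = c * A i p v" if "i < d" for i c v
    by (rule goodD(6)[OF gp that])
  have dual: "fd (R i) (at p) ((1/2) *s w j) = of_bool (i = j)" if "i < d" "j < d" for i j
    using that by (simp add: DR lin w)
  have R0: "R i p = 0" if "i < d" for i using good_in_M_iff[OF gp] p that by (simp add: R_def)
  have "\<forall>\<^sub>F q in nhds p. (\<forall>i<d. R i q = 0) \<longrightarrow> \<phi> q = 0"
    using g \<phi>(2)
  proof eventually_elim
    case (elim q)
    show ?case
    proof
      assume "\<forall>i<d. R i q = 0"
      moreover have "cnj (r i q) = r i q" if "i < d" for i by (rule goodD(2)[OF elim(1) that])
      ultimately have "\<forall>i<d. r i q = 0" unfolding R_def by (auto simp: complex_eq_iff)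
      then show "\<phi> q = 0" using good_in_M_iff[OF elim(1)] elim(2) by simp
    qed
  qed
  note key = fd_eq_0_if_vanishes_on_level_set[of d R p "\<lambda>j. (1/2) *s w j", OF sR R0 dual _ \<phi>(1) this]
  have "2 * Re (A i p (real_part x)) = 0 \<and> 2 * Re (A i p (imag_part x)) = 0" if "i < d" for i
  proof -
    have "fd (r i) (at p) (real_part x) + \<i> * fd (r i) (at p) (imag_part x) = 0"
      using x[unfolded in_complexified_tangent_space_iff, rule_format, OF that]
      unfolding cvector_apply_real_imag[OF smooth_near_differentiable_at[OF sr[OF that]]] .
    then show ?thesis by (simp add: fd_r[OF g that] complex_eq_iff)
  qed
  then have "fd \<phi> (at p) (real_part x) = 0" "fd \<phi> (at p) (imag_part x) = 0"
    by (auto intro!: key simp: DR)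
  then show ?thesis using cvector_apply_real_imag[OF \<phi>(1)] by simp
qed

text \<open>The \<open>(0, 1)\<close> part has to solve \<open>d\<close> linear equations, and their left-hand sides are independent forms because
  \<open>M\<close> is generic.\<close>

lemma tangent_vector_with_1_0_part:
  obtains b where "(a, b) \<in> complexified_tangent_space d \<rho> 0"
proof -
  obtain w where w: "\<forall>i<d. \<forall>j<d. A i 0 (w j) = of_bool (i = j)"
    using good_dual_vectors[OF good_at_0] by (elim exE)
  define u where "u = (\<Sum>j<d. (- cnj (A j 0 a)) *s w j)"
  have "A i 0 u = - cnj (A i 0 a)" if "i < d" for i
  proof -
    interpret Vector_Spaces.linear "(*s)" "(*)" "A i 0" by (rule goodD(3)[OF good_at_0 that])
    have "A i 0 u = (\<Sum>j<d. (- cnj (A j 0 a)) * of_bool (i = j))"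
      unfolding u_def sum by (intro sum.cong refl) (use w that in \<open>simp only: scale, simp\<close>)
    also have "\<dots> = - cnj (A i 0 a)" by (rule sum_of_bool_mult[OF that])
    finally show ?thesis .
  qed
  then have "(a, vcnj u) \<in> complexified_tangent_space d \<rho> 0"
    using cvector_apply_r[OF eventually_good] by (simp add: in_complexified_tangent_space_iff)
  then show thesis by (rule that)
qed

definition T :: "'n cfield set" where
  "T = {X. smooth_near X 0 \<and> tangent_field d \<rho> M X}"

lemma T_iff: "X \<in> T \<longleftrightarrow> smooth_near X 0 \<and>
    (\<forall>\<^sub>F p in nhds 0. p \<in> M \<longrightarrow> (\<forall>i<d. cvector_apply (X p) (r i) p = 0))"
  unfolding T_def tangent_field_def in_complexified_tangent_space_iff by simp

lemma T_apply_vanishes_on_M: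
  assumes "X \<in> T" "smooth_near \<phi> 0" "\<forall>\<^sub>F p in nhds 0. p \<in> M \<longrightarrow> \<phi> p = 0"
  shows "\<forall>\<^sub>F p in nhds 0. p \<in> M \<longrightarrow> cvector_apply (X p) \<phi> p = 0"
proof -
  have "\<forall>\<^sub>F p in nhds 0. \<forall>\<^sub>F q in nhds p. q \<in> M \<longrightarrow> \<phi> q = 0" using assms(3) by (simp add: eventually_eventually)
  moreover have "\<forall>\<^sub>F p in nhds 0. p \<in> M \<longrightarrow> X p \<in> complexified_tangent_space d \<rho> p"
    using assms(1) unfolding T_def tangent_field_def by blast
  ultimately show ?thesis
    using eventually_eventually_good smooth_near_differentiable[OF assms(2)]
    by eventually_elim (blast intro: tangent_vector_annihilates)
qed

text \<open>\<open>Y r\<^sub>i\<close> vanishes on \<open>M\<close> and is therefore annihilated by \<open>X\<close> there, and conversely.\<close>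

lemma T_lie_bracket:
  assumes "X \<in> T" "Y \<in> T"
  shows "lie_bracket X Y \<in> T"
proof -
  have s: "smooth_near X 0" "smooth_near Y 0" using assms by (auto simp: T_iff)
  have "\<forall>\<^sub>F p in nhds 0. p \<in> M \<longrightarrow> cvector_apply (lie_bracket X Y p) (r i) p = 0" if "i < d" for i
  proof -
    have sr: "smooth_near (r i) 0" by (rule goodD(1)[OF good_at_0 that])
    have *: "\<forall>\<^sub>F p in nhds 0. p \<in> M \<longrightarrow> cvector_apply (Z p) (\<lambda>q. cvector_apply (W q) (r i) q) p = 0"
      if "Z \<in> T" "W \<in> T" for Z W
    proof (rule T_apply_vanishes_on_M[OF that(1)])
      show "smooth_near (\<lambda>q. cvector_apply (W q) (r i) q) 0"
        using that(2) sr by (simp add: smooth_near_cvector_apply T_iff)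
      show "\<forall>\<^sub>F p in nhds 0. p \<in> M \<longrightarrow> cvector_apply (W p) (r i) p = 0"
        using that(2) \<open>i < d\<close> unfolding T_iff by (auto elim: eventually_mono)
    qed
    show ?thesis
      using *[OF assms] *[OF assms(2,1)] smooth_near_nhds[OF s(1)] smooth_near_nhds[OF s(2)] smooth_near_nhds[OF sr]
      by eventually_elim (simp add: cvector_apply_lie_bracket)
  qed
  then have "\<forall>\<^sub>F p in nhds 0. \<forall>i\<in>{..<d}. p \<in> M \<longrightarrow> cvector_apply (lie_bracket X Y p) (r i) p = 0"
    by (intro eventually_ball_finite) auto
  then show ?thesis
    unfolding T_iff using smooth_near_lie_bracket[OF s] by (auto elim: eventually_mono)
qed

sublocale smooth_fields T
proof
  show "smooth_near X 0" if "X \<in> T" for X using that by (simp add: T_iff)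
qed (rule T_lie_bracket)

lemma T_add:
  assumes "X \<in> T" "Y \<in> T" shows "(\<lambda>p. X p + Y p) \<in> T"
proof -
  have "\<forall>\<^sub>F p in nhds 0. p \<in> M \<longrightarrow> (\<forall>i<d. cvector_apply (X p) (r i) p = 0)"
    "\<forall>\<^sub>F p in nhds 0. p \<in> M \<longrightarrow> (\<forall>i<d. cvector_apply (Y p) (r i) p = 0)" using assms by (auto simp: T_iff)
  then have "\<forall>\<^sub>F p in nhds 0. p \<in> M \<longrightarrow> (\<forall>i<d. cvector_apply (X p + Y p) (r i) p = 0)"
    by eventually_elim (simp add: cvector_apply_add_vector)
  then show ?thesis using assms by (simp add: T_iff smooth_near_add)
qed

lemma T_scale:
  assumes "X \<in> T" shows "(\<lambda>p. (c *s fst (X p), c *s snd (X p))) \<in> T"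
proof -
  have bl: "bounded_linear (\<lambda>v :: complex^'n. c *s v)"
    by (intro linear_conv_bounded_linear[THEN iffD1] linearI)
      (simp_all add: vec_eq_iff algebra_simps)
  have "smooth_near (\<lambda>p. (c *s fst (X p), c *s snd (X p))) 0"
    using assms by (intro smooth_near_Pair smooth_near_linear[OF bl] smooth_near_fst smooth_near_snd) (auto simp: T_iff)
  moreover have "\<forall>\<^sub>F p in nhds 0. p \<in> M \<longrightarrow> (\<forall>i<d. cvector_apply (X p) (r i) p = 0)"
    using assms by (auto simp: T_iff)
  ultimately show ?thesis
    unfolding T_iff by (auto simp: cvector_apply_scale_vector elim: eventually_mono)
qed

lemma T_diff:
  assumes "X \<in> T" "Y \<in> T" shows "(\<lambda>p. X p - Y p) \<in> T"
proof -
  have "((- 1) *s fst y, (- 1) *s snd y) = - y" for y :: "'n cvector"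
    by (simp add: prod_eq_iff vec_eq_iff)
  then show ?thesis using T_add[OF assms(1) T_scale[OF assms(2), of "- 1"]] by simp
qed

lemma T_cnj:
  assumes "X \<in> T" shows "(\<lambda>p. cvector_cnj (X p)) \<in> T"
proof -
  have X: "\<forall>\<^sub>F p in nhds 0. p \<in> M \<longrightarrow> (\<forall>i<d. cvector_apply (X p) (r i) p = 0)" using assms by (auto simp: T_iff)
  have "\<forall>\<^sub>F p in nhds 0. p \<in> M \<longrightarrow> (\<forall>i<d. cvector_apply (cvector_cnj (X p)) (r i) p = 0)"
    using X eventually_eventually_good
  proof eventually_elim
    case (elim p)
    have "cvector_apply (cvector_cnj (X p)) (r i) p = cnj (cvector_apply (X p) (r i) p)" if "i < d" for i
      using cvector_apply_r[OF elim(2) that] by (simp add: cvector_cnj_def)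
    then show ?case using elim(1) by simp
  qed
  moreover have "smooth_near (\<lambda>p. cvector_cnj (X p)) 0"
    using assms unfolding cvector_cnj_def T_iff
    by (intro smooth_near_Pair smooth_near_vcnj smooth_near_fst smooth_near_snd) auto
  ultimately show ?thesis by (simp add: T_iff)
qed

text \<open>Tangent fields preserve the functions that vanish on \<open>M\<close>.\<close>

lemma vanishes_if_zero_on_M:
  assumes "smooth_near \<phi> 0" "\<forall>\<^sub>F p in nhds 0. p \<in> M \<longrightarrow> \<phi> p = 0"
  shows "vanishes T l \<phi>"
  using assms
proof (induction l arbitrary: \<phi>)
  case 0
  then show ?case by simp
next
  case (Suc l)
  have "\<phi> 0 = 0" using eventually_nhds_x_imp_x[OF Suc.prems(2)] zero_in_M by simp
  moreover have "vanishes T l (\<lambda>p. cvector_apply (X p) \<phi> p)" if "X \<in> T" for X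
    using Suc.IH[OF smooth_near_cvector_apply[OF smooth[OF that] Suc.prems(1)] T_apply_vanishes_on_M[OF that Suc.prems]] .
  ultimately show ?case using Suc.prems(1) by simp
qed

lemma cr_lie_algebra_subset_T: "X \<in> cr_lie_algebra d \<rho> M \<Longrightarrow> X \<in> T"
proof (induction rule: cr_lie_algebra.induct)
  case (field_1_0 X)
  then show ?case by (simp add: T_def)
next
  case (field_0_1 X)
  then show ?case by (simp add: T_def)
qed (auto intro: T_add T_scale T_lie_bracket)

end

section \<open>Jets of holomorphic functions\<close>

definition hol_near :: "(complex^'n \<Rightarrow> complex) \<Rightarrow> complex^'n \<Rightarrow> bool" where
  "hol_near f a \<longleftrightarrow> (\<exists>S. open S \<and> a \<in> S \<and> hol_on (\<lambda>v. \<i> *s v) f S)"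

lemma hol_near_smooth: "hol_near f a \<Longrightarrow> smooth_near f a"
  unfolding hol_near_def smooth_near_iff by (elim exE conjE, intro exI conjI hol_on_smooth)

lemma hol_near_fd: "hol_near f a \<Longrightarrow> hol_near (\<lambda>x. fd f (at x) v) a"
  unfolding hol_near_def by (elim exE conjE, intro exI conjI hol_on_fd)

lemma hol_near_complex_linear:
  assumes "hol_near f a"
  shows "\<forall>\<^sub>F x in nhds a. f differentiable (at x) \<and> (\<forall>v. fd f (at x) (\<i> *s v) = \<i> * fd f (at x) v)"
proof -
  obtain S where "open S" "a \<in> S" "hol_on (\<lambda>v. \<i> *s v) f S" using assms unfolding hol_near_def by (elim exE conjE)
  then show ?thesis unfolding eventually_nhds hol_on_def by (intro exI[of _ S]) simp
qed

lemma hol_nearI: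
  assumes "\<forall>\<^sub>F x in nhds a. \<exists>D. (f has_derivative D) (at x) \<and> (\<forall>v. D (\<i> *s v) = \<i> * D v)"
  shows "hol_near f a"
proof -
  obtain S where S: "open S" "a \<in> S" "\<And>x. x \<in> S \<Longrightarrow> \<exists>D. (f has_derivative D) (at x) \<and> (\<forall>v. D (\<i> *s v) = \<i> * D v)"
    using assms unfolding eventually_nhds by blast
  have "f differentiable (at x) \<and> (\<forall>v. fd f (at x) (\<i> *s v) = \<i> * fd f (at x) v)" if x: "x \<in> S" for x
  proof -
    obtain D where D: "(f has_derivative D) (at x)" "\<forall>v. D (\<i> *s v) = \<i> * D v" using S(3)[OF x] by (elim exE conjE)
    then show ?thesis using differentiableI[OF D(1)] unfolding fd_eqI[OF D(1)] by simp
  qed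
  then show ?thesis unfolding hol_near_def hol_on_def using S(1,2) by (intro exI[of _ S]) simp
qed

lemma hol_near_diff:
  assumes "hol_near f a" "hol_near g a" shows "hol_near (\<lambda>x. f x - g x) a"
proof (rule hol_nearI)
  show "\<forall>\<^sub>F x in nhds a. \<exists>D. ((\<lambda>x. f x - g x) has_derivative D) (at x) \<and> (\<forall>v. D (\<i> *s v) = \<i> * D v)"
    using hol_near_complex_linear[OF assms(1)] hol_near_complex_linear[OF assms(2)]
  proof eventually_elim
    case (elim x)
    then have "((\<lambda>x. f x - g x) has_derivative (\<lambda>v. fd f (at x) v - fd g (at x) v)) (at x)"
      by (intro has_derivative_diff) (simp_all add: frechet_derivative_works[symmetric])
    moreover have "fd f (at x) (\<i> *s v) - fd g (at x) (\<i> *s v) = \<i> * (fd f (at x) v - fd g (at x) v)" for v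
      unfolding elim(1)[THEN conjunct2, rule_format] elim(2)[THEN conjunct2, rule_format]
      by (rule right_diff_distrib[symmetric])
    ultimately show ?case by (intro exI[of _ "\<lambda>v. fd f (at x) v - fd g (at x) v"] conjI allI)
  qed
qed

lemma complex_linear_expand:
  fixes D :: "complex^'n \<Rightarrow> complex"
  assumes "linear D" "\<And>v. D (\<i> *s v) = \<i> * D v"
  shows "D v = (\<Sum>j\<in>UNIV. v $ j * D (axis j 1))"
proof -
  have "axis j \<i> = \<i> *s axis j (1 :: complex)" for j :: 'n by (simp add: vec_eq_iff axis_def)
  then have "D (axis j \<i>) = \<i> * D (axis j 1)" for j using assms(2) by simp
  then have "Re (v $ j) * D (axis j 1) + Im (v $ j) * D (axis j \<i>) = v $ j * D (axis j 1)" for j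
  proof -
    have "(Re (v $ j) + \<i> * Im (v $ j)) * D (axis j 1) = Re (v $ j) * D (axis j 1) + Im (v $ j) * D (axis j \<i>)"
      using \<open>\<And>j. D (axis j \<i>) = \<i> * D (axis j 1)\<close> by (simp add: algebra_simps)
    then show ?thesis using complex_eq[of "v $ j"] by simp
  qed
  then show ?thesis using linear_complex_vec_expand[OF assms(1), of v] by simp
qed

lemma hol_near_fd_expand:
  assumes "hol_near f a"
  shows "\<forall>\<^sub>F x in nhds a. \<forall>v. fd f (at x) v = (\<Sum>j\<in>UNIV. v $ j * fd f (at x) (axis j 1))"
  using hol_near_complex_linear[OF assms]
proof eventually_elim
  case (elim x)
  have "linear (fd f (at x))"
    using has_derivative_linear[OF elim[THEN conjunct1, unfolded frechet_derivative_works]] .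
  from complex_linear_expand[OF this elim[THEN conjunct2, rule_format]] show ?case by (rule allI)
qed

lemma hol_near_cvector_apply:
  assumes "hol_near f a"
  shows "\<forall>\<^sub>F p in nhds a. \<forall>x. cvector_apply x f p = (\<Sum>j\<in>UNIV. fst x $ j * fd f (at p) (axis j 1)) \<and>
    cvector_apply x f p = fd f (at p) (fst x)"
  using hol_near_complex_linear[OF assms] hol_near_fd_expand[OF assms]
proof eventually_elim
  case (elim p)
  show ?case
  proof
    fix x
    have "cvector_apply x f p = fd f (at p) (fst x)"
      by (rule cvector_apply_holomorphic) (use elim(1) in simp_all)
    then show "cvector_apply x f p = (\<Sum>j\<in>UNIV. fst x $ j * fd f (at p) (axis j 1)) \<and>
      cvector_apply x f p = fd f (at p) (fst x)"
      using trans[OF _ elim(2)[rule_format, of "fst x"]] by (intro conjI)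
  qed
qed

text \<open>The components of \<open>partial_derivs\<close>.\<close>

primrec scalar_partial :: "'n list \<Rightarrow> (complex^'n \<Rightarrow> complex) \<Rightarrow> complex^'n \<Rightarrow> complex" where
  "scalar_partial [] f = f"
| "scalar_partial (j # js) f = (\<lambda>x. fd (scalar_partial js f) (at x) (axis j 1))"

lemma scalar_partial_snoc:
  "scalar_partial (js @ [j]) f = scalar_partial js (\<lambda>x. fd f (at x) (axis j 1))"
  by (induction js) auto

lemma partial_derivs_component:
  fixes F :: "complex^'n \<Rightarrow> complex^'m"
  assumes "smooth_near F a"
  shows "smooth_near (partial_derivs js F) a \<and>
    (\<forall>\<^sub>F x in nhds a. \<forall>i. partial_derivs js F x $ i = scalar_partial js (\<lambda>x. F x $ i) x)"
proof (induction js)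
  case Nil
  then show ?case using assms by simp
next
  case (Cons j js)
  let ?G = "partial_derivs js F"
  have s: "smooth_near ?G a" using Cons by blast
  have "\<forall>\<^sub>F x in nhds a. \<forall>\<^sub>F y in nhds x. \<forall>i. ?G y $ i = scalar_partial js (\<lambda>x. F x $ i) y"
    using Cons by (simp add: eventually_eventually)
  then have "\<forall>\<^sub>F x in nhds a. \<forall>i. partial_derivs (j # js) F x $ i = scalar_partial (j # js) (\<lambda>x. F x $ i) x"
    using smooth_near_differentiable[OF s]
  proof eventually_elim
    case (elim x)
    have "fd ?G (at x) v $ i = fd (scalar_partial js (\<lambda>x. F x $ i)) (at x) v" for v i
    proof -
      have "(?G has_derivative fd ?G (at x)) (at x)" using elim(2) unfolding frechet_derivative_works .
      then have "((\<lambda>y. ?G y $ i) has_derivative (\<lambda>v. fd ?G (at x) v $ i)) (at x)"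
        by (rule bounded_linear.has_derivative[OF bounded_linear_vec_nth])
      from fd_eqI[OF this] have 1: "fd (\<lambda>y. ?G y $ i) (at x) = (\<lambda>v. fd ?G (at x) v $ i)" .
      have "\<forall>\<^sub>F y in nhds x. ?G y $ i = scalar_partial js (\<lambda>x. F x $ i) y"
        using elim(1) by eventually_elim simp
      from fd_cong_eventually[OF this] show ?thesis unfolding 1 by (rule fun_cong)
    qed
    then show ?case by simp
  qed
  then show ?case using smooth_near_fd[OF s] by simp
qed

context smooth_fields begin

lemma vanishes_if_partials_vanish:
  assumes "hol_near G 0" "\<And>js. length js < l \<Longrightarrow> scalar_partial js G 0 = 0"
  shows "vanishes T l G"
  using assms
proof (induction l arbitrary: G)
  case 0
  then show ?case by (simp add: hol_near_smooth)
next
  case (Suc l)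
  have "vanishes T l (\<lambda>p. cvector_apply (X p) G p)" if "X \<in> T" for X
  proof (rule vanishes_cong)
    have "vanishes T l (\<lambda>p. fd G (at p) (axis j 1))" for j
    proof (rule Suc.IH)
      show "scalar_partial js (\<lambda>p. fd G (at p) (axis j 1)) 0 = 0" if "length js < l" for js
        using Suc.prems(2)[of "js @ [j]"] that by (simp add: scalar_partial_snoc)
    qed (rule hol_near_fd[OF Suc.prems(1)])
    then show "vanishes T l (\<lambda>p. \<Sum>j\<in>UNIV. fst (X p) $ j * fd G (at p) (axis j 1))"
      using smooth[OF that]
      by (intro vanishes_sum vanishes_mult smooth_near_component smooth_near_fst)
    show "\<forall>\<^sub>F p in nhds 0. (\<Sum>j\<in>UNIV. fst (X p) $ j * fd G (at p) (axis j 1)) = cvector_apply (X p) G p"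
      using hol_near_cvector_apply[OF Suc.prems(1)]
      by eventually_elim (drule spec, erule conjunct1[THEN sym])
  qed
  moreover have "G 0 = 0" using Suc.prems(2)[of "[]"] by simp
  ultimately show ?case using hol_near_smooth[OF Suc.prems(1)] by simp
qed

text \<open>By induction \<open>G\<close> already vanishes to order \<open>l\<close> in the full sense. If \<open>Y\<close> has the \<open>(1, 0)\<close> part \<open>\<partial>/\<partial>z\<^sub>j\<close> at \<open>0\<close>, then \<open>Y G\<close>
  differs from \<open>\<partial>G/\<partial>z\<^sub>j\<close> by derivatives of \<open>G\<close> with coefficients vanishing at \<open>0\<close>, and these make up for the order lost
  by differentiating.\<close>

lemma partials_vanish_if_vanishes:
  assumes Y: "\<And>j. \<exists>Y\<in>T. fst (Y 0) = axis j 1"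
    and "hol_near G 0" "vanishes T l G" "length js < l"
  shows "scalar_partial js G 0 = 0"
  using assms(2-)
proof (induction l arbitrary: G js)
  case 0
  then show ?case by simp
next
  case (Suc l)
  show ?case
  proof (cases js rule: rev_cases)
    case Nil
    then show ?thesis using Suc.prems(2) by simp
  next
    case (snoc js' j)
    then obtain l' where l: "l = Suc l'" using Suc.prems(3) by (cases l) auto
    obtain Y where Y: "Y \<in> T" "fst (Y 0) = axis j 1" using Y by blast
    let ?G = "\<lambda>i p. fd G (at p) (axis i 1)"
    let ?a = "\<lambda>i p. (if i = j then 1 else 0) + (- 1) * fst (Y p) $ i"
    have "vanishes T l' (?G i)" for i
    proof (rule vanishes_if_partials_vanish[OF hol_near_fd[OF Suc.prems(1)]])
      show "scalar_partial js (?G i) 0 = 0" if "length js < l'" for js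
        using Suc.IH[OF Suc.prems(1) vanishes_Suc_D[OF Suc.prems(2)], of "js @ [i]"] that l
        by (simp add: scalar_partial_snoc)
    qed
    then have "vanishes T l (\<lambda>p. ?a i p * ?G i p)" for i
      unfolding l using Y smooth[OF Y(1)]
      by (intro vanishes_mult_gain smooth_near_add smooth_near_mult smooth_near_const
          smooth_near_component smooth_near_fst) (simp_all add: axis_def)
    then have v: "vanishes T l (\<lambda>p. cvector_apply (Y p) G p + (\<Sum>i\<in>UNIV. ?a i p * ?G i p))"
      by (intro vanishes_add vanishes_sum vanishes_apply[OF Suc.prems(2) Y(1)])
    have "vanishes T l (?G j)"
    proof (rule vanishes_cong[OF _ v])
      show "\<forall>\<^sub>F p in nhds 0. cvector_apply (Y p) G p + (\<Sum>i\<in>UNIV. ?a i p * ?G i p) = ?G j p"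
        using hol_near_cvector_apply[OF Suc.prems(1)]
      proof eventually_elim
        case (elim p)
        have "cvector_apply (Y p) G p + (\<Sum>i\<in>UNIV. ?a i p * ?G i p) = (\<Sum>i\<in>UNIV. if i = j then ?G i p else 0)"
          unfolding elim[rule_format, THEN conjunct1] sum.distrib[symmetric]
          by (intro sum.cong refl) (simp add: algebra_simps)
        then show ?case by simp
      qed
    qed
    moreover have "hol_near (?G j) 0" by (rule hol_near_fd[OF Suc.prems(1)])
    moreover have "length js' < l" using Suc.prems(3) snoc by simp
    ultimately have "scalar_partial js' (?G j) 0 = 0" by (intro Suc.IH)
    then show ?thesis unfolding snoc scalar_partial_snoc .
  qed
qed

end

section \<open>Differential relations along the Lie algebra\<close>

context smooth_fields begin

text \<open>\<open>D = A \<bar>D\<close> along \<open>T\<close> up to order \<open>k\<close>, for a holomorphic vector function with components \<open>D j\<close>.\<close>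

definition conj_relation :: "nat \<Rightarrow> ('m::finite \<Rightarrow> complex^'n \<Rightarrow> complex) \<Rightarrow> bool" where
  "conj_relation k D \<longleftrightarrow> (\<forall>j. hol_near (D j) 0) \<and>
     (\<exists>A. (\<forall>j i. smooth_near (A j i) 0) \<and>
          (\<forall>j. vanishes T k (\<lambda>p. D j p - (\<Sum>i\<in>UNIV. A j i p * cnj (D i p)))))"

text \<open>\<open>X D = C D\<close> up to order \<open>k\<close>.\<close>

definition linear_system :: "nat \<Rightarrow> 'n cfield \<Rightarrow> ('m::finite \<Rightarrow> complex^'n \<Rightarrow> complex) \<Rightarrow> bool" where
  "linear_system k X D \<longleftrightarrow> (\<exists>C. (\<forall>j i. smooth_near (C j i) 0) \<and>
     (\<forall>j. vanishes T k (\<lambda>p. cvector_apply (X p) (D j) p - (\<Sum>i\<in>UNIV. C j i p * D i p))))"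

lemma conj_relation_hol: "conj_relation k D \<Longrightarrow> hol_near (D j) 0"
  by (simp add: conj_relation_def)

lemma linear_systemI:
  assumes "\<And>j i. smooth_near (C j i) 0"
    "\<And>j. vanishes T k (\<lambda>p. cvector_apply (X p) (D j) p - (\<Sum>i\<in>UNIV. C j i p * D i p))"
  shows "linear_system k X D"
  unfolding linear_system_def using assms by (intro exI[of _ C] conjI allI)

lemma linear_systemE:
  assumes "linear_system k X D"
  obtains C where "\<forall>j i. smooth_near (C j i) 0"
    "\<forall>j. vanishes T k (\<lambda>p. cvector_apply (X p) (D j) p - (\<Sum>i\<in>UNIV. C j i p * D i p))"
  using assms unfolding linear_system_def by (elim exE conjE)

lemma linear_system_mono:
  assumes "linear_system k X D" "l \<le> k" shows "linear_system l X D"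
proof -
  obtain C where C': "\<forall>j i. smooth_near (C j i) 0"
    "\<forall>j. vanishes T k (\<lambda>p. cvector_apply (X p) (D j) p - (\<Sum>i\<in>UNIV. C j i p * D i p))"
    using linear_systemE[OF assms(1)] .
  note C = C'[rule_format]
  show ?thesis by (rule linear_systemI[of C, OF C(1) vanishes_mono[OF C(2) assms(2)]])
qed

lemma vanishes_apply_pred:
  assumes "vanishes T k \<phi>" "X \<in> T" shows "vanishes T (k - 1) (\<lambda>p. cvector_apply (X p) \<phi> p)"
  using assms by (cases k) (auto intro: smooth_near_cvector_apply smooth)

lemma linear_system_add:
  assumes "linear_system k X D" "linear_system k Y D"
  shows "linear_system k (\<lambda>p. X p + Y p) D"
proof -
  obtain C1 where C1': "\<forall>j i. smooth_near (C1 j i) 0"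
    "\<forall>j. vanishes T k (\<lambda>p. cvector_apply (X p) (D j) p - (\<Sum>i\<in>UNIV. C1 j i p * D i p))"
    using linear_systemE[OF assms(1)] .
    note C1 = C1'[rule_format]
  obtain C2 where C2': "\<forall>j i. smooth_near (C2 j i) 0"
    "\<forall>j. vanishes T k (\<lambda>p. cvector_apply (Y p) (D j) p - (\<Sum>i\<in>UNIV. C2 j i p * D i p))"
    using linear_systemE[OF assms(2)] .
    note C2 = C2'[rule_format]
  show ?thesis
  proof (rule linear_systemI[of "\<lambda>j i p. C1 j i p + C2 j i p"])
    show "smooth_near (\<lambda>p. C1 j i p + C2 j i p) 0" for j i by (intro smooth_near_add C1 C2)
    show "vanishes T k (\<lambda>p. cvector_apply (X p + Y p) (D j) p - (\<Sum>i\<in>UNIV. (C1 j i p + C2 j i p) * D i p))" for j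
      using vanishes_add[OF C1(2)[of j] C2(2)[of j]]
      by (simp add: cvector_apply_add_vector distrib_right sum.distrib algebra_simps)
  qed
qed

lemma linear_system_scale:
  assumes "linear_system k X D"
  shows "linear_system k (\<lambda>p. (c *s fst (X p), c *s snd (X p))) D"
proof -
  obtain C where C': "\<forall>j i. smooth_near (C j i) 0"
    "\<forall>j. vanishes T k (\<lambda>p. cvector_apply (X p) (D j) p - (\<Sum>i\<in>UNIV. C j i p * D i p))"
    using linear_systemE[OF assms] .
    note C = C'[rule_format]
  show ?thesis
  proof (rule linear_systemI[of "\<lambda>j i p. c * C j i p"])
    show "smooth_near (\<lambda>p. c * C j i p) 0" for j i by (intro smooth_near_mult smooth_near_const C)
    show "vanishes T k (\<lambda>p. cvector_apply (c *s fst (X p), c *s snd (X p)) (D j) p - (\<Sum>i\<in>UNIV. c * C j i p * D i p))" for j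
      using vanishes_mult[OF smooth_near_const C(2)[of j], of c]
      by (simp add: cvector_apply_scale_vector right_diff_distrib sum_distrib_left mult.assoc)
  qed
qed

text \<open>If \<open>X D = C D\<close> and \<open>Y D = B D\<close>, then \<open>X Y D = (X B) D + B X D = (X B + B C) D\<close>; differentiating the error of the
  second equation costs one order.\<close>

lemma apply_twice_linear_system:
  fixes D :: "'m::finite \<Rightarrow> complex^'n \<Rightarrow> complex"
  assumes "X \<in> T" "Y \<in> T" "\<And>j. smooth_near (D j) 0" "linear_system k X D" "linear_system k Y D"
  obtains K where "\<forall>j i. smooth_near (K j i) 0"
    "\<forall>j. vanishes T (k - 1) (\<lambda>p. cvector_apply (X p) (\<lambda>q. cvector_apply (Y q) (D j) q) p - (\<Sum>i\<in>UNIV. K j i p * D i p))"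
proof -
  obtain C where C': "\<forall>j i. smooth_near (C j i) 0"
    "\<forall>j. vanishes T k (\<lambda>p. cvector_apply (X p) (D j) p - (\<Sum>i\<in>UNIV. C j i p * D i p))"
    using linear_systemE[OF assms(4)] .
    note C = C'[rule_format]
  obtain B where B': "\<forall>j i. smooth_near (B j i) 0"
    "\<forall>j. vanishes T k (\<lambda>p. cvector_apply (Y p) (D j) p - (\<Sum>i\<in>UNIV. B j i p * D i p))"
    using linear_systemE[OF assms(5)] .
    note B = B'[rule_format]
  \<comment> \<open>The errors of the two systems.\<close>
  define ex where "ex j p = cvector_apply (X p) (D j) p - (\<Sum>i\<in>UNIV. C j i p * D i p)" for j p
  define ey where "ey j p = cvector_apply (Y p) (D j) p - (\<Sum>i\<in>UNIV. B j i p * D i p)" for j p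
  have vx: "vanishes T k (ex j)" and vy: "vanishes T k (ey j)" for j
    using C(2)[of j] B(2)[of j] by (simp_all add: ex_def[abs_def] ey_def[abs_def])
  define K where "K j i p = cvector_apply (X p) (B j i) p + (\<Sum>l\<in>UNIV. B j l p * C l i p)" for j i p
  show thesis
  proof (rule that[of K]; intro allI)
    show "smooth_near (K j i) 0" for j i
      unfolding K_def
      by (intro smooth_near_add smooth_near_sum smooth_near_mult smooth_near_cvector_apply smooth assms B C)
    show "vanishes T (k - 1) (\<lambda>p. cvector_apply (X p) (\<lambda>q. cvector_apply (Y q) (D j) q) p - (\<Sum>i\<in>UNIV. K j i p * D i p))" for j
    proof (rule vanishes_cong)
      show "vanishes T (k - 1) (\<lambda>p. cvector_apply (X p) (ey j) p + (\<Sum>l\<in>UNIV. B j l p * ex l p))"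
        using vanishes_mono[OF vx]
        by (intro vanishes_add vanishes_apply_pred vy assms vanishes_sum vanishes_mult B) auto
      have sm: "\<forall>\<^sub>F p in nhds 0. \<forall>i. B j i differentiable (at p)" "\<forall>\<^sub>F p in nhds 0. \<forall>i. D i differentiable (at p)"
        using eventually_ball_finite[of UNIV "\<lambda>p i. B j i differentiable (at p)"]
          eventually_ball_finite[of UNIV "\<lambda>p i. D i differentiable (at p)"]
          smooth_near_differentiable[OF B(1)] smooth_near_differentiable[OF assms(3)] by simp_all
      show "\<forall>\<^sub>F p in nhds 0. cvector_apply (X p) (ey j) p + (\<Sum>l\<in>UNIV. B j l p * ex l p) =
          cvector_apply (X p) (\<lambda>q. cvector_apply (Y q) (D j) q) p - (\<Sum>i\<in>UNIV. K j i p * D i p)"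
        using sm smooth_near_differentiable[OF vanishes_smooth[OF vy[of j]]]
      proof eventually_elim
        case (elim p)
        have "(\<lambda>q. cvector_apply (Y q) (D j) q) = (\<lambda>q. ey j q + (\<Sum>i\<in>UNIV. B j i q * D i q))"
          by (simp add: ey_def)
        moreover have "cvector_apply (X p) (\<lambda>q. ey j q + (\<Sum>i\<in>UNIV. B j i q * D i q)) p =
            cvector_apply (X p) (ey j) p + (\<Sum>i\<in>UNIV. B j i p * cvector_apply (X p) (D i) p + cvector_apply (X p) (B j i) p * D i p)"
          using elim by (simp add: cvector_apply_add cvector_apply_sum cvector_apply_mult differentiable_sum differentiable_mult)
        moreover have "cvector_apply (X p) (D i) p = ex i p + (\<Sum>l\<in>UNIV. C i l p * D l p)" for i by (simp add: ex_def)
        moreover have "(\<Sum>i\<in>UNIV. K j i p * D i p) = (\<Sum>i\<in>UNIV. cvector_apply (X p) (B j i) p * D i p)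
            + (\<Sum>i\<in>UNIV. B j i p * (\<Sum>l\<in>UNIV. C i l p * D l p))"
        proof -
          have "(\<Sum>i\<in>UNIV. (\<Sum>l\<in>UNIV. B j l p * C l i p) * D i p) = (\<Sum>i\<in>UNIV. \<Sum>l\<in>UNIV. B j l p * C l i p * D i p)"
            by (simp add: sum_distrib_right)
          also have "\<dots> = (\<Sum>l\<in>UNIV. \<Sum>i\<in>UNIV. B j l p * C l i p * D i p)" by (rule sum.swap)
          also have "\<dots> = (\<Sum>i\<in>UNIV. B j i p * (\<Sum>l\<in>UNIV. C i l p * D l p))"
            by (simp add: sum_distrib_left mult.assoc)
          finally show ?thesis by (simp add: K_def distrib_right sum.distrib)
        qed
        ultimately show ?case by (simp add: distrib_left sum.distrib)
      qed
    qed
  qed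
qed

lemma linear_system_lie_bracket:
  fixes D :: "'m::finite \<Rightarrow> complex^'n \<Rightarrow> complex"
  assumes "X \<in> T" "Y \<in> T" "\<And>j. smooth_near (D j) 0" "linear_system k X D" "linear_system k Y D"
  shows "linear_system (k - 1) (lie_bracket X Y) D"
proof -
  obtain K where K': "\<forall>j i. smooth_near (K j i) 0"
    "\<forall>j. vanishes T (k - 1) (\<lambda>p. cvector_apply (X p) (\<lambda>q. cvector_apply (Y q) (D j) q) p - (\<Sum>i\<in>UNIV. K j i p * D i p))"
    using apply_twice_linear_system[OF assms] .
    note K = K'[rule_format]
  obtain L where L': "\<forall>j i. smooth_near (L j i) 0"
    "\<forall>j. vanishes T (k - 1) (\<lambda>p. cvector_apply (Y p) (\<lambda>q. cvector_apply (X q) (D j) q) p - (\<Sum>i\<in>UNIV. L j i p * D i p))"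
    using apply_twice_linear_system[OF assms(2,1,3,5,4)] .
    note L = L'[rule_format]
  show ?thesis
  proof (rule linear_systemI[of "\<lambda>j i p. K j i p + (- 1) * L j i p"])
    show "smooth_near (\<lambda>p. K j i p + (- 1) * L j i p) 0" for j i
      by (intro smooth_near_add smooth_near_mult smooth_near_const K L)
    show "vanishes T (k - 1) (\<lambda>p. cvector_apply (lie_bracket X Y p) (D j) p - (\<Sum>i\<in>UNIV. (K j i p + (- 1) * L j i p) * D i p))" for j
    proof (rule vanishes_cong[OF _ vanishes_diff[OF K(2)[of j] L(2)[of j]]])
      show "\<forall>\<^sub>F p in nhds 0. cvector_apply (X p) (\<lambda>q. cvector_apply (Y q) (D j) q) p - (\<Sum>i\<in>UNIV. K j i p * D i p) -
            (cvector_apply (Y p) (\<lambda>q. cvector_apply (X q) (D j) q) p - (\<Sum>i\<in>UNIV. L j i p * D i p)) =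
          cvector_apply (lie_bracket X Y p) (D j) p - (\<Sum>i\<in>UNIV. (K j i p + (- 1) * L j i p) * D i p)"
        using smooth_near_nhds[OF smooth[OF assms(1)]] smooth_near_nhds[OF smooth[OF assms(2)]] smooth_near_nhds[OF assms(3)[of j]]
        by eventually_elim (simp add: cvector_apply_lie_bracket left_diff_distrib sum_subtractf)
    qed
  qed
qed

lemma linear_system_0_1_field:
  assumes "conj_relation k D" "\<forall>\<^sub>F p in nhds 0. fst (X p) = 0"
  shows "linear_system k X D"
proof (rule linear_systemI[of "\<lambda>j i p. 0"])
  show "vanishes T k (\<lambda>p. cvector_apply (X p) (D j) p - (\<Sum>i\<in>UNIV. 0 * D i p))" for j
  proof (rule vanishes_cong[OF _ vanishes_zero])
    show "\<forall>\<^sub>F p in nhds 0. 0 = cvector_apply (X p) (D j) p - (\<Sum>i\<in>UNIV. 0 * D i p)"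
      using hol_near_cvector_apply[OF conj_relation_hol[OF assms(1), of j]] assms(2)
    proof eventually_elim
      case (elim p)
      show ?case using elim(1)[rule_format, of "X p"] elim(2) by simp
    qed
  qed
qed (rule smooth_near_const)

text \<open>Differentiating \<open>D = A \<bar>D\<close> along \<open>X\<close> gives \<open>X D = (X A) \<bar>D\<close>, because \<open>X\<close> annihilates the antiholomorphic function \<open>\<bar>D\<close>.
  The conjugate relation \<open>\<bar>D = \<bar>A D\<close> turns this into a system for \<open>D\<close>.\<close>

lemma linear_system_1_0_field:
  fixes D :: "'m::finite \<Rightarrow> complex^'n \<Rightarrow> complex"
  assumes T: "\<And>X. X \<in> T \<Longrightarrow> (\<lambda>p. cvector_cnj (X p)) \<in> T"
    and "conj_relation k D" "X \<in> T" "\<forall>\<^sub>F p in nhds 0. snd (X p) = 0"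
  shows "linear_system (k - 1) X D"
proof -
  have hol: "hol_near (D j) 0" for j using conj_relation_hol[OF assms(2)] .
  obtain A where A': "\<forall>j i. smooth_near (A j i) 0"
    "\<forall>j. vanishes T k (\<lambda>p. D j p - (\<Sum>i\<in>UNIV. A j i p * cnj (D i p)))"
    using assms(2) unfolding conj_relation_def by (elim conjE exE)
    note A = A'[rule_format]
  define E where "E j p = D j p - (\<Sum>i\<in>UNIV. A j i p * cnj (D i p))" for j p
  have vE: "vanishes T k (E j)" for j using A(2)[of j] by (simp add: E_def[abs_def])
  define C where "C j l p = (\<Sum>i\<in>UNIV. cvector_apply (X p) (A j i) p * cnj (A i l p))" for j l p
  show ?thesis
  proof (rule linear_systemI[of C])
    show "smooth_near (C j l) 0" for j l
      unfolding C_def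
      by (intro smooth_near_sum smooth_near_mult smooth_near_cvector_apply smooth smooth_near_cnj A assms)
    show "vanishes T (k - 1) (\<lambda>p. cvector_apply (X p) (D j) p - (\<Sum>l\<in>UNIV. C j l p * D l p))" for j
    proof (rule vanishes_cong)
      have "vanishes T (k - 1) (\<lambda>p. cnj (E i p))" for i
        by (rule vanishes_mono[OF vanishes_cnj[OF T vE]]) auto
      then show "vanishes T (k - 1) (\<lambda>p. cvector_apply (X p) (E j) p + (\<Sum>i\<in>UNIV. cvector_apply (X p) (A j i) p * cnj (E i p)))"
        by (intro vanishes_add vanishes_apply_pred vE assms vanishes_sum vanishes_mult smooth_near_cvector_apply smooth A)
      have ap: "\<forall>\<^sub>F p in nhds 0. \<forall>x. cvector_apply x (D i) p = fd (D i) (at p) (fst x)" for i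
        using hol_near_cvector_apply[OF hol[of i]]
        by eventually_elim (intro allI, drule spec, erule conjunct2)
      have ev: "\<forall>\<^sub>F p in nhds 0. \<forall>i. A j i differentiable (at p)" "\<forall>\<^sub>F p in nhds 0. \<forall>i. D i differentiable (at p)"
        "\<forall>\<^sub>F p in nhds 0. \<forall>i x. cvector_apply x (D i) p = fd (D i) (at p) (fst x)"
        using eventually_ball_finite[of UNIV "\<lambda>p i. A j i differentiable (at p)"]
          eventually_ball_finite[of UNIV "\<lambda>p i. D i differentiable (at p)"]
          eventually_ball_finite[of UNIV "\<lambda>p i. \<forall>x. cvector_apply x (D i) p = fd (D i) (at p) (fst x)"]
          smooth_near_differentiable[OF A(1)] smooth_near_differentiable[OF hol_near_smooth[OF hol]] ap
        by (simp_all del: split_paired_All)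
      show "\<forall>\<^sub>F p in nhds 0. cvector_apply (X p) (E j) p + (\<Sum>i\<in>UNIV. cvector_apply (X p) (A j i) p * cnj (E i p)) =
          cvector_apply (X p) (D j) p - (\<Sum>l\<in>UNIV. C j l p * D l p)"
        using ev smooth_near_differentiable[OF vanishes_smooth[OF vE[of j]]] assms(4)
      proof eventually_elim
        case (elim p)
        have dD: "D i differentiable (at p)" for i using elim(2) by simp
        have dc: "(\<lambda>q. cnj (D i q)) differentiable (at p)" for i
          using has_derivative_cnj[OF dD[unfolded frechet_derivative_works]] by (rule differentiableI)
        have "fd (D i) (at p) 0 = 0" for i
          using linear_0[OF has_derivative_linear[OF dD[unfolded frechet_derivative_works]]] .
        then have c0: "cvector_apply (X p) (\<lambda>q. cnj (D i q)) p = 0" for i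
          by (simp only: cvector_apply_cnj[OF dD] elim(3)[rule_format]) (simp add: cvector_cnj_def elim(5))
        have "D j = (\<lambda>q. E j q + (\<Sum>i\<in>UNIV. A j i q * cnj (D i q)))" by (simp add: E_def)
        then have "cvector_apply (X p) (D j) p = cvector_apply (X p) (\<lambda>q. E j q + (\<Sum>i\<in>UNIV. A j i q * cnj (D i q))) p"
          by (rule arg_cong)
        also have "\<dots> = cvector_apply (X p) (E j) p + (\<Sum>i\<in>UNIV. cvector_apply (X p) (A j i) p * cnj (D i p))"
          using elim(1,4) dc
          by (simp add: cvector_apply_add cvector_apply_sum cvector_apply_mult differentiable_sum differentiable_mult c0)
        also have "(\<Sum>i\<in>UNIV. cvector_apply (X p) (A j i) p * cnj (D i p)) =
            (\<Sum>i\<in>UNIV. cvector_apply (X p) (A j i) p * cnj (E i p)) + (\<Sum>l\<in>UNIV. C j l p * D l p)"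
        proof -
          have "cnj (D i p) = cnj (E i p) + (\<Sum>l\<in>UNIV. cnj (A i l p) * D l p)" for i
            by (simp add: E_def)
          then have "(\<Sum>i\<in>UNIV. cvector_apply (X p) (A j i) p * cnj (D i p)) =
            (\<Sum>i\<in>UNIV. cvector_apply (X p) (A j i) p * cnj (E i p)) +
            (\<Sum>i\<in>UNIV. \<Sum>l\<in>UNIV. cvector_apply (X p) (A j i) p * cnj (A i l p) * D l p)"
            by (simp only: distrib_left sum.distrib sum_distrib_left mult.assoc)
          also have "(\<Sum>i\<in>UNIV. \<Sum>l\<in>UNIV. cvector_apply (X p) (A j i) p * cnj (A i l p) * D l p) =
            (\<Sum>l\<in>UNIV. \<Sum>i\<in>UNIV. cvector_apply (X p) (A j i) p * cnj (A i l p) * D l p)" by (rule sum.swap)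
          also have "\<dots> = (\<Sum>l\<in>UNIV. C j l p * D l p)" by (simp only: C_def sum_distrib_right)
          finally show ?thesis .
        qed
        finally show ?case by simp
      qed
    qed
  qed
qed

text \<open>Inserting an approximate relation \<open>D = A \<bar>D\<close> into the term \<open>N D\<close> gives the relation \<open>D = (B + N A) \<bar>D\<close>, whose error
  is of one order more because \<open>N(0) = 0\<close>. This avoids inverting \<open>1 - N\<close>.\<close>

lemma conj_relationI:
  fixes D :: "'m::finite \<Rightarrow> complex^'n \<Rightarrow> complex"
  assumes hol: "\<And>j. hol_near (D j) 0"
    and N: "\<And>j i. smooth_near (N j i) 0" "\<And>j i. N j i 0 = 0" and B: "\<And>j i. smooth_near (B j i) 0"
    and rel: "\<And>j. vanishes T k (\<lambda>p. D j p - (\<Sum>i\<in>UNIV. N j i p * D i p) - (\<Sum>i\<in>UNIV. B j i p * cnj (D i p)))"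
  shows "conj_relation k D"
proof -
  have "\<exists>A. (\<forall>j i. smooth_near (A j i) 0) \<and>
     (\<forall>j. vanishes T s (\<lambda>p. D j p - (\<Sum>i\<in>UNIV. A j i p * cnj (D i p))))" if "s \<le> k" for s
    using that
  proof (induction s)
    case 0
    have "smooth_near (\<lambda>p. D j p - (\<Sum>i\<in>UNIV. (0 :: complex) * cnj (D i p))) 0" for j
      using hol_near_smooth[OF hol[of j]] by simp
    then show ?case
      by (intro exI[of _ "\<lambda>j i p. 0"] conjI allI smooth_near_const) (simp only: vanishes.simps)
  next
    case (Suc s)
    have "s \<le> k" using Suc.prems by simp
    from Suc.IH[OF this] obtain A where A': "\<forall>j i. smooth_near (A j i) 0"
      "\<forall>j. vanishes T s (\<lambda>p. D j p - (\<Sum>i\<in>UNIV. A j i p * cnj (D i p)))"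
      by (elim exE conjE)
    note A = A'[rule_format]
    define A' where "A' j i p = B j i p + (\<Sum>l\<in>UNIV. N j l p * A l i p)" for j i p
    have 1: "smooth_near (A' j i) 0" for j i
      unfolding A'_def by (intro smooth_near_add smooth_near_sum smooth_near_mult A B N)
    have 2: "vanishes T (Suc s) (\<lambda>p. D j p - (\<Sum>i\<in>UNIV. A' j i p * cnj (D i p)))" for j
    proof -
      have "vanishes T (Suc s) (\<lambda>p. (D j p - (\<Sum>i\<in>UNIV. N j i p * D i p) - (\<Sum>i\<in>UNIV. B j i p * cnj (D i p)))
         + (\<Sum>i\<in>UNIV. N j i p * (D i p - (\<Sum>l\<in>UNIV. A i l p * cnj (D l p)))))"
        using Suc.prems
        by (intro vanishes_add vanishes_sum vanishes_mult_gain N A vanishes_mono[OF rel])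
      also have "(\<lambda>p. (D j p - (\<Sum>i\<in>UNIV. N j i p * D i p) - (\<Sum>i\<in>UNIV. B j i p * cnj (D i p)))
         + (\<Sum>i\<in>UNIV. N j i p * (D i p - (\<Sum>l\<in>UNIV. A i l p * cnj (D l p))))) =
         (\<lambda>p. D j p - (\<Sum>i\<in>UNIV. A' j i p * cnj (D i p)))"
      proof
        fix p
        have "(\<Sum>i\<in>UNIV. (\<Sum>l\<in>UNIV. N j l p * A l i p) * cnj (D i p)) =
            (\<Sum>i\<in>UNIV. \<Sum>l\<in>UNIV. N j l p * A l i p * cnj (D i p))"
          by (simp only: sum_distrib_right)
        also have "\<dots> = (\<Sum>l\<in>UNIV. \<Sum>i\<in>UNIV. N j l p * A l i p * cnj (D i p))" by (rule sum.swap)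
        also have "\<dots> = (\<Sum>i\<in>UNIV. N j i p * (\<Sum>l\<in>UNIV. A i l p * cnj (D l p)))"
          by (simp only: sum_distrib_left mult.assoc)
        finally show "(D j p - (\<Sum>i\<in>UNIV. N j i p * D i p) - (\<Sum>i\<in>UNIV. B j i p * cnj (D i p)))
         + (\<Sum>i\<in>UNIV. N j i p * (D i p - (\<Sum>l\<in>UNIV. A i l p * cnj (D l p)))) =
         D j p - (\<Sum>i\<in>UNIV. A' j i p * cnj (D i p))"
          by (simp add: A'_def distrib_right right_diff_distrib sum.distrib sum_subtractf)
      qed
      finally show ?thesis .
    qed
    show ?case using 1 2 by (intro exI[of _ A'] conjI allI)
  qed
  then show ?thesis using hol unfolding conj_relation_def by simp
qed

end

context generic_manifold begin

text \<open>It is essential that \<open>a\<close> is chosen before \<open>k\<close> and \<open>D\<close>: it depends only on how deeply brackets are nested in the construction of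
  \<open>X\<close>.\<close>

lemma cr_lie_algebra_linear_system:
  assumes "X \<in> cr_lie_algebra d \<rho> M"
  shows "\<exists>a. \<forall>k (D :: 'm::finite \<Rightarrow> complex^'n \<Rightarrow> complex). conj_relation k D \<longrightarrow> linear_system (k - a) X D"
  using assms
proof (induction rule: cr_lie_algebra.induct)
  case (field_1_0 X)
  then have "X \<in> T" by (intro cr_lie_algebra_subset_T cr_lie_algebra.field_1_0)
  then show ?case using linear_system_1_0_field[OF T_cnj] field_1_0(3) by (intro exI[of _ 1] allI impI)
next
  case (field_0_1 X)
  then show ?case using linear_system_0_1_field by (intro exI[of _ 0] allI impI) simp
next
  case (add X Y)
  then obtain a b where ab': "\<forall>k (D :: 'm \<Rightarrow> complex^'n \<Rightarrow> complex). conj_relation k D \<longrightarrow> linear_system (k - a) X D"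
    "\<forall>k (D :: 'm \<Rightarrow> complex^'n \<Rightarrow> complex). conj_relation k D \<longrightarrow> linear_system (k - b) Y D"
    by (elim exE)
  note ab = ab'[rule_format]
  show ?case
    by (intro exI[of _ "max a b"] allI impI linear_system_add)
      (rule linear_system_mono[OF ab(1)] linear_system_mono[OF ab(2)], assumption, simp)+
next
  case (scale X c)
  then obtain a where a': "\<forall>k (D :: 'm \<Rightarrow> complex^'n \<Rightarrow> complex). conj_relation k D \<longrightarrow> linear_system (k - a) X D"
    by (elim exE)
  note a = a'[rule_format]
  show ?case by (intro exI[of _ a] allI impI linear_system_scale a)
next
  case (bracket X Y)
  then obtain a b where ab': "\<forall>k (D :: 'm \<Rightarrow> complex^'n \<Rightarrow> complex). conj_relation k D \<longrightarrow> linear_system (k - a) X D"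
    "\<forall>k (D :: 'm \<Rightarrow> complex^'n \<Rightarrow> complex). conj_relation k D \<longrightarrow> linear_system (k - b) Y D"
    by (elim exE)
  note ab = ab'[rule_format]
  have XY: "X \<in> T" "Y \<in> T" using bracket cr_lie_algebra_subset_T by simp_all
  have "linear_system (k - (max a b + 1)) (lie_bracket X Y) D" if D: "conj_relation k D"
    for k and D :: "'m \<Rightarrow> complex^'n \<Rightarrow> complex"
  proof -
    have "linear_system (k - max a b) X D" "linear_system (k - max a b) Y D"
      by (rule linear_system_mono[OF ab(1)[OF D]], simp, rule linear_system_mono[OF ab(2)[OF D]], simp)
    from linear_system_lie_bracket[OF XY hol_near_smooth[OF conj_relation_hol[OF D]] this]
    show ?thesis by simp
  qed
  then show ?case by (intro exI[of _ "max a b + 1"] allI impI)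
qed

text \<open>The tangent space has finite dimension, so the loss of order is bounded by that of the members of a basis. The fields
  \<open>Y\<close> with a given bound form a space.\<close>

lemma finite_type_uniform_loss:
  assumes "finite_type_at_0 d \<rho> M"
  obtains m where "\<forall>x\<in>complexified_tangent_space d \<rho> 0. \<exists>Y\<in>T. Y 0 = x \<and>
    (\<forall>k (D :: 'm::finite \<Rightarrow> complex^'n \<Rightarrow> complex). conj_relation k D \<longrightarrow> linear_system (k - m) Y D)"
proof -
  let ?V = "complexified_tangent_space d \<rho> 0"
  obtain B where B: "B \<subseteq> ?V" "independent B" "?V \<subseteq> span B" using maximal_independent_subset by blast
  have fB: "finite B" using independent_imp_finite[OF B(2)] .
  have "\<forall>x\<in>B. \<exists>a. \<exists>Y\<in>T. Y 0 = x \<and>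
    (\<forall>k (D :: 'm \<Rightarrow> complex^'n \<Rightarrow> complex). conj_relation k D \<longrightarrow> linear_system (k - a) Y D)"
  proof
    fix x assume "x \<in> B"
    then have "x \<in> (\<lambda>X. X 0) ` cr_lie_algebra d \<rho> M" using B(1) assms unfolding finite_type_at_0_def by blast
    then obtain X where X: "X \<in> cr_lie_algebra d \<rho> M" "x = X 0" by (elim imageE)
    obtain a where "\<forall>k (D :: 'm \<Rightarrow> complex^'n \<Rightarrow> complex). conj_relation k D \<longrightarrow> linear_system (k - a) X D"
      using cr_lie_algebra_linear_system[OF X(1)] by (elim exE)
    then show "\<exists>a. \<exists>Y\<in>T. Y 0 = x \<and>
      (\<forall>k (D :: 'm \<Rightarrow> complex^'n \<Rightarrow> complex). conj_relation k D \<longrightarrow> linear_system (k - a) Y D)"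
      using cr_lie_algebra_subset_T[OF X(1)] X(2) by (intro exI[of _ a] bexI[of _ X] conjI) simp_all
  qed
  then obtain a where a: "\<forall>x\<in>B. \<exists>Y\<in>T. Y 0 = x \<and>
    (\<forall>k (D :: 'm \<Rightarrow> complex^'n \<Rightarrow> complex). conj_relation k D \<longrightarrow> linear_system (k - a x) Y D)"
    by (drule_tac bchoice) (elim exE)
  \<comment> \<open>Any upper bound of the finitely many \<open>a x\<close> would do.\<close>
  define m where "m = (\<Sum>x\<in>B. a x)"
  define W where "W = {x. \<exists>Y\<in>T. Y 0 = x \<and>
    (\<forall>k (D :: 'm \<Rightarrow> complex^'n \<Rightarrow> complex). conj_relation k D \<longrightarrow> linear_system (k - m) Y D)}"
  have BW: "B \<subseteq> W"
  proof
    fix x assume x: "x \<in> B"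
    then have "a x \<le> m" unfolding m_def using fB by (intro member_le_sum) auto
    moreover obtain Y where Y: "Y \<in> T" "Y 0 = x"
      "\<forall>k (D :: 'm \<Rightarrow> complex^'n \<Rightarrow> complex). conj_relation k D \<longrightarrow> linear_system (k - a x) Y D"
      using a[rule_format, OF x] by (elim bexE conjE)
    ultimately have "\<forall>k (D :: 'm \<Rightarrow> complex^'n \<Rightarrow> complex). conj_relation k D \<longrightarrow> linear_system (k - m) Y D"
      by (intro allI impI linear_system_mono[OF Y(3)[rule_format]]) auto
    then show "x \<in> W" unfolding W_def using Y(1,2) by (intro CollectI bexI[of _ Y] conjI)
  qed
  have "subspace W"
    unfolding subspace_def
  proof (intro conjI ballI allI)
    have zero: "(\<lambda>_. 0) \<in> T" by (simp add: T_iff smooth_near_const)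
    have "linear_system k (\<lambda>_. 0) D" for k and D :: "'m \<Rightarrow> complex^'n \<Rightarrow> complex"
      by (rule linear_systemI[of "\<lambda>j i p. 0"]) (simp_all add: smooth_near_const vanishes_zero)
    then show "0 \<in> W" unfolding W_def using zero by (intro CollectI bexI[of _ "\<lambda>_. 0"]) simp_all
  next
    fix x y assume "x \<in> W" "y \<in> W"
    then obtain X Y where XY: "X \<in> T" "X 0 = x" "Y \<in> T" "Y 0 = y"
      "\<forall>k (D :: 'm \<Rightarrow> complex^'n \<Rightarrow> complex). conj_relation k D \<longrightarrow> linear_system (k - m) X D"
      "\<forall>k (D :: 'm \<Rightarrow> complex^'n \<Rightarrow> complex). conj_relation k D \<longrightarrow> linear_system (k - m) Y D"
      unfolding W_def by (elim CollectE bexE conjE)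
    show "x + y \<in> W"
      unfolding W_def using XY(2,4)
      by (intro CollectI bexI[OF _ T_add[OF XY(1,3)]] conjI allI impI linear_system_add XY(5,6)[rule_format]) simp_all
  next
    fix c :: real and x assume "x \<in> W"
    then obtain X where X: "X \<in> T" "X 0 = x"
      "\<forall>k (D :: 'm \<Rightarrow> complex^'n \<Rightarrow> complex). conj_relation k D \<longrightarrow> linear_system (k - m) X D"
      unfolding W_def by (elim CollectE bexE conjE)
    have "(complex_of_real c *s fst (X 0), complex_of_real c *s snd (X 0)) = c *\<^sub>R x"
      using X(2) by (simp add: prod_eq_iff scaleR_vec_smult)
    then show "c *\<^sub>R x \<in> W"
      unfolding W_def
      by (intro CollectI bexI[OF _ T_scale[OF X(1), of "complex_of_real c"]] conjI allI impI linear_system_scale X(3)[rule_format]) simp_all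
  qed
  then have "?V \<subseteq> W" using span_minimal[OF BW] B(3) by blast
  then show thesis by (intro that[of m]) (auto simp: W_def)
qed

text \<open>Any tangent field \<open>X\<close> agrees at \<open>0\<close> with some \<open>Y\<close> for which \<open>Y D = C D\<close>. If \<open>D\<close> vanishes to order \<open>l\<close>, then so do
  \<open>Y D\<close> and \<open>(X - Y) D\<close>, hence \<open>D\<close> vanishes to order \<open>l + 1\<close>.\<close>

lemma conj_relation_vanishes:
  fixes D :: "'m::finite \<Rightarrow> complex^'n \<Rightarrow> complex"
  assumes Y: "\<forall>x\<in>complexified_tangent_space d \<rho> 0. \<exists>Y\<in>T. Y 0 = x \<and> linear_system k Y D"
    and D: "\<And>j. smooth_near (D j) 0" "\<And>j. D j 0 = 0"
  shows "l \<le> Suc k \<Longrightarrow> vanishes T l (D j)"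
proof (induction l arbitrary: j)
  case 0
  then show ?case by (simp add: D)
next
  case (Suc l)
  then have IH: "vanishes T l (D j)" for j by simp
  have "vanishes T l (\<lambda>p. cvector_apply (X p) (D j) p)" if X: "X \<in> T" for X
  proof -
    have "X 0 \<in> complexified_tangent_space d \<rho> 0"
      using X zero_in_M unfolding T_def tangent_field_def by (auto dest: eventually_nhds_x_imp_x)
    from Y[rule_format, OF this] obtain Y where Y: "Y \<in> T" "Y 0 = X 0" "linear_system k Y D" by (elim bexE conjE)
    obtain C where C': "\<forall>j i. smooth_near (C j i) 0"
      "\<forall>j. vanishes T k (\<lambda>p. cvector_apply (Y p) (D j) p - (\<Sum>i\<in>UNIV. C j i p * D i p))"
      using linear_systemE[OF Y(3)] .
    note C = C'[rule_format]
    have 1: "vanishes T l (\<lambda>p. cvector_apply (X p - Y p) (D j) p)"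
      by (rule vanishes_field_vanishing_at_0[OF T_diff[OF X Y(1)] _ IH]) (simp add: Y(2))
    have 2: "vanishes T l (\<lambda>p. cvector_apply (Y p) (D j) p - (\<Sum>i\<in>UNIV. C j i p * D i p))"
      using Suc.prems by (intro vanishes_mono[OF C(2)]) simp
    have 3: "vanishes T l (\<lambda>p. \<Sum>i\<in>UNIV. C j i p * D i p)"
      by (intro vanishes_sum vanishes_mult C IH)
    show ?thesis using vanishes_add[OF vanishes_add[OF 1 2] 3] by (simp add: cvector_apply_diff_vector)
  qed
  then show ?case by (simp add: D)
qed

end

section \<open>Differences of two maps into the target\<close>

lemma holomorphic_near_derivative:
  assumes "holomorphic_near f a"
  shows "\<forall>\<^sub>F x in nhds a. \<exists>D. (f has_derivative D) (at x) \<and> (\<forall>c v. D (c *s v) = c *s D v)"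
  using assms unfolding holomorphic_near_def
proof eventually_elim
  case (elim x)
  then obtain D where D: "Vector_Spaces.linear (*s) (*s) D" "(f has_derivative D) (at x)" by (elim exE conjE)
  interpret Vector_Spaces.linear "(*s)" "(*s)" D using D(1) .
  show ?case using D(2) scale by (intro exI[of _ D]) simp
qed

lemma holomorphic_near_component:
  assumes "holomorphic_near f a" shows "hol_near (\<lambda>x. f x $ j) a"
proof (rule hol_nearI)
  show "\<forall>\<^sub>F x in nhds a. \<exists>D. ((\<lambda>x. f x $ j) has_derivative D) (at x) \<and> (\<forall>v. D (\<i> *s v) = \<i> * D v)"
    using holomorphic_near_derivative[OF assms]
  proof eventually_elim
    case (elim x)
    then obtain D where D: "(f has_derivative D) (at x)" "\<forall>c v. D (c *s v) = c *s D v" by (elim exE conjE)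
    then show ?case
      using bounded_linear.has_derivative[OF bounded_linear_vec_nth D(1), of j]
      by (intro exI[of _ "\<lambda>v. D v $ j"]) simp
  qed
qed

lemma holomorphic_near_smooth: "holomorphic_near f a \<Longrightarrow> smooth_near f a"
  by (intro smooth_near_vec hol_near_smooth holomorphic_near_component)

lemma smooth_near_tendsto: "smooth_near f a \<Longrightarrow> filterlim f (nhds (f a)) (nhds a)"
  using smooth_near_isCont[of f a] by (simp add: isCont_def tendsto_at_iff_tendsto_nhds)

lemma hol_near_compose:
  assumes f: "hol_near f (H a)" and H: "holomorphic_near H a"
  shows "hol_near (\<lambda>x. f (H x)) a"
proof (rule hol_nearI)
  have "\<forall>\<^sub>F x in nhds a. f differentiable (at (H x)) \<and> (\<forall>v. fd f (at (H x)) (\<i> *s v) = \<i> * fd f (at (H x)) v)"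
    by (rule eventually_compose_filterlim[OF hol_near_complex_linear[OF f] smooth_near_tendsto[OF holomorphic_near_smooth[OF H]]])
  then show "\<forall>\<^sub>F x in nhds a. \<exists>D. ((\<lambda>x. f (H x)) has_derivative D) (at x) \<and> (\<forall>v. D (\<i> *s v) = \<i> * D v)"
    using holomorphic_near_derivative[OF H]
  proof eventually_elim
    case (elim x)
    then obtain D where D: "(H has_derivative D) (at x)" "\<forall>c v. D (c *s v) = c *s D v" by (elim exE conjE)
    have "(f has_derivative fd f (at (H x))) (at (H x))" using elim(1) unfolding frechet_derivative_works by (elim conjE)
    from has_derivative_compose[OF D(1) this] show ?case
      using elim(1) D(2) by (intro exI[of _ "\<lambda>v. fd f (at (H x)) (D v)"] conjI) simp_all
  qed
qed

lemma scalar_partial_smooth: "smooth_near f a \<Longrightarrow> smooth_near (scalar_partial js f) a"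
  by (induction js) (auto intro: smooth_near_fd)

lemma scalar_partial_diff:
  assumes "smooth_near f a" "smooth_near g a"
  shows "\<forall>\<^sub>F x in nhds a. scalar_partial js (\<lambda>x. f x - g x) x = scalar_partial js f x - scalar_partial js g x"
proof (induction js)
  case Nil
  then show ?case by simp
next
  case (Cons j js)
  let ?f = "scalar_partial js f" and ?g = "scalar_partial js g"
  have "\<forall>\<^sub>F x in nhds a. \<forall>\<^sub>F y in nhds x. scalar_partial js (\<lambda>x. f x - g x) y = ?f y - ?g y"
    using Cons by (simp add: eventually_eventually)
  then show ?case
    using smooth_near_differentiable[OF scalar_partial_smooth[OF assms(1), of js]]
      smooth_near_differentiable[OF scalar_partial_smooth[OF assms(2), of js]]
  proof eventually_elim
    case (elim x)
    have "((\<lambda>y. ?f y - ?g y) has_derivative (\<lambda>v. fd ?f (at x) v - fd ?g (at x) v)) (at x)"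
      by (intro has_derivative_diff elim(2,3)[unfolded frechet_derivative_works])
    from fd_eqI[OF this] fd_cong_eventually[OF elim(1)] show ?case by simp
  qed
qed

lemma jet_eq_scalar_partials:
  fixes f g :: "complex^'n \<Rightarrow> complex^'m"
  assumes "smooth_near f a" "smooth_near g a"
  shows "jet k f a = jet k g a \<longleftrightarrow>
    (\<forall>js i. length js \<le> k \<longrightarrow> scalar_partial js (\<lambda>x. f x $ i - g x $ i) a = 0)"
proof -
  have c: "partial_derivs js f a $ i = scalar_partial js (\<lambda>x. f x $ i) a" if "smooth_near f a"
    for js i and f :: "complex^'n \<Rightarrow> complex^'m"
    using eventually_nhds_x_imp_x[OF partial_derivs_component[OF that, of js, THEN conjunct2]] by simp
  have d: "scalar_partial js (\<lambda>x. f x $ i - g x $ i) a = partial_derivs js f a $ i - partial_derivs js g a $ i" for js i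
    unfolding c[OF assms(1)] c[OF assms(2)]
    by (rule eventually_nhds_x_imp_x[OF scalar_partial_diff]) (intro smooth_near_component assms)+
  have "jet k f a = jet k g a \<longleftrightarrow> (\<forall>js. length js \<le> k \<longrightarrow> partial_derivs js f a = partial_derivs js g a)"
    unfolding jet_def fun_eq_iff by (intro iff_allI) simp
  then show ?thesis unfolding d by (simp add: vec_eq_iff)
qed

lemma Hadamard_holomorphic:
  fixes H1 H2 :: "complex^'n \<Rightarrow> complex^'m"
  assumes f: "hol_near f 0" and H: "smooth_near H1 0" "smooth_near H2 0" "H1 0 = 0" "H2 0 = 0"
  shows "\<exists>t. (\<forall>j. smooth_near (t j) 0) \<and> (\<forall>j. t j 0 = fd f (at 0) (axis j 1)) \<and>
    (\<forall>\<^sub>F Z in nhds 0. f (H1 Z) - f (H2 Z) = (\<Sum>j\<in>UNIV. t j Z * (H1 Z $ j - H2 Z $ j)))"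
proof -
  have J: "\<forall>\<^sub>F y in nhds 0. \<forall>e. fd f (at y) (\<i> *s e) = \<i> * fd f (at y) e"
    using hol_near_complex_linear[OF f] by eventually_elim (erule conjunct2)
  obtain I where I': "\<forall>e. smooth_near (I e) 0" "\<forall>e. I e 0 = fd f (at 0) e"
    "\<forall>\<^sub>F x in nhds 0. linear (\<lambda>e. I e x) \<and> (\<forall>e. I (\<i> *s e) x = \<i> * I e x) \<and>
       f (H1 x) - f (H2 x) = I (H1 x - H2 x) x"
    using Hadamard_difference[OF hol_near_smooth[OF f] H J] by (elim exE conjE)
  note I = I'(1)[rule_format] I'(2)[rule_format] I'(3)
  have "\<forall>\<^sub>F Z in nhds 0. f (H1 Z) - f (H2 Z) = (\<Sum>j\<in>UNIV. I (axis j 1) Z * (H1 Z $ j - H2 Z $ j))"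
    using I(3)
  proof eventually_elim
    case (elim Z)
    have "I (H1 Z - H2 Z) Z = (\<Sum>j\<in>UNIV. (H1 Z - H2 Z) $ j * I (axis j 1) Z)"
      by (rule complex_linear_expand[where D = "\<lambda>e. I e Z"]) (use elim in simp_all)
    then show ?case using elim by (simp add: mult.commute)
  qed
  then show ?thesis using I(1,2) by (intro exI[of _ "\<lambda>j. I (axis j 1)"] conjI allI)
qed

lemma Hadamard_holomorphic2:
  fixes H1 H2 :: "complex^'n \<Rightarrow> complex^'m"
  assumes f: "open S" "(0, 0) \<in> S" "hol_on \<i>_pair f S"
    and H: "smooth_near H1 0" "smooth_near H2 0" "H1 0 = 0" "H2 0 = 0"
  shows "\<exists>P Q. (\<forall>j. smooth_near (P j) 0) \<and> (\<forall>j. smooth_near (Q j) 0) \<and>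
    (\<forall>j. P j 0 = fd f (at (0, 0)) (axis j 1, 0)) \<and>
    (\<forall>\<^sub>F Z in nhds 0. f (H1 Z, vcnj (H1 Z)) - f (H2 Z, vcnj (H2 Z)) =
       (\<Sum>j\<in>UNIV. P j Z * (H1 Z $ j - H2 Z $ j)) + (\<Sum>j\<in>UNIV. Q j Z * cnj (H1 Z $ j - H2 Z $ j)))"
proof -
  have s: "smooth_near f (0, 0)" using hol_on_smooth[OF f(1,3)] f(1,2) unfolding smooth_near_iff by blast
  have J: "\<forall>\<^sub>F y in nhds (0, 0). \<forall>e. fd f (at y) (\<i>_pair e) = \<i> * fd f (at y) e"
    unfolding eventually_nhds using f(3) unfolding hol_on_def by (intro exI[of _ S] conjI f(1,2)) simp
  have e: "(H1 0, vcnj (H1 0)) = (0, 0)" "(H2 0, vcnj (H2 0)) = (0, 0)" by (simp_all add: H)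
  have w: "smooth_near (\<lambda>Z. (H Z, vcnj (H Z))) 0" if "smooth_near H 0" for H :: "complex^'n \<Rightarrow> complex^'m"
    by (intro smooth_near_Pair smooth_near_vcnj that)
  obtain I where I': "\<forall>e. smooth_near (I e) 0" "\<forall>e. I e 0 = fd f (at (0, 0)) e"
    "\<forall>\<^sub>F x in nhds 0. linear (\<lambda>e. I e x) \<and> (\<forall>e. I (\<i>_pair e) x = \<i> * I e x) \<and>
       f (H1 x, vcnj (H1 x)) - f (H2 x, vcnj (H2 x)) = I ((H1 x, vcnj (H1 x)) - (H2 x, vcnj (H2 x))) x"
    using Hadamard_difference[OF s w[OF H(1)] w[OF H(2)] e J] by (elim exE conjE)
  note I = I'(1)[rule_format] I'(2)[rule_format] I'(3)
  have "\<forall>\<^sub>F Z in nhds 0. f (H1 Z, vcnj (H1 Z)) - f (H2 Z, vcnj (H2 Z)) =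
       (\<Sum>j\<in>UNIV. I (axis j 1, 0) Z * (H1 Z $ j - H2 Z $ j)) + (\<Sum>j\<in>UNIV. I (0, axis j 1) Z * cnj (H1 Z $ j - H2 Z $ j))"
    using I(3)
  proof eventually_elim
    case (elim Z)
    have lin: "linear (\<lambda>e. I e Z)" and iI: "\<And>e. I (\<i>_pair e) Z = \<i> * I e Z"
      by (fact elim[THEN conjunct1], fact elim[THEN conjunct2, THEN conjunct1, rule_format])
    have split: "I (u, v) Z = I (u, 0) Z + I (0, v) Z" for u v
      using linear_add[OF lin, of "(u, 0)" "(0, v)"] by simp
    have l1: "linear (\<lambda>u. I (u, 0) Z)"
    proof (rule linearI)
      show "I (u + v, 0) Z = I (u, 0) Z + I (v, 0) Z" for u v using linear_add[OF lin, of "(u, 0)" "(v, 0)"] by simp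
      show "I (c *\<^sub>R u, 0) Z = c *\<^sub>R I (u, 0) Z" for c u using linear_scale[OF lin, of c "(u, 0)"] by simp
    qed
    have l2: "linear (\<lambda>v. I (0, v) Z)"
    proof (rule linearI)
      show "I (0, u + v) Z = I (0, u) Z + I (0, v) Z" for u v using linear_add[OF lin, of "(0, u)" "(0, v)"] by simp
      show "I (0, c *\<^sub>R u) Z = c *\<^sub>R I (0, u) Z" for c u using linear_scale[OF lin, of c "(0, u)"] by simp
    qed
    have i1: "I (\<i> *s u, 0) Z = \<i> * I (u, 0) Z" and i2: "I (0, \<i> *s u) Z = \<i> * I (0, u) Z" for u
      using iI[of "(u, 0)"] iI[of "(0, u)"] by (simp_all add: \<i>_pair_def)
    note f1 = complex_linear_expand[OF l1 i1] and f2 = complex_linear_expand[OF l2 i2]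
    have *: "I (u, v) Z = (\<Sum>j\<in>UNIV. u $ j * I (axis j 1, 0) Z) + (\<Sum>j\<in>UNIV. v $ j * I (0, axis j 1) Z)" for u v
      by (rule trans[OF split arg_cong2[where f = "(+)", OF f1 f2]])
    have "f (H1 Z, vcnj (H1 Z)) - f (H2 Z, vcnj (H2 Z)) = I (H1 Z - H2 Z, vcnj (H1 Z) - vcnj (H2 Z)) Z"
      using elim[THEN conjunct2, THEN conjunct2] by simp
    then show ?case unfolding *[of "H1 Z - H2 Z" "vcnj (H1 Z) - vcnj (H2 Z)"] by (simp add: mult.commute)
  qed
  then show ?thesis using I(1,2)
    by (intro exI[of _ "\<lambda>j. I (axis j 1, 0)"] exI[of _ "\<lambda>j. I (0, axis j 1)"] conjI allI)
qed

text \<open>The matrices \<open>E1\<close> and \<open>E2\<close> make up a left inverse of \<open>u \<mapsto> (t u, P u)\<close>. With a right inverse \<open>w\<close> of \<open>P\<close>, they arise from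
  the inverse of the endomorphism \<open>\<Phi> = t + w P\<close>, which is onto because, by transversality, \<open>t\<close> already maps
  \<open>ker P\<close> onto its range \<open>ker P\<close>.\<close>

lemma transversal_left_inverse:
  fixes t :: "complex^'m \<Rightarrow> complex^'m" and P :: "nat \<Rightarrow> complex^'m \<Rightarrow> complex"
  assumes t: "linear t" "\<And>c v. t (c *s v) = c *s t v"
    and P: "\<And>i u v. i < d \<Longrightarrow> P i (u + v) = P i u + P i v" "\<And>i c v. i < d \<Longrightarrow> P i (c *s v) = c * P i v"
    and w: "\<forall>i<d. \<forall>j<d. P i (w j) = of_bool (i = j)"
    and range: "range t = {v. \<forall>i<d. P i v = 0}"
    and trans: "{u + v | u v. t u = 0 \<and> (\<forall>i<d. P i v = 0)} = UNIV"
  obtains E1 :: "'m \<Rightarrow> 'm \<Rightarrow> complex" and E2 :: "'m \<Rightarrow> nat \<Rightarrow> complex" where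
    "\<forall>a j. (\<Sum>i\<in>UNIV. E1 a i * t (axis j 1) $ i) + (\<Sum>i<d. E2 a i * P i (axis j 1)) = (if a = j then 1 else 0)"
proof -
  define \<Phi> where "\<Phi> u = t u + (\<Sum>i<d. P i u *s w i)" for u
  have add: "\<Phi> (u + v) = \<Phi> u + \<Phi> v" for u v
  proof -
    have "(\<Sum>i<d. P i (u + v) *s w i) = (\<Sum>i<d. P i u *s w i) + (\<Sum>i<d. P i v *s w i)"
      unfolding sum.distrib[symmetric] by (intro sum.cong refl) (simp add: P vector_sadd_rdistrib)
    then show ?thesis by (simp add: \<Phi>_def linear_add[OF t(1)])
  qed
  have scale: "\<Phi> (c *s u) = c *s \<Phi> u" for c u
  proof -
    have "(\<Sum>i<d. P i (c *s u) *s w i) = c *s (\<Sum>i<d. P i u *s w i)"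
      unfolding vec.scale_sum_right by (intro sum.cong refl) (simp add: P)
    then show ?thesis by (simp add: \<Phi>_def t(2) vec.scale_right_distrib)
  qed
  have lin: "linear \<Phi>" by (intro linearI add) (simp add: scaleR_vec_smult scale)
  have Pw: "P i (\<Sum>j<d. c j *s w j) = c i" if "i < d" for i c
  proof -
    interpret Vector_Spaces.linear "(*s)" "(*)" "P i" using P that by (simp add: complex_linear_form_iff)
    have "P i (\<Sum>j<d. c j *s w j) = (\<Sum>j<d. c j * of_bool (i = j))"
      unfolding sum by (intro sum.cong refl) (use w that in \<open>simp only: scale, simp\<close>)
    then show ?thesis using sum_of_bool_mult[OF that] by simp
  qed
  have onto: "\<exists>s. t s = y \<and> (\<forall>i<d. P i s = 0)" if "\<forall>i<d. P i y = 0" for y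
  proof -
    have "y \<in> range t" using that range by blast
    then obtain x where x: "y = t x" by (elim imageE)
    have "x \<in> {u + v | u v. t u = 0 \<and> (\<forall>i<d. P i v = 0)}" unfolding trans by simp
    then obtain u v where "x = u + v" "t u = 0" "\<forall>i<d. P i v = 0" by (elim CollectE exE conjE)
    then show ?thesis using x linear_add[OF t(1), of u v] by (intro exI[of _ v]) simp
  qed
  have Pt: "P i (t x) = 0" if "i < d" for i x
  proof -
    have "t x \<in> {v. \<forall>i<d. P i v = 0}" unfolding range[symmetric] by (rule rangeI)
    then show ?thesis using that by simp
  qed
  have P_add_diff: "P i (x - y) = P i x - P i y" if "i < d" for i x y
    using P(1)[OF that, of "x - y" y] by simp
  have "surj \<Phi>"
    unfolding surj_def
  proof
    fix y
    \<comment> \<open>\<open>w'\<close> takes care of the values of \<open>P\<close>, and \<open>s \<in> ker P\<close> of the rest, including the term \<open>t w'\<close>.\<close>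
    define w' where "w' = (\<Sum>j<d. P j y *s w j)"
    have w': "P i w' = P i y" if "i < d" for i using Pw[OF that, of "\<lambda>j. P j y"] by (simp add: w'_def)
    have "\<forall>i<d. P i (y - w' - t w') = 0" using w' Pt by (simp add: P_add_diff)
    from onto[OF this] obtain s where s: "t s = y - w' - t w'" "\<forall>i<d. P i s = 0" by (elim exE conjE)
    have "(\<Sum>i<d. P i (s + w') *s w i) = (\<Sum>i<d. P i y *s w i)"
      by (intro sum.cong refl) (use s(2) w' P(1) in simp)
    then have "(\<Sum>i<d. P i (s + w') *s w i) = w'" unfolding w'_def[symmetric] .
    then have "\<Phi> (s + w') = y" by (simp add: \<Phi>_def linear_add[OF t(1)] s(1))
    then show "\<exists>x. y = \<Phi> x" by (intro exI[of _ "s + w'"]) (rule sym)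
  qed
  then have "inj \<Phi>" using linear_surjective_imp_injective[OF lin] by simp
  define g where "g = inv \<Phi>"
  have g\<Phi>: "g (\<Phi> u) = u" for u unfolding g_def using inv_f_f[OF \<open>inj \<Phi>\<close>] .
  have \<Phi>g: "\<Phi> (g y) = y" for y unfolding g_def using surj_f_inv_f[OF \<open>surj \<Phi>\<close>] .
  have g_add: "g (x + y) = g x + g y" for x y
    by (rule injD[OF \<open>inj \<Phi>\<close>]) (simp add: \<Phi>g add)
  have g_scale: "g (c *s x) = c *s g x" for c x
    by (rule injD[OF \<open>inj \<Phi>\<close>]) (simp add: \<Phi>g scale)
  have g_sum: "g (\<Sum>i\<in>I. h i) = (\<Sum>i\<in>I. g (h i))" if "finite I" for I :: "'b set" and h
    using that g_scale[of 0 0] by (induction I rule: finite_induct) (simp_all add: g_add)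
  have "(\<Sum>i\<in>UNIV. g (axis i 1) $ a * t (axis j 1) $ i) + (\<Sum>i<d. g (w i) $ a * P i (axis j 1)) = (if a = j then 1 else 0)"
    for a j
  proof -
    have "t (axis j 1) = (\<Sum>i\<in>UNIV. t (axis j 1) $ i *s axis i 1)" by (simp add: basis_expansion)
    then have "g (t (axis j 1)) = g (\<Sum>i\<in>UNIV. t (axis j 1) $ i *s axis i 1)" by (rule arg_cong)
    also have "\<dots> = (\<Sum>i\<in>UNIV. t (axis j 1) $ i *s g (axis i 1))" by (simp add: g_sum g_scale)
    finally have 1: "g (t (axis j 1)) = \<dots>" .
    have "axis j 1 = g (\<Phi> (axis j 1))" by (simp add: g\<Phi>)
    also have "\<dots> = (\<Sum>i\<in>UNIV. t (axis j 1) $ i *s g (axis i 1)) + (\<Sum>i<d. P i (axis j 1) *s g (w i))"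
      unfolding \<Phi>_def g_add 1 by (simp add: g_sum g_scale)
    finally have "axis j 1 $ a = ((\<Sum>i\<in>UNIV. t (axis j 1) $ i *s g (axis i 1)) + (\<Sum>i<d. P i (axis j 1) *s g (w i))) $ a"
      by (rule arg_cong)
    then show ?thesis by (simp add: axis_def mult.commute)
  qed
  then show thesis by (intro that[of "\<lambda>a i. g (axis i 1) $ a" "\<lambda>a i. g (w i) $ a"]) simp
qed

context generic_manifold begin

text \<open>A combination of two relations is solved for \<open>D\<close>: the one between jets holds to order \<open>k + 1\<close> because the
  \<open>k\<close>-jets agree, and the one from the equations of \<open>M'\<close> holds to every order along \<open>M\<close>.\<close>

lemma conj_relation_of_maps:
  fixes H1 H2 :: "complex^'n \<Rightarrow> complex^'m"
  assumes M': "generic_submanifold d' \<rho>' M'"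
    and H1: "holomorphic_near H1 0" "H1 0 = 0" "sends_germ_into H1 M M'"
    and H2: "holomorphic_near H2 0" "H2 0 = 0" "sends_germ_into H2 M M'"
    and zt: "submersion_onto_segre d' \<rho>' U' zt" "fibre_transversal_to_segre d' \<rho>' zt"
    and jets: "jet k (zt \<circ> H1) 0 = jet k (zt \<circ> H2) 0"
  shows "conj_relation (Suc k) (\<lambda>j Z. H1 Z $ j - H2 Z $ j)"
proof -
  interpret N: generic_manifold d' \<rho>' M' by unfold_locales (rule M')
  note s1 = holomorphic_near_smooth[OF H1(1)] and s2 = holomorphic_near_smooth[OF H2(1)]
  have zth: "holomorphic_near zt 0" and zt0: "zt 0 = 0" using zt(1) unfolding submersion_onto_segre_def by simp_all
  define D where "D j Z = H1 Z $ j - H2 Z $ j" for j Z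

  \<comment> \<open>First relation: \<open>zt \<circ> H1 - zt \<circ> H2\<close> vanishes to high order.\<close>
  define G where "G i Z = zt (H1 Z) $ i - zt (H2 Z) $ i" for i Z
  have hz: "hol_near (\<lambda>Z. zt (H Z) $ i) 0" if "holomorphic_near H 0" "H 0 = 0" for H :: "complex^'n \<Rightarrow> complex^'m" and i
    by (rule hol_near_compose[of "\<lambda>w. zt w $ i" H, OF _ that(1)]) (simp add: that(2) holomorphic_near_component[OF zth])
  have vG: "vanishes T (Suc k) (G i)" for i
  proof (rule vanishes_if_partials_vanish)
    show "hol_near (G i) 0" unfolding G_def by (intro hol_near_diff hz H1 H2)
    have s: "smooth_near (zt \<circ> H1) 0" "smooth_near (zt \<circ> H2) 0"
      unfolding o_def by (intro smooth_near_vec hol_near_smooth hz H1 H2)+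
    show "scalar_partial js (G i) 0 = 0" if "length js < Suc k" for js
      using jets[unfolded jet_eq_scalar_partials[OF s], rule_format, of js i] that by (simp add: G_def[abs_def])
  qed
  have "\<forall>i. \<exists>t. (\<forall>j. smooth_near (t j) 0) \<and> (\<forall>j. t j 0 = fd (\<lambda>w. zt w $ i) (at 0) (axis j 1)) \<and>
    (\<forall>\<^sub>F Z in nhds 0. G i Z = (\<Sum>j\<in>UNIV. t j Z * D j Z))"
    unfolding G_def D_def
    by (intro allI Hadamard_holomorphic holomorphic_near_component zth s1 s2 H1 H2)
  then obtain t where t': "\<forall>i. (\<forall>j. smooth_near (t i j) 0) \<and> (\<forall>j. t i j 0 = fd (\<lambda>w. zt w $ i) (at 0) (axis j 1)) \<and>
    (\<forall>\<^sub>F Z in nhds 0. G i Z = (\<Sum>j\<in>UNIV. t i j Z * D j Z))"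
    by (drule_tac choice) (elim exE)
  have t: "smooth_near (t i j) 0" "t i j 0 = fd (\<lambda>w. zt w $ i) (at 0) (axis j 1)"
    "\<forall>\<^sub>F Z in nhds 0. G i Z = (\<Sum>j\<in>UNIV. t i j Z * D j Z)" for i j
    using t' by simp_all

  \<comment> \<open>Second relation: the defining functions of \<open>M'\<close> agree along \<open>H1\<close> and \<open>H2\<close> on \<open>M\<close>.\<close>
  define R where "R i Z = N.r i (H1 Z) - N.r i (H2 Z)" for i Z
  have sr: "smooth_near (\<lambda>Z. N.r i (H Z)) 0" if "i < d'" "smooth_near H 0" "H 0 = 0"
    for H :: "complex^'n \<Rightarrow> complex^'m" and i
    by (rule smooth_near_compose[of "N.r i" H, OF _ that(2)]) (simp add: that(3) N.goodD(1)[OF N.good_at_0 that(1)])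
  have r0: "\<forall>\<^sub>F Z in nhds 0. Z \<in> M \<longrightarrow> (\<forall>i<d'. N.r i (H Z) = 0)"
    if "smooth_near H 0" "H 0 = 0" "sends_germ_into H M M'" for H :: "complex^'n \<Rightarrow> complex^'m"
  proof -
    have "filterlim H (nhds 0) (nhds 0)" using smooth_near_tendsto[OF that(1)] that(2) by simp
    from eventually_compose_filterlim[OF N.eventually_good this] that(3)[unfolded sends_germ_into_def]
    show ?thesis by eventually_elim (simp add: N.good_in_M_iff)
  qed
  have vR: "vanishes T l (R i)" if "i < d'" for i l
  proof (rule vanishes_if_zero_on_M)
    have "smooth_near (\<lambda>Z. N.r i (H1 Z) + (- 1) * N.r i (H2 Z)) 0"
      by (intro smooth_near_add smooth_near_mult smooth_near_const sr that s1 s2 H1 H2)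
    then show "smooth_near (R i) 0" by (simp add: R_def[abs_def])
    show "\<forall>\<^sub>F Z in nhds 0. Z \<in> M \<longrightarrow> R i Z = 0"
      using r0[OF s1 H1(2,3)] r0[OF s2 H2(2,3)] by eventually_elim (simp add: R_def that)
  qed
  have "\<exists>P Q. (\<forall>j. smooth_near (P j) 0) \<and> (\<forall>j. smooth_near (Q j) 0) \<and> (\<forall>j. P j 0 = N.A i 0 (axis j 1)) \<and>
    (\<forall>\<^sub>F Z in nhds 0. R i Z = (\<Sum>j\<in>UNIV. P j Z * D j Z) + (\<Sum>j\<in>UNIV. Q j Z * cnj (D j Z)))" if "i < d'" for i
  proof -
    let ?f = "\<lambda>w. \<rho>' i (fst w) (snd w)"
    have "holomorphic2_near (\<rho>' i) (0, 0)" using M' that unfolding generic_submanifold_def by simp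
    then obtain S where S: "open S" "(0, 0) \<in> S" "hol_on \<i>_pair ?f S" by (rule holomorphic2_near_local)
    have "?f differentiable (at (0, 0))" using S(2,3) unfolding hol_on_def by simp
    then have "(?f has_derivative fd ?f (at (0, 0))) (at (0, 0))" unfolding frechet_derivative_works .
    from has_derivative_compose[OF has_derivative_Pair[OF has_derivative_ident has_derivative_const] this]
    have "((\<lambda>Z. \<rho>' i Z 0) has_derivative (\<lambda>v. fd ?f (at (0, 0)) (v, 0))) (at 0)" by simp
    from fd_eqI[OF this] have A: "N.A i 0 v = fd ?f (at (0, 0)) (v, 0)" for v
      unfolding N.A_def dZ_def by simp
    show ?thesis
      using Hadamard_holomorphic2[OF S s1 s2 H1(2) H2(2)] unfolding A R_def D_def N.r_def by simp
  qed
  then have "\<forall>i\<in>{..<d'}. \<exists>P Q. (\<forall>j. smooth_near (P j) 0) \<and> (\<forall>j. smooth_near (Q j) 0) \<and> (\<forall>j. P j 0 = N.A i 0 (axis j 1)) \<and>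
    (\<forall>\<^sub>F Z in nhds 0. R i Z = (\<Sum>j\<in>UNIV. P j Z * D j Z) + (\<Sum>j\<in>UNIV. Q j Z * cnj (D j Z)))" by simp
  then obtain P where "\<forall>i\<in>{..<d'}. \<exists>Q. (\<forall>j. smooth_near (P i j) 0) \<and> (\<forall>j. smooth_near (Q j) 0) \<and> (\<forall>j. P i j 0 = N.A i 0 (axis j 1)) \<and>
    (\<forall>\<^sub>F Z in nhds 0. R i Z = (\<Sum>j\<in>UNIV. P i j Z * D j Z) + (\<Sum>j\<in>UNIV. Q j Z * cnj (D j Z)))"
    by (drule_tac bchoice) (elim exE)
  then obtain Q where PQ': "\<forall>i\<in>{..<d'}. (\<forall>j. smooth_near (P i j) 0) \<and> (\<forall>j. smooth_near (Q i j) 0) \<and> (\<forall>j. P i j 0 = N.A i 0 (axis j 1)) \<and>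
    (\<forall>\<^sub>F Z in nhds 0. R i Z = (\<Sum>j\<in>UNIV. P i j Z * D j Z) + (\<Sum>j\<in>UNIV. Q i j Z * cnj (D j Z)))"
    by (drule_tac bchoice) (elim exE)
  have PQ: "smooth_near (P i j) 0" "smooth_near (Q i j) 0" "P i j 0 = N.A i 0 (axis j 1)"
    "\<forall>\<^sub>F Z in nhds 0. R i Z = (\<Sum>j\<in>UNIV. P i j Z * D j Z) + (\<Sum>j\<in>UNIV. Q i j Z * cnj (D j Z))" if "i < d'" for i j
    using PQ' that by simp_all

  \<comment> \<open>Transversality: the coefficients of \<open>D\<close> in the two relations have a left inverse at \<open>0\<close>.\<close>
  obtain T0 where T0: "(zt has_derivative T0) (at 0)" "\<forall>c v. T0 (c *s v) = c *s T0 v"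
    using eventually_nhds_x_imp_x[OF holomorphic_near_derivative[OF zth]] by (elim exE conjE)
  have T0fd: "fd zt (at 0) = T0" by (rule fd_eqI[OF T0(1)])
  have T0c: "T0 v $ i = fd (\<lambda>w. zt w $ i) (at 0) v" for v i
    using fd_eqI[OF bounded_linear.has_derivative[OF bounded_linear_vec_nth T0(1)], of i] by simp
  have segre: "segre_tangent_space d' \<rho>' 0 0 = {v. \<forall>i<d'. N.A i 0 v = 0}"
    unfolding segre_tangent_space_def N.A_def by simp
  have "\<forall>\<^sub>F Z in nhds 0. range (fd zt (at Z)) = segre_tangent_space d' \<rho>' 0 (zt Z)"
    using zt(1) unfolding submersion_onto_segre_def by simp
  from eventually_nhds_x_imp_x[OF this] have range: "range T0 = {v. \<forall>i<d'. N.A i 0 v = 0}"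
    by (simp add: zt0 T0fd segre)
  have trans: "{u + v | u v. T0 u = 0 \<and> (\<forall>i<d'. N.A i 0 v = 0)} = UNIV"
    using zt(2) unfolding fibre_transversal_to_segre_def T0fd segre by simp
  obtain w where w: "\<forall>i<d'. \<forall>j<d'. N.A i 0 (w j) = of_bool (i = j)"
    using N.good_dual_vectors[OF N.good_at_0] by (elim exE)
  obtain E1 :: "'m \<Rightarrow> 'm \<Rightarrow> complex" and E2 where
    E: "\<forall>a j. (\<Sum>i\<in>UNIV. E1 a i * T0 (axis j 1) $ i) + (\<Sum>i<d'. E2 a i * N.A i 0 (axis j 1)) = (if a = j then 1 else 0)"
    by (rule transversal_left_inverse[OF has_derivative_linear[OF T0(1)] T0(2)[rule_format]
          N.goodD(5)[OF N.good_at_0] N.goodD(6)[OF N.good_at_0] w range trans])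

  define K where "K a j Z = (if a = j then 1 else 0) + (- 1) * ((\<Sum>i\<in>UNIV. E1 a i * t i j Z) + (\<Sum>i<d'. E2 a i * P i j Z))" for a j Z
  define B where "B a j Z = (\<Sum>i<d'. (- E2 a i) * Q i j Z)" for a j Z
  have "conj_relation (Suc k) D"
  proof (rule conj_relationI[of D K B])
    show "hol_near (D j) 0" for j
      unfolding D_def by (intro hol_near_diff holomorphic_near_component H1 H2)
    show "smooth_near (K a j) 0" "smooth_near (B a j) 0" for a j
      unfolding K_def B_def
      by (intro smooth_near_add smooth_near_mult smooth_near_const smooth_near_sum t PQ; simp)+
    show "K a j 0 = 0" for a j
    proof -
      have "(\<Sum>i\<in>UNIV. E1 a i * t i j 0) + (\<Sum>i<d'. E2 a i * P i j 0) =
         (\<Sum>i\<in>UNIV. E1 a i * T0 (axis j 1) $ i) + (\<Sum>i<d'. E2 a i * N.A i 0 (axis j 1))"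
        by (intro arg_cong2[where f = "(+)"] sum.cong refl) (simp_all add: t(2) T0c PQ(3))
      then show ?thesis unfolding K_def E[rule_format] by simp
    qed
    show "vanishes T (Suc k) (\<lambda>Z. D a Z - (\<Sum>j\<in>UNIV. K a j Z * D j Z) - (\<Sum>j\<in>UNIV. B a j Z * cnj (D j Z)))" for a
    proof (rule vanishes_cong)
      show "vanishes T (Suc k) (\<lambda>Z. (\<Sum>i\<in>UNIV. E1 a i * G i Z) + (\<Sum>i<d'. E2 a i * R i Z))"
        by (intro vanishes_add vanishes_sum vanishes_mult smooth_near_const vG vR) simp
      have "\<forall>\<^sub>F Z in nhds 0. \<forall>i\<in>UNIV. G i Z = (\<Sum>j\<in>UNIV. t i j Z * D j Z)"
        by (intro eventually_ball_finite finite ballI t(3))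
      moreover have "\<forall>\<^sub>F Z in nhds 0. \<forall>i\<in>{..<d'}. R i Z = (\<Sum>j\<in>UNIV. P i j Z * D j Z) + (\<Sum>j\<in>UNIV. Q i j Z * cnj (D j Z))"
        by (intro eventually_ball_finite finite_lessThan ballI PQ(4)) simp
      ultimately show "\<forall>\<^sub>F Z in nhds 0. (\<Sum>i\<in>UNIV. E1 a i * G i Z) + (\<Sum>i<d'. E2 a i * R i Z) =
         D a Z - (\<Sum>j\<in>UNIV. K a j Z * D j Z) - (\<Sum>j\<in>UNIV. B a j Z * cnj (D j Z))"
      proof eventually_elim
        case (elim Z)
        have 1: "(\<Sum>i\<in>UNIV. E1 a i * G i Z) = (\<Sum>j\<in>UNIV. (\<Sum>i\<in>UNIV. E1 a i * t i j Z) * D j Z)"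
        proof -
          have "(\<Sum>i\<in>UNIV. E1 a i * G i Z) = (\<Sum>i\<in>UNIV. \<Sum>j\<in>UNIV. E1 a i * t i j Z * D j Z)"
            using elim(1) by (simp add: sum_distrib_left mult.assoc)
          also have "\<dots> = (\<Sum>j\<in>UNIV. \<Sum>i\<in>UNIV. E1 a i * t i j Z * D j Z)" by (rule sum.swap)
          finally show ?thesis by (simp only: sum_distrib_right)
        qed
        have 2: "(\<Sum>i<d'. E2 a i * (\<Sum>j\<in>UNIV. V i j Z * W j)) = (\<Sum>j\<in>UNIV. (\<Sum>i<d'. E2 a i * V i j Z) * W j)"
          for V :: "nat \<Rightarrow> 'm \<Rightarrow> complex^'n \<Rightarrow> complex" and W
        proof -
          have "(\<Sum>i<d'. E2 a i * (\<Sum>j\<in>UNIV. V i j Z * W j)) = (\<Sum>i<d'. \<Sum>j\<in>UNIV. E2 a i * V i j Z * W j)"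
            by (simp only: sum_distrib_left mult.assoc)
          also have "\<dots> = (\<Sum>j\<in>UNIV. \<Sum>i<d'. E2 a i * V i j Z * W j)" by (rule sum.swap)
          finally show ?thesis by (simp only: sum_distrib_right)
        qed
        have 3: "(\<Sum>i<d'. E2 a i * R i Z) = (\<Sum>j\<in>UNIV. (\<Sum>i<d'. E2 a i * P i j Z) * D j Z)
            + (\<Sum>j\<in>UNIV. (\<Sum>i<d'. E2 a i * Q i j Z) * cnj (D j Z))"
        proof -
          have "(\<Sum>i<d'. E2 a i * R i Z) = (\<Sum>i<d'. E2 a i * (\<Sum>j\<in>UNIV. P i j Z * D j Z) + E2 a i * (\<Sum>j\<in>UNIV. Q i j Z * cnj (D j Z)))"
            using elim(2) by (intro sum.cong refl) (simp add: distrib_left)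
          then show ?thesis
            unfolding sum.distrib 2[of P "\<lambda>j. D j Z"] 2[of Q "\<lambda>j. cnj (D j Z)"] .
        qed
        have 4: "(\<Sum>j\<in>UNIV. B a j Z * cnj (D j Z)) = - (\<Sum>j\<in>UNIV. (\<Sum>i<d'. E2 a i * Q i j Z) * cnj (D j Z))"
          by (simp add: B_def sum_negf)
        have 5: "(\<Sum>j\<in>UNIV. K a j Z * D j Z) = D a Z - (\<Sum>j\<in>UNIV. (\<Sum>i\<in>UNIV. E1 a i * t i j Z) * D j Z)
            - (\<Sum>j\<in>UNIV. (\<Sum>i<d'. E2 a i * P i j Z) * D j Z)"
        proof -
          have "(\<Sum>j\<in>UNIV. K a j Z * D j Z) = (\<Sum>j\<in>UNIV. (if a = j then D j Z else 0) -
            (\<Sum>i\<in>UNIV. E1 a i * t i j Z) * D j Z - (\<Sum>i<d'. E2 a i * P i j Z) * D j Z)"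
            by (intro sum.cong refl) (simp add: K_def distrib_right left_diff_distrib)
          then show ?thesis by (simp add: sum_subtractf)
        qed
        show ?case unfolding 1 3 4 5 by simp
      qed
    qed
  qed
  then show ?thesis unfolding D_def[abs_def] .
qed

end

section \<open>Finite determination\<close>

theorem theorem5p1:
  fixes M :: "(complex^'n) set" and M' :: "(complex^'m) set"
    and d d' :: nat
    and \<rho> :: "nat \<Rightarrow> complex^'n \<Rightarrow> complex^'n \<Rightarrow> complex"
    and \<rho>' :: "nat \<Rightarrow> complex^'m \<Rightarrow> complex^'m \<Rightarrow> complex"
    and U' :: "(complex^'m) set"
    and F :: "(complex^'n \<Rightarrow> complex^'m) set"
  assumes "generic_submanifold d \<rho> M"
    and "generic_submanifold d' \<rho>' M'"
    and "finite_type_at_0 d \<rho> M"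
    and "open U'" and "0 \<in> U'"
    and "\<And>H. H \<in> F \<Longrightarrow> holomorphic_near H 0 \<and> H 0 = 0 \<and> sends_germ_into H M M'"
    and "finite_jet_determination F 0"
  shows "\<exists>k>0. \<forall>zt. submersion_onto_segre d' \<rho>' U' zt \<and> fibre_transversal_to_segre d' \<rho>' zt \<longrightarrow>
           (\<forall>H1\<in>F. \<forall>H2\<in>F. jet k (zt \<circ> H1) 0 = jet k (zt \<circ> H2) 0 \<longrightarrow> germ_eq H1 H2 0)"
proof -
  interpret generic_manifold d \<rho> M by unfold_locales (rule assms(1))
  obtain k0 where k0: "\<forall>H1\<in>F. \<forall>H2\<in>F. jet k0 H1 0 = jet k0 H2 0 \<longrightarrow> germ_eq H1 H2 0"
    using assms(7) unfolding finite_jet_determination_def by (elim exE)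
  obtain m where m: "\<forall>x\<in>complexified_tangent_space d \<rho> 0. \<exists>Y\<in>T. Y 0 = x \<and>
    (\<forall>k (D :: 'm \<Rightarrow> complex^'n \<Rightarrow> complex). conj_relation k D \<longrightarrow> linear_system (k - m) Y D)"
    using finite_type_uniform_loss[OF assms(3)] .
  have span: "\<exists>Y\<in>T. fst (Y 0) = axis j 1" for j
  proof -
    obtain b where "(axis j 1, b) \<in> complexified_tangent_space d \<rho> 0" using tangent_vector_with_1_0_part .
    from m[rule_format, OF this] obtain Y where "Y \<in> T" "Y 0 = (axis j 1, b)" by (elim bexE conjE)
    then show ?thesis by (intro bexI[of _ Y]) simp_all
  qed
  have "germ_eq H1 H2 0" if zt: "submersion_onto_segre d' \<rho>' U' zt" "fibre_transversal_to_segre d' \<rho>' zt"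
    and H: "H1 \<in> F" "H2 \<in> F" and jets: "jet (Suc (k0 + m)) (zt \<circ> H1) 0 = jet (Suc (k0 + m)) (zt \<circ> H2) 0"
    for zt H1 H2
  proof -
    note h1 = assms(6)[OF H(1)] and h2 = assms(6)[OF H(2)]
    define D where "D j Z = H1 Z $ j - H2 Z $ j" for j Z
    have rel: "conj_relation (Suc (Suc (k0 + m))) D"
      unfolding D_def using h1 h2 by (intro conj_relation_of_maps[OF assms(2) _ _ _ _ _ _ zt jets]) simp_all
    have hol: "hol_near (D j) 0" for j using conj_relation_hol[OF rel] .
    have D0: "D j 0 = 0" for j using h1 h2 by (simp add: D_def)
    have sys: "\<forall>x\<in>complexified_tangent_space d \<rho> 0. \<exists>Y\<in>T. Y 0 = x \<and> linear_system (Suc (Suc (k0 + m)) - m) Y D"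
    proof
      fix x assume "x \<in> complexified_tangent_space d \<rho> 0"
      from m[rule_format, OF this] obtain Y where Y: "Y \<in> T" "Y 0 = x"
        "\<forall>k (D :: 'm \<Rightarrow> complex^'n \<Rightarrow> complex). conj_relation k D \<longrightarrow> linear_system (k - m) Y D" by (elim bexE conjE)
      show "\<exists>Y\<in>T. Y 0 = x \<and> linear_system (Suc (Suc (k0 + m)) - m) Y D"
        using Y(1,2) Y(3)[rule_format, OF rel] by (intro bexI[of _ Y] conjI)
    qed
    have van: "vanishes T (Suc k0) (D j)" for j
      by (rule conj_relation_vanishes[OF sys hol_near_smooth[OF hol] D0]) simp
    have "scalar_partial js (D j) 0 = 0" if "length js \<le> k0" for js j
      by (rule partials_vanish_if_vanishes[OF span hol van]) (use that in simp)
    then have "jet k0 H1 0 = jet k0 H2 0"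
      using h1 h2 by (subst jet_eq_scalar_partials) (auto simp: D_def[abs_def] holomorphic_near_smooth)
    then show ?thesis using k0 H by simp
  qed
  then show ?thesis by (intro exI[of _ "Suc (k0 + m)"] conjI allI impI ballI) auto
qed

end
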